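(* Let $\mathcal{F}=\mathcal{F}_1\oplus\cdots\oplus\mathcal{F}_d$ be the class of additive functions $f(x)=f_1(x_1)+\cdots+f_d(x_d)$, $x\in[0,1]^d$, with $f_k\in\mathcal{F}_k$, where $$\mathcal{F}_k=\Big\{\sum_{j=1}^\infty\theta_{kj}\phi_{kj}:\ \sum_{j=1}^\infty a_{kj}^2\theta_{kj}^2\le L_k^2\Big\},\qquad \phi_{kj}(t)=\sqrt2\cos(2\pi jt),\ t\in[0,1],$$ with $L_k>0$, and assume that there are positive constants $C_0,C_1$ and $s_k>0$ with $C_0j^{s_k}\le a_{kj}\le C_1j^{s_k}$ for $j\ge1$, $k=1,\ldots,d$. Let $A$ be the convolution operator $Af=a*f$ with known $a$, and assume that the marginal functions $a_k$ of $a$ are 1-periodic functions in $L_2([0,1])$ with expansions $a_k=\sum_{j=0}^\infty b_{kj}\phi_{kj}$ (where $\phi_{k0}\equiv1$) whose Fourier coefficients satisfy $$C_2j^{-q_k}\le b_{kj}\le C_3j^{-q_k},\qquad j\ge1,$$ for some $q_k\ge0$, $C_2,C_3>0$. Let $$\alpha=\min_{k=1,\ldots,d}\frac{2s_k}{2s_k+2q_k+1}.$$ Then, in the Gaussian white noise model, $$\limsup_{n\to\infty}n^{\alpha}\sup_{f\in\mathcal{F}}E_f\|\hat f-f\|_2^2<\infty,$$ where $\hat f$ is the $\delta$-net estimator (over the net described in the context). Also, $$\liminf_{n\to\infty}n^{\alpha}\inf_{\hat g}\sup_{f\in\mathcal{F}}E_f\|\hat g-f\|_2^2>0,$$ where the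 infimum is taken over all estimators $\hat g$ in the white noise model.
   Context: Convolution of additive functions: for $f(x)=\sum_kf_k(x_k)$, $Af=A_1f_1+\cdots+A_df_d$ with $A_kf_k(x_k)=\int_0^1f_k(x_k-y_k)a_k(y_k)\,dy_k$ (1-periodic convolution), where $a_k(y_k)=\int_{[0,1]^{d-1}}a(y)\prod_{l\ne k}dy_l$ is the $k$th marginal function of $a$. $\|\cdot\|_2$ is the $L_2([0,1]^d)$ norm. The additive components are normed by $\int f_k=0$. Gaussian white noise model: one observes $dY_n(y)=(Af)(y)\,dy+n^{-1/2}dW(y)$ on $\mathbf{Y}=[0,1]^d$, i.e. $\int h\,dY_n=\int h\,(Af)+n^{-1/2}\int h\,dW$ for $h\in L_2(\mathbf{Y})$, where $(\int h_1dW,\int h_2dW)$ is mean-zero Gaussian with variances $\|h_1\|_2^2,\|h_2\|_2^2$ and covariance $\int h_1h_2$. $E_f$ is expectation under $f$; estimators are measurable functions of the observed process. $\delta$-net estimator: $\hat f=\arg\min_{\phi\in\mathcal{F}_\delta}\gamma_n(\phi)$, where $\gamma_n(g)=-2\int(Qg)\,dY_n+\|g\|_2^2$ and $Q=(A^{-1})^*$ is the adjoint of the inverse of $A$ (so $\int fg=\int(Af)(Qg)$ for additive $f,g$). The net is $\mathcal{F}_\delta=\mathcal{F}_{1,\delta_1}\oplus\cdots\oplus\mathcal{F}_{d,\delta_d}$ (the set of sums of one element from each), with $\delta_k=n^{-s_k/(2s_k+2q_k+1)}$ and $\delta=\sum_k\delta_k$, where $\mathcal{F}_{k,\delta_k}$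 is a finite $\delta_k$-net of $\mathcal{F}_k$ in $L_2$ (each element of $\mathcal{F}_k$ is within distance $\delta_k$ of the net), whose elements have $\theta_{kj}=0$ for $j>M_k$ with $M_k\asymp\delta_k^{-1/s_k}$, and $\log(\#\mathcal{F}_{k,\delta_k})\le C\delta_k^{-1/s_k}$ with $C$ not depending on $n$. *)

theory Defs
  imports "HOL-Probability.Probability" "HOL-Library.Landau_Symbols"
begin

text \<open>Elements of $L_2(M)$ are represented by square integrable functions, not by
  equivalence classes; all notions below are invariant under almost everywhere equality.\<close>

definition l2 :: "'a measure \<Rightarrow> ('a \<Rightarrow> real) set" where
  "l2 M = {f \<in> borel_measurable M. integrable M (\<lambda>x. (f x)\<^sup>2)}"

definition l2_inner :: "'a measure \<Rightarrow> ('a \<Rightarrow> real) \<Rightarrow> ('a \<Rightarrow> real) \<Rightarrow> real" where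
  "l2_inner M f g = (\<integral>x. f x * g x \<partial>M)"

definition l2_norm :: "'a measure \<Rightarrow> ('a \<Rightarrow> real) \<Rightarrow> real" where
  "l2_norm M f = sqrt (\<integral>x. (f x)\<^sup>2 \<partial>M)"

definition l2_sums :: "'a measure \<Rightarrow> (nat \<Rightarrow> 'a \<Rightarrow> real) \<Rightarrow> ('a \<Rightarrow> real) \<Rightarrow> bool" where
  "l2_sums M g f \<longleftrightarrow>
     f \<in> l2 M \<and> (\<lambda>N. l2_norm M (\<lambda>x. f x - (\<Sum>j<N. g j x))) \<longlonglongrightarrow> 0"

text \<open>The Borel $\sigma$-algebra of $L_2(M)$: generated by the sets open for the
  $L_2$ seminorm.\<close>

definition l2_borel :: "'a measure \<Rightarrow> ('a \<Rightarrow> real) measure" where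
  "l2_borel M = sigma (l2 M)
     {U. U \<subseteq> l2 M \<and>
         (\<forall>g\<in>U. \<exists>r>0. \<forall>h\<in>l2 M. l2_norm M (\<lambda>x. h x - g x) < r \<longrightarrow> h \<in> U)}"

definition unit_ival :: "real measure" where
  "unit_ival = restrict_space lborel {0..1}"

text \<open>The dimension $d$ is the cardinality of the finite index type.\<close>

definition cube :: "('d::finite \<Rightarrow> real) measure" where
  "cube = (\<Pi>\<^sub>M k\<in>UNIV. unit_ival)"

definition phi :: "nat \<Rightarrow> real \<Rightarrow> real" where
  "phi j t = (if j = 0 then 1 else sqrt 2 * cos (2 * pi * real j * t))"

definition oplus :: "('d::finite \<Rightarrow> (real \<Rightarrow> real) set) \<Rightarrow> (('d \<Rightarrow> real) \<Rightarrow> real) set" where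
  "oplus S = {\<lambda>x. \<Sum>k\<in>UNIV. g k (x k) | g. \<forall>k. g k \<in> S k}"

text \<open>The coefficient sequences start at index 1.\<close>

definition ellipsoid :: "(nat \<Rightarrow> real) \<Rightarrow> real \<Rightarrow> (real \<Rightarrow> real) set" where
  "ellipsoid w L = {f. \<exists>\<theta>.
     l2_sums unit_ival (\<lambda>j t. \<theta> (Suc j) * phi (Suc j) t) f \<and>
     summable (\<lambda>j. (w (Suc j))\<^sup>2 * (\<theta> (Suc j))\<^sup>2) \<and>
     (\<Sum>j. (w (Suc j))\<^sup>2 * (\<theta> (Suc j))\<^sup>2) \<le> L\<^sup>2}"

definition marginal :: "(('d::finite \<Rightarrow> real) \<Rightarrow> real) \<Rightarrow> 'd \<Rightarrow> real \<Rightarrow> real" where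
  "marginal a k t = (\<integral>y. a (y(k := t)) \<partial>(\<Pi>\<^sub>M l\<in>UNIV - {k}. unit_ival))"

text \<open>Periodic convolution $a * f$: applying \<open>frac\<close> to the coordinates of $x - y$ evaluates
  the 1-periodic extension of $f$. For integrable $a$ and additive
  $f(x) = \sum_k f_k(x_k)$ in $L_2$, Fubini's theorem shows that $(a * f)(x)$ is, for almost
  every $x$, the sum over $k$ of the one-dimensional periodic convolutions of $f_k$ with the
  marginals of $a$.\<close>

definition conv :: "(('d::finite \<Rightarrow> real) \<Rightarrow> real) \<Rightarrow> (('d \<Rightarrow> real) \<Rightarrow> real) \<Rightarrow> ('d \<Rightarrow> real) \<Rightarrow> real"
  where "conv a f x = (\<integral>y. f (\<lambda>k. frac (x k - y k)) * a y \<partial>cube)"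

definition additive_l2 :: "(('d::finite \<Rightarrow> real) \<Rightarrow> real) set" where
  "additive_l2 = oplus (\<lambda>k. {g \<in> l2 unit_ival. (\<integral>t. g t \<partial>unit_ival) = 0})"

text \<open>The adjoint of the inverse of $A = a * \cdot$ as an operator in the Hilbert space of
  additive functions with centred components: $Qg$ is the element $u$ of that space with
  $\langle A^{-1} v, g\rangle = \langle v, u\rangle$ for all $v = Af$ in the range of $A$.
  It is unique up to null sets when $A$ has dense range. It need not exist
  for all $g$, because $A^{-1}$ may be unbounded; in that case the value is unspecified.\<close>

definition inv_adjoint ::
  "(('d::finite \<Rightarrow> real) \<Rightarrow> real) \<Rightarrow> (('d \<Rightarrow> real) \<Rightarrow> real) \<Rightarrow> (('d \<Rightarrow> real) \<Rightarrow> real)" where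
  "inv_adjoint a g = (SOME u. u \<in> additive_l2 \<and>
     (\<forall>f\<in>additive_l2. l2_inner cube f g = l2_inner cube (conv a f) u))"

definition centred_gaussian :: "real \<Rightarrow> real measure" where
  "centred_gaussian v = (if v = 0 then return borel 0
     else density lborel (\<lambda>x. ennreal (normal_density 0 (sqrt v) x)))"

text \<open>\<open>W h\<close> stands for $\int h\,dW$. A pair is jointly Gaussian iff all its linear
  combinations are Gaussian. The condition on pairs forces
  $W$ to be almost surely linear, so all finite-dimensional distributions are Gaussian.\<close>

definition white_noise :: "'a measure \<Rightarrow> 'w measure \<Rightarrow> (('a \<Rightarrow> real) \<Rightarrow> 'w \<Rightarrow> real) \<Rightarrow> bool" where
  "white_noise M P W \<longleftrightarrow> prob_space P \<and>
     (\<forall>h\<in>l2 M. W h \<in> borel_measurable P) \<and>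
     (\<forall>h1\<in>l2 M. \<forall>h2\<in>l2 M. \<forall>c1 c2.
        distr P borel (\<lambda>\<omega>. c1 * W h1 \<omega> + c2 * W h2 \<omega>) =
        centred_gaussian (c1\<^sup>2 * (l2_norm M h1)\<^sup>2 + 2 * c1 * c2 * l2_inner M h1 h2
                    + c2\<^sup>2 * (l2_norm M h2)\<^sup>2))"

text \<open>A path of the observed process is the family $(\int h\,dY_n)_{h \in L_2}$.\<close>

definition obs_space :: "'a measure \<Rightarrow> (('a \<Rightarrow> real) \<Rightarrow> real) measure" where
  "obs_space M = (\<Pi>\<^sub>M h\<in>l2 M. borel)"

definition observation ::
  "(('d::finite \<Rightarrow> real) \<Rightarrow> real) \<Rightarrow> ((('d \<Rightarrow> real) \<Rightarrow> real) \<Rightarrow> 'w \<Rightarrow> real) \<Rightarrow> nat \<Rightarrow>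
   (('d \<Rightarrow> real) \<Rightarrow> real) \<Rightarrow> 'w \<Rightarrow> (('d \<Rightarrow> real) \<Rightarrow> real) \<Rightarrow> real" where
  "observation a W n f \<omega> =
     (\<lambda>h\<in>l2 cube. l2_inner cube h (conv a f) + W h \<omega> / sqrt (real n))"

definition estimators :: "'a measure \<Rightarrow> ((('a \<Rightarrow> real) \<Rightarrow> real) \<Rightarrow> 'a \<Rightarrow> real) set" where
  "estimators M = measurable (obs_space M) (l2_borel M)"

definition risk ::
  "(('d::finite \<Rightarrow> real) \<Rightarrow> real) \<Rightarrow> 'w measure \<Rightarrow> ((('d \<Rightarrow> real) \<Rightarrow> real) \<Rightarrow> 'w \<Rightarrow> real) \<Rightarrow> nat \<Rightarrow>
   (((('d \<Rightarrow> real) \<Rightarrow> real) \<Rightarrow> real) \<Rightarrow> ('d \<Rightarrow> real) \<Rightarrow> real) \<Rightarrow> (('d \<Rightarrow> real) \<Rightarrow> real) \<Rightarrow> ennreal" where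
  "risk a P W n G f =
     (\<integral>\<^sup>+\<omega>. ennreal ((l2_norm cube (\<lambda>x. G (observation a W n f \<omega>) x - f x))\<^sup>2) \<partial>P)"

definition gamma_n ::
  "(('d::finite \<Rightarrow> real) \<Rightarrow> real) \<Rightarrow> ((('d \<Rightarrow> real) \<Rightarrow> real) \<Rightarrow> real) \<Rightarrow> (('d \<Rightarrow> real) \<Rightarrow> real) \<Rightarrow> real"
  where "gamma_n a Y g = - 2 * Y (inv_adjoint a g) + (l2_norm cube g)\<^sup>2"

definition delta :: "real \<Rightarrow> real \<Rightarrow> nat \<Rightarrow> real" where
  "delta s q n = real n powr (- s / (2 * s + 2 * q + 1))"

text \<open>\<open>net n k\<close> is the net of the \<open>k\<close>-th component class at sample size \<open>n\<close>. Its elements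
  are cosine polynomials without constant term and of degree at most \<open>m n k\<close>; they are not
  required to lie in the ellipsoid.\<close>

definition admissible_nets ::
  "('d::finite \<Rightarrow> nat \<Rightarrow> real) \<Rightarrow> ('d \<Rightarrow> real) \<Rightarrow> ('d \<Rightarrow> real) \<Rightarrow> ('d \<Rightarrow> real) \<Rightarrow>
   (nat \<Rightarrow> 'd \<Rightarrow> (real \<Rightarrow> real) set) \<Rightarrow> bool" where
  "admissible_nets w L s q net \<longleftrightarrow> (\<exists>(m :: nat \<Rightarrow> 'd \<Rightarrow> nat) C.
     (\<forall>k. (\<lambda>n. real (m n k)) \<in> \<Theta>(\<lambda>n. delta (s k) (q k) n powr (- 1 / s k))) \<and>
     (\<forall>n\<ge>1. \<forall>k.
        finite (net n k) \<and>
        (\<forall>f\<in>ellipsoid (w k) (L k). \<exists>g\<in>net n k.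
           l2_norm unit_ival (\<lambda>t. f t - g t) \<le> delta (s k) (q k) n) \<and>
        (\<forall>g\<in>net n k. \<exists>\<theta>. g = (\<lambda>t. \<Sum>j=1..m n k. \<theta> j * phi j t)) \<and>
        ln (real (card (net n k))) \<le> C * delta (s k) (q k) n powr (- 1 / s k)))"

text \<open>Ties between minimizers may be broken in any way that makes the estimator measurable.\<close>

definition delta_net_estimator ::
  "(('d::finite \<Rightarrow> real) \<Rightarrow> real) \<Rightarrow> ('d \<Rightarrow> (real \<Rightarrow> real) set) \<Rightarrow>
   (((('d \<Rightarrow> real) \<Rightarrow> real) \<Rightarrow> real) \<Rightarrow> ('d \<Rightarrow> real) \<Rightarrow> real) \<Rightarrow> bool" where
  "delta_net_estimator a S fhat \<longleftrightarrow> fhat \<in> estimators cube \<and>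
     (\<forall>Y\<in>space (obs_space cube). is_arg_min (gamma_n a Y) (\<lambda>g. g \<in> oplus S) (fhat Y))"

end

theory Submission
  imports Defs
begin

text \<open>Upper bound. As $\int fg = \int (Af)(Qg)$, the criterion is
  $\gamma_n(g) = \|g-f\|^2 - \|f\|^2 - 2n^{-1/2}W(Qg)$, so the minimiser competes with a net point
  within $\delta$ of $f$, and the noise splits over the components because $W$ is almost surely linear.
  On cosine polynomials of degree at most $M_k$ the operator $Q$ increases norms at most by a constant
  times $M_k^{q_k}$, so the maximum of the noise over the $k$th net contributes
  $M_k^{2q_k}\log(\#\mathcal{F}_{k,\delta_k})/n$, which is of order $\delta_k^2$. Completeness of
  the trigonometric system makes $Qg$ unique up to null sets.

  Lower bound. Assouad's cube is built on the frequencies $m < j \le 2m$,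
  $m \approx n^{1/(2s_k+2q_k+1)}$, of the component attaining the minimum in $\alpha$. Flipping the sign at frequency $j$ shifts the
  observation by a bounded multiple of the noise level in the direction $\phi_{kj}$, and the noise in
  this direction is independent of the rest of the observation.\<close>

section \<open>Square integrable functions\<close>

text \<open>Two features of the model shape the work. \<open>white_noise\<close> constrains the laws
  of pairs only, so linearity of \<open>W\<close> holds off a null set that depends on the functions
  involved. It is used for finitely many functions at a time, which suffices since nets are finite
  and laws on the path space are determined by finite-dimensional ones. And
  \<open>inv_adjoint\<close> chooses among all centred additive functions, where the cosines are not
  complete, so sines have to be carried along; a marginal with a cosine expansion acts on both
  systems with the same multiplier \<open>b k j / sqrt 2\<close>.

  In the upper bound the noise is taken relative to a net point near f and divided by the distance
  to it, so that the loss absorbs it whatever the diameter of the net. The cube of the lower bound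
  uses one octave of frequencies, on which weights and multipliers are comparable. Its squared
  amplitude, of order \<open>m powr (- 2 * s - 1)\<close>, is up to constants the largest that fits
  the ellipsoid; m is then, up to constants, the smallest for which the signal-to-noise ratio per
  frequency stays bounded.\<close>

lemma l2_measurable: "f \<in> l2 M \<Longrightarrow> f \<in> borel_measurable M"
  by (simp add: l2_def)

lemma l2_square_integrable: "f \<in> l2 M \<Longrightarrow> integrable M (\<lambda>x. (f x)\<^sup>2)"
  by (simp add: l2_def)

lemma l2_mult_integrable:
  assumes "f \<in> l2 M" "g \<in> l2 M"
  shows "integrable M (\<lambda>x. f x * g x)"
proof (rule Bochner_Integration.integrable_bound)
  show "integrable M (\<lambda>x. (f x)\<^sup>2 + (g x)\<^sup>2)"
    using assms by (intro Bochner_Integration.integrable_add l2_square_integrable)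
  show "(\<lambda>x. f x * g x) \<in> borel_measurable M"
    using assms by (intro borel_measurable_times l2_measurable)
  show "AE x in M. norm (f x * g x) \<le> norm ((f x)\<^sup>2 + (g x)\<^sup>2)"
  proof (intro AE_I2)
    fix x
    have "0 \<le> (\<bar>f x\<bar> - \<bar>g x\<bar>)\<^sup>2" by simp
    also have "\<dots> = (f x)\<^sup>2 + (g x)\<^sup>2 - 2 * \<bar>f x * g x\<bar>"
      by (simp add: power2_diff abs_mult)
    finally show "norm (f x * g x) \<le> norm ((f x)\<^sup>2 + (g x)\<^sup>2)" by simp
  qed
qed

lemma l2_scale: "f \<in> l2 M \<Longrightarrow> (\<lambda>x. c * f x) \<in> l2 M"
  by (auto simp: l2_def power_mult_distrib)

lemma l2_add:
  assumes "f \<in> l2 M" "g \<in> l2 M"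
  shows "(\<lambda>x. f x + g x) \<in> l2 M"
  using assms l2_mult_integrable[OF assms]
  by (auto simp: l2_def power2_sum mult.assoc)

lemma l2_diff: "f \<in> l2 M \<Longrightarrow> g \<in> l2 M \<Longrightarrow> (\<lambda>x. f x - g x) \<in> l2 M"
  using l2_add[OF _ l2_scale[of g M "-1"], of f] by simp

lemma l2_zero: "(\<lambda>x. 0) \<in> l2 M"
  by (simp add: l2_def)

lemma l2_sum: "(\<And>i. i \<in> I \<Longrightarrow> f i \<in> l2 M) \<Longrightarrow> (\<lambda>x. \<Sum>i\<in>I. f i x) \<in> l2 M"
  by (induction I rule: infinite_finite_induct) (auto simp: l2_zero l2_add)

lemma l2_bounded:
  assumes "finite_measure M" "f \<in> borel_measurable M" "\<And>x. \<bar>f x\<bar> \<le> B"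
  shows "f \<in> l2 M"
proof -
  interpret finite_measure M by fact
  have "integrable M (\<lambda>x. (f x)\<^sup>2)"
    using assms(2,3)
    by (intro integrable_const_bound[where B="B\<^sup>2"] AE_I2)
       (auto intro: power2_le_iff_abs_le[THEN iffD2] order_trans[OF abs_ge_zero])
  with assms(2) show ?thesis by (simp add: l2_def)
qed

lemma l2_integrable:
  assumes "finite_measure M" "f \<in> l2 M"
  shows "integrable M f"
proof -
  have "(\<lambda>x. 1) \<in> l2 M" using l2_bounded[OF assms(1), of "\<lambda>x. 1" 1] by simp
  from l2_mult_integrable[OF assms(2) this] show ?thesis by simp
qed

lemma l2_norm_nonneg: "l2_norm M f \<ge> 0"
  by (simp add: l2_norm_def)

lemma l2_norm_power2: "(l2_norm M f)\<^sup>2 = (\<integral>x. (f x)\<^sup>2 \<partial>M)"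
  by (simp add: l2_norm_def)

lemma l2_norm_eq_inner: "(l2_norm M f)\<^sup>2 = l2_inner M f f"
  unfolding l2_norm_power2 l2_inner_def by (simp add: power2_eq_square)

lemma l2_norm_scale: "l2_norm M (\<lambda>x. c * f x) = \<bar>c\<bar> * l2_norm M f"
  by (simp add: l2_norm_def power_mult_distrib real_sqrt_mult)

lemma l2_norm_minus_commute: "l2_norm M (\<lambda>x. f x - g x) = l2_norm M (\<lambda>x. g x - f x)"
  by (simp add: l2_norm_def power2_commute)

lemma l2_inner_commute: "l2_inner M f g = l2_inner M g f"
  by (simp add: l2_inner_def mult.commute)

lemma l2_inner_add_left:
  "f \<in> l2 M \<Longrightarrow> g \<in> l2 M \<Longrightarrow> h \<in> l2 M \<Longrightarrow>
   l2_inner M (\<lambda>x. f x + g x) h = l2_inner M f h + l2_inner M g h"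
  by (simp add: l2_inner_def distrib_right l2_mult_integrable)

lemma l2_inner_diff_left:
  "f \<in> l2 M \<Longrightarrow> g \<in> l2 M \<Longrightarrow> h \<in> l2 M \<Longrightarrow>
   l2_inner M (\<lambda>x. f x - g x) h = l2_inner M f h - l2_inner M g h"
  by (simp add: l2_inner_def left_diff_distrib l2_mult_integrable)

lemma l2_inner_scale_left: "l2_inner M (\<lambda>x. c * f x) h = c * l2_inner M f h"
  by (simp add: l2_inner_def mult.assoc)

lemma l2_inner_sum_left:
  "(\<And>i. i \<in> I \<Longrightarrow> f i \<in> l2 M) \<Longrightarrow> h \<in> l2 M \<Longrightarrow>
   l2_inner M (\<lambda>x. \<Sum>i\<in>I. f i x) h = (\<Sum>i\<in>I. l2_inner M (f i) h)"
  by (simp add: l2_inner_def sum_distrib_right l2_mult_integrable)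

lemma l2_inner_add_right:
  "f \<in> l2 M \<Longrightarrow> g \<in> l2 M \<Longrightarrow> h \<in> l2 M \<Longrightarrow>
   l2_inner M h (\<lambda>x. f x + g x) = l2_inner M h f + l2_inner M h g"
  by (simp add: l2_inner_commute[of M h] l2_inner_add_left)

lemma l2_inner_diff_right:
  "f \<in> l2 M \<Longrightarrow> g \<in> l2 M \<Longrightarrow> h \<in> l2 M \<Longrightarrow>
   l2_inner M h (\<lambda>x. f x - g x) = l2_inner M h f - l2_inner M h g"
  by (simp add: l2_inner_commute[of M h] l2_inner_diff_left)

lemma l2_inner_scale_right: "l2_inner M h (\<lambda>x. c * f x) = c * l2_inner M h f"
  by (simp add: l2_inner_commute[of M h] l2_inner_scale_left)

lemma l2_inner_sum_right:
  "(\<And>i. i \<in> I \<Longrightarrow> f i \<in> l2 M) \<Longrightarrow> h \<in> l2 M \<Longrightarrow>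
   l2_inner M h (\<lambda>x. \<Sum>i\<in>I. f i x) = (\<Sum>i\<in>I. l2_inner M h (f i))"
  by (simp add: l2_inner_commute[of M h] l2_inner_sum_left)

lemma l2_norm_power2_add:
  assumes "f \<in> l2 M" "g \<in> l2 M"
  shows "(l2_norm M (\<lambda>x. f x + g x))\<^sup>2 = (l2_norm M f)\<^sup>2 + 2 * l2_inner M f g + (l2_norm M g)\<^sup>2"
  using assms
  by (simp add: l2_norm_eq_inner l2_inner_add_left l2_inner_add_right l2_add l2_inner_commute[of M g f])

lemma l2_norm_power2_diff:
  assumes "f \<in> l2 M" "g \<in> l2 M"
  shows "(l2_norm M (\<lambda>x. f x - g x))\<^sup>2 = (l2_norm M f)\<^sup>2 - 2 * l2_inner M f g + (l2_norm M g)\<^sup>2"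
  using assms
  by (simp add: l2_norm_eq_inner l2_inner_diff_left l2_inner_diff_right l2_diff l2_inner_commute[of M g f])

text \<open>The quadratic ||f + t g||^2 in t is nonnegative. As \<open>l2_norm\<close> is a seminorm
  on functions, \<open>l2_norm M g = 0\<close> does not give g = 0, and this case is treated by
  itself.\<close>

lemma l2_Cauchy_Schwarz:
  assumes "f \<in> l2 M" "g \<in> l2 M"
  shows "\<bar>l2_inner M f g\<bar> \<le> l2_norm M f * l2_norm M g"
proof -
  have q: "0 \<le> (l2_norm M f)\<^sup>2 + 2 * t * l2_inner M f g + t\<^sup>2 * (l2_norm M g)\<^sup>2" for t
    using l2_norm_power2_add[OF assms(1) l2_scale[OF assms(2), of t]]
    by (simp add: l2_inner_scale_right l2_norm_scale power_mult_distrib)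
       (metis zero_le_power2 mult.assoc)
  have "(l2_inner M f g)\<^sup>2 \<le> (l2_norm M f)\<^sup>2 * (l2_norm M g)\<^sup>2"
  proof (cases "l2_norm M g = 0")
    case True
    have "l2_inner M f g = 0"
    proof (rule ccontr)
      assume ne: "l2_inner M f g \<noteq> 0"
      have "0 \<le> (l2_norm M f)\<^sup>2 + 2 * t * l2_inner M f g" for t using q[of t] True by simp
      \<comment> \<open>At this t the linear function takes the value -1.\<close>
      from this[of "- ((l2_norm M f)\<^sup>2 + 1) / (2 * l2_inner M f g)"] ne show False
        by (simp add: field_simps)
    qed
    then show ?thesis by simp
  next
    case False
    define N where "N = (l2_norm M g)\<^sup>2"
    have N: "N > 0" using False by (simp add: N_def)
    \<comment> \<open>The quadratic is evaluated at its minimiser.\<close>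
    have "(l2_norm M f)\<^sup>2 + 2 * (- l2_inner M f g / N) * l2_inner M f g + (- l2_inner M f g / N)\<^sup>2 * N =
        (l2_norm M f)\<^sup>2 - (l2_inner M f g)\<^sup>2 / N"
      using N by (simp add: power2_eq_square)
    then have "0 \<le> (l2_norm M f)\<^sup>2 - (l2_inner M f g)\<^sup>2 / N"
      using q[of "- l2_inner M f g / N"] by (simp only: N_def[symmetric])
    then show ?thesis using N by (simp add: N_def[symmetric] field_simps)
  qed
  then have "(l2_inner M f g)\<^sup>2 \<le> (l2_norm M f * l2_norm M g)\<^sup>2"
    by (simp add: power_mult_distrib)
  then show ?thesis
    by (rule abs_le_square_iff[THEN iffD2, THEN order_trans]) (simp add: l2_norm_nonneg)
qed

lemma l2_norm_triangle:
  assumes "f \<in> l2 M" "g \<in> l2 M"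
  shows "l2_norm M (\<lambda>x. f x + g x) \<le> l2_norm M f + l2_norm M g"
proof (rule power2_le_imp_le)
  show "(l2_norm M (\<lambda>x. f x + g x))\<^sup>2 \<le> (l2_norm M f + l2_norm M g)\<^sup>2"
    using l2_Cauchy_Schwarz[OF assms] by (simp add: l2_norm_power2_add[OF assms] power2_sum)
qed (simp add: l2_norm_nonneg)

lemma l2_norm_eq_0_iff:
  assumes "f \<in> l2 M"
  shows "l2_norm M f = 0 \<longleftrightarrow> (AE x in M. f x = 0)"
  using integral_nonneg_eq_0_iff_AE[OF l2_square_integrable[OF assms]]
  by (simp add: l2_norm_def)

text \<open>\<open>p\<close> is the orthogonal projection of f onto the span of the
  \<open>e i\<close>, and the difference of the two sides is ||f - p||^2. In the lower bound this
  replaces the loss by its coordinates along the perturbed frequencies.\<close>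

lemma l2_Bessel:
  assumes "finite I" "f \<in> l2 M" "\<And>i. i \<in> I \<Longrightarrow> e i \<in> l2 M"
    and "\<And>i j. i \<in> I \<Longrightarrow> j \<in> I \<Longrightarrow> l2_inner M (e i) (e j) = (if i = j then 1 else 0)"
  shows "(\<Sum>i\<in>I. (l2_inner M f (e i))\<^sup>2) \<le> (l2_norm M f)\<^sup>2"
proof -
  define p where "p = (\<lambda>x. \<Sum>i\<in>I. l2_inner M f (e i) * e i x)"
  have p: "p \<in> l2 M" unfolding p_def using assms by (intro l2_sum l2_scale)
  have "l2_inner M f p = (\<Sum>i\<in>I. (l2_inner M f (e i))\<^sup>2)"
    unfolding p_def using assms
    by (subst l2_inner_sum_right) (auto intro: l2_scale simp: l2_inner_scale_right power2_eq_square)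
  moreover have "l2_inner M p p = (\<Sum>i\<in>I. (l2_inner M f (e i))\<^sup>2)"
  proof -
    have "l2_inner M (e i) p = l2_inner M f (e i)" if i: "i \<in> I" for i
    proof -
      have "l2_inner M (e i) p = (\<Sum>j\<in>I. l2_inner M f (e j) * (if i = j then 1 else 0))"
        unfolding p_def using assms i
        by (subst l2_inner_sum_right) (auto intro: l2_scale simp: l2_inner_scale_right)
      also have "\<dots> = l2_inner M f (e i)" using i assms(1)
        by (simp add: sum.delta' if_distrib[of "\<lambda>t. _ * t"] cong: if_cong)
      finally show ?thesis .
    qed
    then show ?thesis using assms p
      by (subst (1) p_def, subst l2_inner_sum_left)
         (auto intro: l2_scale simp: l2_inner_scale_left power2_eq_square)
  qed
  moreover have "0 \<le> (l2_norm M (\<lambda>x. f x - p x))\<^sup>2" by simp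
  ultimately show ?thesis
    by (simp add: l2_norm_power2_diff[OF assms(2) p] l2_norm_eq_inner[of M p])
qed

text \<open>Inner products are continuous by the Cauchy-Schwarz inequality. With a basis function
  for h this reads off Fourier coefficients from an L2 expansion.\<close>

lemma l2_sums_inner:
  assumes "l2_sums M g f" "\<And>j. g j \<in> l2 M" "h \<in> l2 M"
  shows "(\<lambda>j. l2_inner M (g j) h) sums l2_inner M f h"
proof -
  have f: "f \<in> l2 M" and lim: "(\<lambda>N. l2_norm M (\<lambda>x. f x - (\<Sum>j<N. g j x))) \<longlonglongrightarrow> 0"
    using assms(1) by (auto simp: l2_sums_def)
  have "(\<lambda>N. (\<Sum>j<N. l2_inner M (g j) h) - l2_inner M f h) \<longlonglongrightarrow> 0"
  proof (rule Lim_null_comparison)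
    show "(\<lambda>N. l2_norm M (\<lambda>x. f x - (\<Sum>j<N. g j x)) * l2_norm M h) \<longlonglongrightarrow> 0"
      using tendsto_mult_right[OF lim, of "l2_norm M h"] by simp
    show "\<forall>\<^sub>F N in sequentially. norm ((\<Sum>j<N. l2_inner M (g j) h) - l2_inner M f h)
        \<le> l2_norm M (\<lambda>x. f x - (\<Sum>j<N. g j x)) * l2_norm M h"
    proof (intro always_eventually allI)
      fix N
      have s: "(\<lambda>x. \<Sum>j<N. g j x) \<in> l2 M" by (intro l2_sum assms)
      have "l2_inner M (\<lambda>x. f x - (\<Sum>j<N. g j x)) h = l2_inner M f h - (\<Sum>j<N. l2_inner M (g j) h)"
        using assms f s by (simp add: l2_inner_diff_left l2_inner_sum_left)
      then show "norm ((\<Sum>j<N. l2_inner M (g j) h) - l2_inner M f h)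
        \<le> l2_norm M (\<lambda>x. f x - (\<Sum>j<N. g j x)) * l2_norm M h"
        using l2_Cauchy_Schwarz[OF l2_diff[OF f s] assms(3)] by (simp add: abs_minus_commute)
    qed
  qed
  then show ?thesis by (simp add: sums_def LIM_zero_iff)
qed

section \<open>The trigonometric system\<close>

lemma borel_measurable_frac: "(frac :: real \<Rightarrow> real) \<in> borel_measurable borel"
  unfolding frac_def[abs_def] by measurable

lemma space_unit_ival [simp]: "space unit_ival = {0..1}"
  by (simp add: unit_ival_def space_restrict_space)

lemma sets_unit_ival: "sets unit_ival = sets (restrict_space borel {0..1})"
  unfolding unit_ival_def by (rule sets_restrict_space_cong) simp

lemma prob_space_unit_ival: "prob_space unit_ival"
  by (rule prob_spaceI) (simp add: unit_ival_def emeasure_restrict_space space_restrict_space)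

interpretation unit_ival: prob_space unit_ival
  by (rule prob_space_unit_ival)

lemma measurable_unit_ival: "f \<in> measurable borel N \<Longrightarrow> f \<in> measurable unit_ival N"
  unfolding unit_ival_def by (rule measurable_restrict_space1) simp

lemma measurable_unit_ival_ident [measurable]: "(\<lambda>t. t) \<in> measurable unit_ival borel"
  by (rule measurable_unit_ival) simp

lemma integral_unit_ival: "(\<integral>t. f t \<partial>unit_ival) = (\<integral>t. indicator {0..1} t * f t \<partial>lborel)"
  for f :: "real \<Rightarrow> real"
  by (simp add: unit_ival_def integral_restrict_space set_lebesgue_integral_def)

lemma integrable_unit_ival_iff:
  "integrable unit_ival f \<longleftrightarrow> integrable lborel (\<lambda>t. indicator {0..1} t * f t)"
  for f :: "real \<Rightarrow> real"
  by (simp add: unit_ival_def integrable_restrict_space set_integrable_def)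

lemma AE_unit_ival_iff: "(AE t in unit_ival. Q t) \<longleftrightarrow> (AE t in lborel. t \<in> {0..1} \<longrightarrow> Q t)"
  unfolding unit_ival_def by (subst AE_restrict_space_iff) simp_all

lemma integrable_unit_ival_bounded:
  "f \<in> borel_measurable unit_ival \<Longrightarrow> (\<And>t. \<bar>f t\<bar> \<le> B) \<Longrightarrow> integrable unit_ival f" for f :: "real \<Rightarrow> real"
  by (rule unit_ival.integrable_const_bound[where B=B]) auto

lemma integrable_unit_ival_cos [simp]: "integrable unit_ival (\<lambda>t. cos (r * t + c))"
  by (rule integrable_unit_ival_bounded[where B=1]) auto

lemma integral_unit_ival_cos:
  "(\<integral>t. cos (2 * pi * of_int j * t + c) \<partial>unit_ival) = (if j = 0 then cos c else 0)"
proof (cases "j = 0")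
  case True
  then show ?thesis using unit_ival.prob_space by simp
next
  case False
  define r where "r = 2 * pi * of_int j"
  have r: "r \<noteq> 0" using False by (simp add: r_def)
  have "(\<integral>t. indicator {0..1} t *\<^sub>R cos (r * t + c) \<partial>lborel) =
      sin (r * 1 + c) / r - sin (r * 0 + c) / r"
    by (rule integral_FTC_Icc)
       (auto intro!: derivative_eq_intros continuous_intros simp: r
             simp flip: has_real_derivative_iff_has_vector_derivative)
  moreover have "sin (r * 1 + c) = sin c"
    using sin.plus_of_int[of c j] by (simp add: r_def algebra_simps)
  ultimately show ?thesis using False by (simp add: integral_unit_ival r_def)
qed

section \<open>Orthonormal cosines and sines\<close>

definition psi :: "nat \<Rightarrow> real \<Rightarrow> real" where
  "psi j t = sqrt 2 * sin (2 * pi * real j * t)"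

lemma phi_pos: "j \<ge> 1 \<Longrightarrow> phi j t = sqrt 2 * cos (2 * pi * real j * t)"
  by (simp add: phi_def)

lemma measurable_phi [measurable]: "phi j \<in> borel_measurable borel"
  unfolding phi_def by (cases "j = 0") simp_all

lemma measurable_psi [measurable]: "psi j \<in> borel_measurable borel"
  unfolding psi_def by simp

lemma abs_phi_le: "\<bar>phi j t\<bar> \<le> 2"
proof -
  have "sqrt 2 * \<bar>cos x\<bar> \<le> 2 * 1" for x :: real
    by (intro mult_mono) (auto simp: real_le_lsqrt)
  then show ?thesis by (simp add: phi_def abs_mult)
qed

lemma abs_psi_le: "\<bar>psi j t\<bar> \<le> 2"
proof -
  have "sqrt 2 * \<bar>sin x\<bar> \<le> 2 * 1" for x :: real
    by (intro mult_mono) (auto simp: real_le_lsqrt)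
  then show ?thesis by (simp add: psi_def abs_mult)
qed

lemma phi_l2: "phi j \<in> l2 unit_ival"
  by (rule l2_bounded[where B=2]) (auto intro: abs_phi_le unit_ival.finite_measure_axioms)

lemma psi_l2: "psi j \<in> l2 unit_ival"
  by (rule l2_bounded[where B=2]) (auto intro: abs_psi_le unit_ival.finite_measure_axioms)

lemma integral_phi: "j \<ge> 1 \<Longrightarrow> (\<integral>t. phi j t \<partial>unit_ival) = 0"
  using integral_unit_ival_cos[of "int j" 0] by (simp add: phi_pos)

lemma integral_psi: "(\<integral>t. psi j t \<partial>unit_ival) = 0"
proof -
  have "sin x = cos (x + (- pi / 2))" for x :: real by (simp add: cos_diff)
  then have "psi j t = sqrt 2 * cos (2 * pi * of_int (int j) * t + (- pi / 2))" for t
    by (simp add: psi_def)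
  then show ?thesis using integral_unit_ival_cos[of "int j" "- pi / 2"] by simp
qed

text \<open>Phases are kept general so that one formula serves cosines and sines, a sine being a
  cosine with phase -pi/2.\<close>

lemma cos_mult_cos:
  "cos (2 * pi * of_int i * t + c) * cos (2 * pi * of_int j * t + d) =
     cos (2 * pi * of_int (i - j) * t + (c - d)) / 2 + cos (2 * pi * of_int (i + j) * t + (c + d)) / 2"
  by (subst cos_times_cos) (simp add: algebra_simps add_divide_distrib)

lemma integral_unit_ival_cos_cos:
  "(\<integral>t. cos (2 * pi * of_int i * t + c) * cos (2 * pi * of_int j * t + d) \<partial>unit_ival) =
     ((if i = j then cos (c - d) else 0) + (if i + j = 0 then cos (c + d) else 0)) / 2"
proof -
  show ?thesis
    unfolding cos_mult_cos using integral_unit_ival_cos[of "i - j" "c -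
        d"] integral_unit_ival_cos[of "i + j" "c + d"]
    by (simp add: add_divide_distrib)
qed

lemma inner_phi_phi:
  assumes "i \<ge> 1"
  shows "l2_inner unit_ival (phi i) (phi j) = (if i = j then 1 else 0)"
proof (cases "j = 0")
  case True
  then show ?thesis using integral_phi[OF assms] assms by (simp add: l2_inner_def phi_def[of 0])
next
  case False
  have "l2_inner unit_ival (phi i) (phi j) =
      (\<integral>t. 2 * (cos (2 * pi * of_int (int i) * t + 0) * cos (2 * pi * of_int (int j) * t + 0)) \<partial>unit_ival)"
    unfolding l2_inner_def using assms False
    by (intro Bochner_Integration.integral_cong) (auto simp: phi_pos)
  also have "\<dots> = (if i = j then 1 else 0)"
    using assms False
    by (simp only: Bochner_Integration.integral_mult_right_zero integral_unit_ival_cos_cos) simp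
  finally show ?thesis .
qed

lemma inner_phi_psi: "l2_inner unit_ival (phi i) (psi j) = 0"
proof (cases "i = 0")
  case True
  then show ?thesis using integral_psi by (simp add: l2_inner_def phi_def)
next
  case False
  have *: "sin x = cos (x + (- pi / 2))" for x :: real by (simp add: cos_diff)
  have "l2_inner unit_ival (phi i) (psi j) =
      (\<integral>t. 2 * (cos (2 * pi * of_int (int i) * t + 0) * cos (2 * pi * of_int (int j) * t + (- pi / 2))) \<partial>unit_ival)"
    unfolding l2_inner_def using False
    by (intro Bochner_Integration.integral_cong) (auto simp: phi_pos psi_def *)
  also have "\<dots> = 0"
    by (simp only: Bochner_Integration.integral_mult_right_zero integral_unit_ival_cos_cos) simp
  finally show ?thesis .
qed

text \<open>Rotations of the circle preserve length: subtracting y modulo 1 translates [0, y) to [1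
  - y, 1) and [y, 1) to [0, 1 - y). This is the change of variable behind all computations with
  periodic convolutions.\<close>

lemma distr_frac_unit_ival:
  assumes y: "y \<in> {0..1}"
  shows "(\<lambda>t. frac (t - y)) \<in> measurable unit_ival unit_ival" (is ?m)
    and "distr unit_ival unit_ival (\<lambda>t. frac (t - y)) = unit_ival" (is ?d)
proof -
  have fr: "(\<lambda>t::real. frac (t - y)) \<in> borel_measurable borel"
    using measurable_compose[of "\<lambda>t. t - y" borel borel, OF _ borel_measurable_frac] by simp
  show m: ?m
    unfolding unit_ival_def
    by (rule measurable_restrict_space2)
       (use fr frac_ge_0 frac_lt_1 in \<open>auto intro: less_imp_le[OF frac_lt_1] measurable_restrict_space1\<close>)
  show ?d
  proof (rule measure_eqI)
    fix A assume "A \<in> sets (distr unit_ival unit_ival (\<lambda>t. frac (t - y)))"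
    then have A: "A \<in> sets unit_ival" by simp
    then have A': "A \<in> sets borel" "A \<subseteq> {0..1}"
      by (auto simp: sets_unit_ival sets_restrict_space)
    \<comment> \<open>The parts of A hit by the two pieces of the rotation; each piece is a plain
      translation. The endpoint t = 1 does not fit the half-open pieces and is discarded as a null
      set.\<close>
    define g1 g2 :: "real \<Rightarrow> ennreal" where
      "g1 u = indicator (A \<inter> {1 - y..<1}) u" and "g2 u = indicator (A \<inter> {0..<1 - y}) u" for u
    have [measurable]: "g1 \<in> borel_measurable borel" "g2 \<in> borel_measurable borel"
      using A' by (simp_all add: g1_def[abs_def] g2_def[abs_def])
    have "emeasure (distr unit_ival unit_ival (\<lambda>t. frac (t - y))) A
        = emeasure unit_ival ((\<lambda>t. frac (t - y)) -` A \<inter> {0..1})"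
      using m A by (simp add: emeasure_distr)
    also have "\<dots> = emeasure lborel ((\<lambda>t. frac (t - y)) -` A \<inter> {0..1})"
      by (simp add: unit_ival_def emeasure_restrict_space)
    also have "\<dots> = (\<integral>\<^sup>+t. indicator ((\<lambda>t. frac (t - y)) -` A \<inter> {0..1}) t \<partial>lborel)"
      using measurable_sets[OF fr A'(1)] by simp
    also have "\<dots> = (\<integral>\<^sup>+t. g1 ((1 - y) + 1 * t) + g2 (- y + 1 * t) \<partial>lborel)"
    proof (rule nn_integral_cong_AE)
      have "AE t in lborel. t \<noteq> (1::real)" by (rule AE_lborel_singleton)
      then show "AE t in lborel. indicator ((\<lambda>t. frac (t - y)) -` A \<inter> {0..1}) t =
          g1 ((1 - y) + 1 * t) + g2 (- y + 1 * t)"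
      proof eventually_elim
        fix t :: real assume t1: "t \<noteq> 1"
        consider "t < 0" | "0 \<le> t" "t < y" | "y \<le> t" "t < 1" | "t > 1" using t1 y by fastforce
        then show "indicator ((\<lambda>t. frac (t - y)) -` A \<inter> {0..1}) t =
            g1 ((1 - y) + 1 * t) + g2 (- y + 1 * t)"
        proof cases
          case 2
          then have "frac (t - y) = t - y + 1" using y by (auto simp: frac_unique_iff)
          then have e: "(1 - y) + 1 * t = frac (t - y)" "- y + 1 * t = frac (t - y) - 1" by simp_all
          have "frac (t - y) - 1 < 0" "1 - y \<le> frac (t - y)" "t \<in> {0..1}"
              using e 2 y frac_lt_1[of "t - y"] by auto
          then show ?thesis unfolding e using frac_lt_1[of "t - y"]
              by (simp add: g1_def g2_def indicator_def)
        next
          case 3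
          then have "frac (t - y) = t - y" using y by (auto simp: frac_unique_iff)
          then have e: "(1 - y) + 1 * t = frac (t - y) + 1" "- y + 1 * t = frac (t - y)" by simp_all
          have "1 \<le> frac (t - y) + 1" "frac (t - y) < 1 - y" "t \<in> {0..1}" using e 3 y by auto
          then show ?thesis unfolding e by (simp add: g1_def g2_def indicator_def not_less)
        qed (use y in \<open>auto simp: g1_def g2_def indicator_def\<close>)
      qed
    qed
    also have "\<dots> = (\<integral>\<^sup>+t. g1 t \<partial>lborel) + (\<integral>\<^sup>+t. g2 t \<partial>lborel)"
      using nn_integral_real_affine[of g1 1 "1 - y"] nn_integral_real_affine[of g2 1 "- y"]
      by (subst nn_integral_add) auto
    also have "\<dots> = (\<integral>\<^sup>+t. g1 t + g2 t \<partial>lborel)"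
      by (subst nn_integral_add) auto
    also have "\<dots> = (\<integral>\<^sup>+t. indicator A t \<partial>lborel)"
    proof (rule nn_integral_cong_AE)
      have "AE t in lborel. t \<noteq> (1::real)" by (rule AE_lborel_singleton)
      then show "AE t in lborel. g1 t + g2 t = indicator A t"
        by eventually_elim (use A' y in \<open>auto simp: g1_def g2_def indicator_def\<close>)
    qed
    also have "\<dots> = emeasure unit_ival A"
      using A' by (simp add: unit_ival_def emeasure_restrict_space)
    finally show "emeasure (distr unit_ival unit_ival (\<lambda>t. frac (t - y))) A = emeasure unit_ival A" .
  qed simp
qed

text \<open>With a free phase c a single kind of generator covers constants, cosines and sines, and
  the product of two generators is again a sum of two generators.\<close>

inductive_set trig_polys :: "(real \<Rightarrow> real) set" where
  trig_base: "(\<lambda>t. \<alpha> * cos (2 * pi * of_int j * t + c)) \<in> trig_polys"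
| trig_add: "f \<in> trig_polys \<Longrightarrow> g \<in> trig_polys \<Longrightarrow> (\<lambda>t. f t + g t) \<in> trig_polys"

lemma trig_polys_mult:
  assumes "f \<in> trig_polys" "g \<in> trig_polys"
  shows "(\<lambda>t. f t * g t) \<in> trig_polys"
  using assms(1)
proof induction
  case (trig_base \<alpha> i c)
  from assms(2) show ?case
  proof induction
    case (trig_base \<beta> j d)
    have "\<alpha> * cos (2 * pi * of_int i * t + c) * (\<beta> * cos (2 * pi * of_int j * t + d)) =
        \<alpha> * \<beta> / 2 * cos (2 * pi * of_int (i - j) * t + (c - d)) +
        \<alpha> * \<beta> / 2 * cos (2 * pi * of_int (i + j) * t + (c + d))" for t
      using cos_mult_cos[of i t c j d] by (simp add: algebra_simps)
    then show ?case by (simp only:) (intro trig_polys.intros)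
  next
    case (trig_add f g)
    then show ?case by (simp only: distrib_left) (intro trig_polys.intros)
  qed
next
  case (trig_add f g)
  then show ?case by (simp only: distrib_right) (intro trig_polys.intros)
qed

text \<open>A real polynomial in the two coordinates of a point of the circle becomes a
  trigonometric polynomial in the angle. Approximants on \<open>sphere 0 1\<close> come from the
  Stone-Weierstrass theorem in the former shape, while orthogonality is known in the latter.\<close>

lemma trig_polys_compose_cis:
  assumes "real_polynomial_function p"
  shows "(\<lambda>t. p (cis (2 * pi * t))) \<in> trig_polys"
  using assms
proof induction
  case (linear f)
  interpret bounded_linear f by fact
  have "f (cis (2 * pi * t)) =
      f 1 * cos (2 * pi * of_int 1 * t + 0) + f \<i> * cos (2 * pi * of_int 1 * t + (- pi / 2))" for t
  proof -
    have "cis (2 * pi * t) = cos (2 * pi * t) *\<^sub>R 1 + sin (2 * pi * t) *\<^sub>R \<i>"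
      by (simp add: complex_eq_iff)
    then have "f (cis (2 * pi * t)) = cos (2 * pi * t) * f 1 + sin (2 * pi * t) * f \<i>"
      by (simp add: add scaleR)
    then show ?thesis by (simp add: cos_diff)
  qed
  then show ?case by (simp only:) (intro trig_polys.intros)
next
  case (const c)
  have "(\<lambda>t. c * cos (2 * pi * of_int 0 * t + 0)) \<in> trig_polys" by (rule trig_polys.intros)
  then show ?case by simp
next
  case (add f g)
  show ?case by (rule trig_polys.intros) fact+
next
  case (mult f g)
  show ?case by (rule trig_polys_mult) fact+
qed

lemma integrable_mult_bounded:
  fixes f g :: "'a \<Rightarrow> real"
  assumes "integrable M f" "g \<in> borel_measurable M" "\<And>x. \<bar>g x\<bar> \<le> B"
  shows "integrable M (\<lambda>x. f x * g x)"
proof (rule Bochner_Integration.integrable_bound)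
  show "integrable M (\<lambda>x. B * f x)" using assms by simp
  show "(\<lambda>x. f x * g x) \<in> borel_measurable M" using assms by auto
  have "\<bar>f x * g x\<bar> \<le> \<bar>B * f x\<bar>" for x
    using mult_left_mono[OF order_trans[OF assms(3)[of x] abs_ge_self[of B]], of "\<bar>f x\<bar>"]
    by (simp add: abs_mult mult.commute)
  then show "AE x in M. norm (f x * g x) \<le> norm (B * f x)" by simp
qed

lemma measurable_cis [measurable (raw)]:
  assumes "X \<in> borel_measurable P"
  shows "(\<lambda>\<omega>. cis (X \<omega>)) \<in> borel_measurable P"
proof -
  have "cis \<in> borel_measurable borel"
    by (intro borel_measurable_continuous_onI continuous_intros)
  from measurable_compose[OF assms this] show ?thesis .
qed

lemma measurable_indicator_cis:
  "closed K \<Longrightarrow> (\<lambda>t. indicator K (cis (2 * pi * t)) :: real) \<in> borel_measurable borel"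
  by (rule measurable_compose[OF measurable_cis borel_measurable_indicator]) auto

text \<open>Completeness of the trigonometric system: orthogonality extends from trigonometric polynomials to
  continuous functions on the circle by the Stone--Weierstrass theorem, to indicators of closed arcs
  by dominated convergence, and the arcs determine the positive and negative parts of $h$.\<close>

context
  fixes h :: "real \<Rightarrow> real"
  assumes h_int: "integrable unit_ival h"
    and h_mean: "(\<integral>t. h t \<partial>unit_ival) = 0"
    and h_phi: "\<And>j. j \<ge> 1 \<Longrightarrow> (\<integral>t. h t * phi j t \<partial>unit_ival) = 0"
    and h_psi: "\<And>j. j \<ge> 1 \<Longrightarrow> (\<integral>t. h t * psi j t \<partial>unit_ival) = 0"
begin

private lemma orthogonal_trig_poly:
  assumes "f \<in> trig_polys"
  shows "integrable unit_ival (\<lambda>t. h t * f t) \<and> (\<integral>t. h t * f t \<partial>unit_ival) = 0"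
  using assms
proof induction
  case (trig_base \<alpha> j c)
  have i1: "integrable unit_ival (\<lambda>t. h t * cos (2 * pi * of_int j * t + d))" for d
    by (rule integrable_mult_bounded[OF h_int, where B=1]) auto
  have i2: "integrable unit_ival (\<lambda>t. h t * sin (2 * pi * of_int j * t))"
    by (rule integrable_mult_bounded[OF h_int, where B=1]) auto
  have c0: "(\<integral>t. h t * cos (2 * pi * of_int j * t) \<partial>unit_ival) = 0"
  proof (cases "j = 0")
    case True then show ?thesis using h_mean by simp
  next
    case False
    have "cos (2 * pi * of_int j * t) = cos (2 * pi * real (nat \<bar>j\<bar>) * t)" for t
      by (cases "j \<ge> 0") (simp_all flip: minus_mult_right minus_mult_left)
    then show ?thesis using h_phi[of "nat \<bar>j\<bar>"] False
      by (simp add: phi_pos mult.left_commute[of _ "sqrt 2"])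
  qed
  have s0: "(\<integral>t. h t * sin (2 * pi * of_int j * t) \<partial>unit_ival) = 0"
  proof (cases "j = 0")
    case False
    have "sin (2 * pi * of_int j * t) = of_int (sgn j) * sin (2 * pi * real (nat \<bar>j\<bar>) * t)" for t
      using False
      by (cases "j \<ge> 0") (simp_all flip: minus_mult_right minus_mult_left)
    then show ?thesis using h_psi[of "nat \<bar>j\<bar>"] False
      by (simp add: psi_def mult.left_commute[of _ "real_of_int _"] mult.left_commute[of _ "sqrt _"])
  qed simp
  have "h t * (\<alpha> * cos (2 * pi * of_int j * t + c)) =
      \<alpha> * cos c * (h t * cos (2 * pi * of_int j * t)) - \<alpha> * sin c * (h t * sin (2 * pi * of_int j * t))" for t
    by (simp add: cos_add algebra_simps)
  then show ?case using c0 s0 i1[of 0] i2 by simp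
next
  case (trig_add f g)
  then show ?case by (simp add: distrib_left)
qed

private lemma orthogonal_continuous:
  assumes H: "continuous_on UNIV (H :: complex \<Rightarrow> real)"
  shows "(\<integral>t. h t * H (cis (2 * pi * t)) \<partial>unit_ival) = 0"
proof -
  have mH: "(\<lambda>t. H (cis (2 * pi * t))) \<in> borel_measurable borel"
    by (rule borel_measurable_continuous_onI, rule continuous_on_compose2[OF H])
       (auto intro!: continuous_intros)
  have "\<bar>\<integral>t. h t * H (cis (2 * pi * t)) \<partial>unit_ival\<bar> \<le> e * (\<integral>t. \<bar>h t\<bar> \<partial>unit_ival)" if e: "e > 0" for e
  proof -
    obtain p where p: "real_polynomial_function p" "\<And>z. z \<in> sphere 0 1 \<Longrightarrow> \<bar>H z - p z\<bar> < e"
      using Stone_Weierstrass_real_polynomial_function[OF compact_sphere, of 0 1 H e]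
        continuous_on_subset[OF H subset_UNIV] e by metis
    have P: "integrable unit_ival (\<lambda>t. h t * p (cis (2 * pi * t)))"
        "(\<integral>t. h t * p (cis (2 * pi * t)) \<partial>unit_ival) = 0"
      using orthogonal_trig_poly[OF trig_polys_compose_cis[OF p(1)]] by auto
    have mp: "(\<lambda>t. p (cis (2 * pi * t))) \<in> borel_measurable borel"
    proof (rule borel_measurable_continuous_onI, rule continuous_on_compose2[of UNIV p])
      show "continuous_on UNIV p"
        using p(1) by (simp add: real_polynomial_function_eq continuous_on_polymonial_function)
    qed (auto intro!: continuous_intros)
    have bd: "\<bar>H (cis (2 * pi * t)) - p (cis (2 * pi * t))\<bar> \<le> e" for t
      using p(2)[of "cis (2 * pi * t)"] by (simp add: less_imp_le)
    have D: "integrable unit_ival (\<lambda>t. h t * (H (cis (2 * pi * t)) - p (cis (2 * pi * t))))"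
      using mH mp bd by (intro integrable_mult_bounded[OF h_int, where B=e]) auto
    have "(\<integral>t. h t * H (cis (2 * pi * t)) \<partial>unit_ival)
        = (\<integral>t. h t * (H (cis (2 * pi * t)) - p (cis (2 * pi * t))) + h t * p (cis (2 * pi * t)) \<partial>unit_ival)"
      by (simp add: algebra_simps)
    also have "\<dots> = (\<integral>t. h t * (H (cis (2 * pi * t)) - p (cis (2 * pi * t))) \<partial>unit_ival)"
      using D P by (subst Bochner_Integration.integral_add) auto
    also have "\<bar>\<dots>\<bar> \<le> (\<integral>t. \<bar>h t * (H (cis (2 * pi * t)) - p (cis (2 * pi * t)))\<bar> \<partial>unit_ival)"
      by (rule integral_abs_bound)
    also have "\<dots> \<le> (\<integral>t. e * \<bar>h t\<bar> \<partial>unit_ival)"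
    proof (rule integral_mono[OF integrable_abs[OF D]])
      show "\<bar>h t * (H (cis (2 * pi * t)) - p (cis (2 * pi * t)))\<bar> \<le> e * \<bar>h t\<bar>" for t
        using mult_left_mono[OF bd, of "\<bar>h t\<bar>" t] by (simp only: abs_mult mult.commute[of e])
    qed (use h_int in simp)
    finally show ?thesis by simp
  qed
  then have "\<bar>\<integral>t. h t * H (cis (2 * pi * t)) \<partial>unit_ival\<bar> \<le> 0"
  proof -
    assume *: "\<And>e. e > 0 \<Longrightarrow> \<bar>\<integral>t. h t * H (cis (2 * pi * t)) \<partial>unit_ival\<bar> \<le> e * (\<integral>t. \<bar>h t\<bar> \<partial>unit_ival)"
    \<comment> \<open>The added 1 makes division by \<open>B\<close> possible even if h
      vanishes.\<close>
    define B where "B = (\<integral>t. \<bar>h t\<bar> \<partial>unit_ival) + 1"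
    have B: "B > 0" "(\<integral>t. \<bar>h t\<bar> \<partial>unit_ival) \<le> B"
      unfolding B_def by (intro add_nonneg_pos integral_nonneg_AE) auto
    show ?thesis
    proof (rule field_le_epsilon)
      fix d :: real assume d: "d > 0"
      have "d / B * (\<integral>t. \<bar>h t\<bar> \<partial>unit_ival) \<le> d / B * B"
        using d B by (intro mult_left_mono) auto
      with *[of "d / B"] d B show "\<bar>\<integral>t. h t * H (cis (2 * pi * t)) \<partial>unit_ival\<bar> \<le> 0 + d" by simp
    qed
  qed
  then show ?thesis by simp
qed

private lemma orthogonal_closed:
  assumes K: "closed K" "K \<noteq> {}"
  shows "(\<integral>t. h t * indicator K (cis (2 * pi * t)) \<partial>unit_ival) = 0"
proof -
  \<comment> \<open>Continuous functions that equal 1 on K and, at each point off the closed set K,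
    vanish for all large n.\<close>
  define H where "H n z = max 0 (1 - real n * infdist z K)" for n and z :: complex
  have H01: "0 \<le> H n z" "H n z \<le> 1" for n z by (auto simp: H_def infdist_nonneg)
  have Hc: "continuous_on UNIV (H n)" for n
    unfolding H_def by (intro continuous_intros continuous_on_infdist)
  have mH: "(\<lambda>t. H n (cis (2 * pi * t))) \<in> borel_measurable borel" for n
    by (rule borel_measurable_continuous_onI, rule continuous_on_compose2[OF Hc])
       (auto intro!: continuous_intros)
  note mK = measurable_indicator_cis[OF K(1)]
  have lim: "(\<lambda>n. H n z) \<longlonglongrightarrow> indicator K z" for z
  proof (cases "z \<in> K")
    case True
    then show ?thesis by (simp add: H_def infdist_zero)
  next
    case False
    then have pos: "infdist z K > 0" using K by (simp add: infdist_pos_not_in_closed)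
    have "\<forall>\<^sub>F n in sequentially. H n z = 0"
    proof -
      have "\<forall>\<^sub>F n in sequentially. real n > 1 / infdist z K"
        by (rule filterlim_at_top_dense[THEN iffD1, OF filterlim_real_sequentially, rule_format])
      then show ?thesis
        by eventually_elim (use pos in \<open>auto simp: H_def field_simps\<close>)
    qed
    then show ?thesis using False by (simp add: tendsto_eventually)
  qed
  have "(\<lambda>n. \<integral>t. h t * H n (cis (2 * pi * t)) \<partial>unit_ival) \<longlonglongrightarrow>
      (\<integral>t. h t * indicator K (cis (2 * pi * t)) \<partial>unit_ival)"
  proof (rule integral_dominated_convergence[where w="\<lambda>t. \<bar>h t\<bar>"])
    show "(\<lambda>t. h t * indicator K (cis (2 * pi * t))) \<in> borel_measurable unit_ival"
      using mK h_int by auto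
    show "(\<lambda>t. h t * H n (cis (2 * pi * t))) \<in> borel_measurable unit_ival" for n
      using mH[of n] h_int by auto
    show "AE t in unit_ival. norm (h t * H n (cis (2 * pi * t))) \<le> \<bar>h t\<bar>" for n
      using H01[of n] by (auto simp: abs_mult intro!: mult_left_le)
    show "AE t in unit_ival. (\<lambda>n. h t * H n (cis (2 * pi * t))) \<longlonglongrightarrow> h t * indicator K (cis (2 * pi * t))"
      by (intro AE_I2 tendsto_mult tendsto_const lim)
    show "integrable unit_ival (\<lambda>t. \<bar>h t\<bar>)"
      using h_int by simp
  qed
  then have "(\<lambda>n. 0) \<longlonglongrightarrow> (\<integral>t. h t * indicator K (cis (2 * pi * t)) \<partial>unit_ival)"
    unfolding orthogonal_continuous[OF Hc] .
  then show ?thesis by (rule LIMSEQ_unique[OF _ tendsto_const])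
qed

private lemma integral_tail_zero: "(\<integral>t. h t * indicator {x<..} t \<partial>unit_ival) = 0"
proof -
  consider "x < 0" | "x \<ge> 1" | "0 \<le> x" "x < 1" by linarith
  then show ?thesis
  proof cases
    case 1
    then have "(\<integral>t. h t * indicator {x<..} t \<partial>unit_ival) = (\<integral>t. h t \<partial>unit_ival)"
      by (intro Bochner_Integration.integral_cong) (auto simp: indicator_def)
    then show ?thesis using h_mean by simp
  next
    case 2
    then have "(\<integral>t. h t * indicator {x<..} t \<partial>unit_ival) = (\<integral>t. 0 \<partial>unit_ival)"
      by (intro Bochner_Integration.integral_cong) (auto simp: indicator_def)
    then show ?thesis by simp
  next
    case 3
    \<comment> \<open>The closed arc swept by [0, x]. The angle is injective on [0, 1), so there
      membership in the arc means t \<le> x; t = 1 falls on the same point as 0 but is a null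
      set.\<close>
    define K where "K = (\<lambda>t. cis (2 * pi * t)) ` {0..x}"
    have "compact K" unfolding K_def
      by (intro compact_continuous_image continuous_intros) auto
    then have K: "closed K" "K \<noteq> {}" using 3 by (auto simp: K_def compact_imp_closed)
    have iff: "cis (2 * pi * t) \<in> K \<longleftrightarrow> t \<le> x" if t: "0 \<le> t" "t < 1" for t
    proof
      assume "cis (2 * pi * t) \<in> K"
      then obtain u where u: "0 \<le> u" "u \<le> x" "cis (2 * pi * t) = cis (2 * pi * u)" by (auto simp: K_def)
      then obtain n :: int where "2 * pi * t = 2 * pi * u + 2 * pi * of_int n"
        using sin_cos_eq_iff[of "2 * pi * t" "2 * pi * u"] by (auto simp: complex_eq_iff)
      then have "2 * pi * t = 2 * pi * (u + of_int n)" by (simp add: algebra_simps)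
      then have n: "t = u + of_int n" by simp
      with t u 3 have "of_int n < (1::real)" "of_int n > (-1::real)" by auto
      then have "n = 0" by linarith
      with n u show "t \<le> x" by simp
    qed (use that in \<open>auto simp: K_def\<close>)
    note mK = measurable_indicator_cis[OF K(1)]
    have "(\<integral>t. h t * indicator {x<..} t \<partial>unit_ival) =
        (\<integral>t. h t - h t * indicator K (cis (2 * pi * t)) \<partial>unit_ival)"
    proof (rule integral_cong_AE)
      have "AE t in lborel. t \<noteq> (1::real)" by (rule AE_lborel_singleton)
      then show "AE t in unit_ival. h t * indicator {x<..} t =
          h t - h t * indicator K (cis (2 * pi * t))"
        unfolding AE_unit_ival_iff by eventually_elim (auto simp: indicator_def iff)
    qed (use mK h_int in auto)
    also have "\<dots> = (\<integral>t. h t \<partial>unit_ival) - (\<integral>t. h t * indicator K (cis (2 * pi * t)) \<partial>unit_ival)"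
      using mK by (intro Bochner_Integration.integral_diff h_int
                         integrable_mult_bounded[OF h_int, where B=1]) (auto simp: indicator_def)
    also have "\<dots> = 0" using h_mean orthogonal_closed[OF K] by simp
    finally show ?thesis .
  qed
qed

lemma trig_complete: "AE t in unit_ival. h t = 0"
proof -
  \<comment> \<open>h vanishes almost everywhere if its positive and negative parts are densities of
    the same measure. These two measures are finite and are compared on the half-lines
    \<open>{x<..}\<close>.\<close>
  define hp hm :: "real \<Rightarrow> real" where
    "hp t = indicator {0..1} t * max 0 (h t)" and "hm t = indicator {0..1} t * max 0 (- h t)" for t
  have hL: "integrable lborel (\<lambda>t. indicator {0..1} t * h t)"
    using h_int by (simp add: integrable_unit_ival_iff)
  have hpm: "hp t = max 0 (indicator {0..1} t * h t)" "hm t = max 0 (- (indicator {0..1} t * h t))"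
      for t
    by (auto simp: hp_def hm_def indicator_def)
  have mh [measurable]: "(\<lambda>t. indicator {0..1} t * h t) \<in> borel_measurable borel"
    using borel_measurable_integrable[OF hL] by simp
  have [measurable]: "hp \<in> borel_measurable borel" "hm \<in> borel_measurable borel"
    unfolding hpm[abs_def] using mh by simp_all
  have i: "integrable lborel hp" "integrable lborel hm"
    unfolding hpm[abs_def] using hL by (auto intro!: integrable_max)
  have nn: "hp t \<ge> 0" "hm t \<ge> 0" for t by (auto simp: hpm)
  have tail: "(\<integral>t. hp t * indicator {x<..} t \<partial>lborel) = (\<integral>t. hm t * indicator {x<..} t \<partial>lborel)" for x
  proof -
    have "(\<integral>t. hp t * indicator {x<..} t \<partial>lborel) - (\<integral>t. hm t * indicator {x<..} t \<partial>lborel) =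
        (\<integral>t. hp t * indicator {x<..} t - hm t * indicator {x<..} t \<partial>lborel)"
      using i by (intro Bochner_Integration.integral_diff[symmetric] integrable_mult_bounded[where B=1])
                 (auto simp: indicator_def)
    also have "\<dots> = (\<integral>t. h t * indicator {x<..} t \<partial>unit_ival)"
      unfolding integral_unit_ival
      by (intro Bochner_Integration.integral_cong) (auto simp: hpm indicator_def)
    finally show ?thesis by (simp add: integral_tail_zero)
  qed
  have em: "emeasure (density lborel (\<lambda>t. ennreal (g t))) {x<..} =
      ennreal (\<integral>t. g t * indicator {x<..} t \<partial>lborel)"
    if g: "integrable lborel g" "g \<in> borel_measurable borel" "\<And>t. g t \<ge> 0" for g :: "real \<Rightarrow> real" and x
  proof -
    have "emeasure (density lborel (\<lambda>t. ennreal (g t))) {x<..} =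
        (\<integral>\<^sup>+t. ennreal (g t * indicator {x<..} t) \<partial>lborel)"
      using g by (subst emeasure_density) (auto intro!: nn_integral_cong simp: indicator_def)
    also have "\<dots> = ennreal (\<integral>t. g t * indicator {x<..} t \<partial>lborel)"
      using g by (intro nn_integral_eq_integral integrable_mult_bounded[where B=1])
                 (auto simp: indicator_def)
    finally show ?thesis .
  qed
  have "density lborel (\<lambda>t. ennreal (hp t)) = density lborel (\<lambda>t. ennreal (hm t))"
    by (rule measure_eqI_lessThan) (auto simp: em i nn tail)
  then have "AE t in lborel. ennreal (hp t) = ennreal (hm t)"
    by (subst (asm) sigma_finite_measure.density_unique_iff[OF sigma_finite_lborel]) auto
  then show ?thesis
    unfolding AE_unit_ival_iff
    by eventually_elim (auto simp: hp_def hm_def nn ennreal_inj max_def split: if_splits)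
qed

end

section \<open>Additive functions on the cube\<close>

lemma product_prob_space_unit_ival: "product_prob_space (\<lambda>_. unit_ival)"
  by (intro product_prob_spaceI prob_space_unit_ival)

interpretation unit_prod: product_prob_space "\<lambda>_. unit_ival" I for I
  by (rule product_prob_space_unit_ival)

lemma prob_space_cube: "prob_space cube"
  unfolding cube_def by (intro prob_space_PiM prob_space_unit_ival)

interpretation cube: prob_space cube
  by (rule prob_space_cube)

lemma space_cube: "space cube = (UNIV \<rightarrow>\<^sub>E {0..1})"
  by (simp add: cube_def space_PiM)

lemma measurable_cube_component [measurable]: "(\<lambda>x. x k) \<in> measurable cube unit_ival"
  unfolding cube_def by measurable

lemma measurable_cube_component_borel [measurable]: "(\<lambda>x. x k) \<in> borel_measurable cube"
  using measurable_compose[OF measurable_cube_component measurable_unit_ival_ident] by simp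

lemma distr_cube_component: "distr cube unit_ival (\<lambda>x. x k) = unit_ival"
  unfolding cube_def by (intro distr_PiM_component prob_space_unit_ival) simp

lemma integral_cube_component:
  "f \<in> borel_measurable unit_ival \<Longrightarrow> (\<integral>x. f (x k) \<partial>cube) = (\<integral>t. f t \<partial>unit_ival)"
  for f :: "real \<Rightarrow> real"
  using integral_distr[OF measurable_cube_component, of f k] by (simp add: distr_cube_component)

lemma integrable_cube_component:
  "integrable unit_ival f \<Longrightarrow> integrable cube (\<lambda>x. f (x k))" for f :: "real \<Rightarrow> real"
  by (rule integrable_distr[OF measurable_cube_component[of k]]) (simp add: distr_cube_component)

lemma l2_cube_component: "f \<in> l2 unit_ival \<Longrightarrow> (\<lambda>x. f (x k)) \<in> l2 cube"
  using integrable_cube_component[OF l2_square_integrable, of f k]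
    measurable_compose[OF measurable_cube_component l2_measurable, of f k]
  by (simp only: l2_def[of cube]) simp

lemma cube_component_product:
  fixes f g :: "real \<Rightarrow> real"
  assumes "k \<noteq> l" "integrable unit_ival f" "integrable unit_ival g"
  shows "integrable cube (\<lambda>x. f (x k) * g (x l))"
    and "(\<integral>x. f (x k) * g (x l) \<partial>cube) = (\<integral>t. f t \<partial>unit_ival) * (\<integral>t. g t \<partial>unit_ival)"
proof -
  \<comment> \<open>The remaining coordinates carry the constant 1, whose integral is 1, so that the
    product theorem over the whole index set applies.\<close>
  define h where "h i = (if i = k then f else if i = l then g else (\<lambda>_. 1))" for i
  have h: "integrable unit_ival (h i)" for i using assms by (simp add: h_def)
  have split: "(\<Prod>i\<in>UNIV. F i) = F k * (F l * (\<Prod>i\<in>UNIV - {k} - {l}. F i))" for F :: "'a \<Rightarrow> real"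
    using assms(1) by (subst prod.remove[of _ k], simp, simp, subst prod.remove[of _ l]) auto
  have "(\<Prod>i\<in>UNIV. h i (x i)) = f (x k) * g (x l)" for x
    using assms(1) by (subst split) (simp add: h_def)
  moreover have "(\<Prod>i\<in>UNIV. \<integral>t. h i t \<partial>unit_ival) = (\<integral>t. f t \<partial>unit_ival) * (\<integral>t. g t \<partial>unit_ival)"
    using assms(1) unit_ival.prob_space by (subst split) (simp add: h_def)
  ultimately show "integrable cube (\<lambda>x. f (x k) * g (x l))"
    and "(\<integral>x. f (x k) * g (x l) \<partial>cube) = (\<integral>t. f t \<partial>unit_ival) * (\<integral>t. g t \<partial>unit_ival)"
    using unit_prod.product_integrable_prod[of UNIV h] unit_prod.product_integral_prod[of UNIV h] h
    by (simp_all add: cube_def)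
qed

definition centred_l2 :: "(real \<Rightarrow> real) set" where
  "centred_l2 = {g \<in> l2 unit_ival. (\<integral>t. g t \<partial>unit_ival) = 0}"

lemma additive_l2_eq: "additive_l2 = oplus (\<lambda>k. centred_l2)"
  by (simp add: additive_l2_def centred_l2_def)

lemma centred_l2_l2: "f \<in> centred_l2 \<Longrightarrow> f \<in> l2 unit_ival"
  by (simp add: centred_l2_def)

lemma integrable_l2_unit_ival: "f \<in> l2 unit_ival \<Longrightarrow> integrable unit_ival f"
  by (rule l2_integrable) (rule unit_ival.finite_measure_axioms)

lemma centred_l2_diff: "f \<in> centred_l2 \<Longrightarrow> g \<in> centred_l2 \<Longrightarrow> (\<lambda>t. f t - g t) \<in> centred_l2"
  by (simp add: centred_l2_def l2_diff integrable_l2_unit_ival)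

lemma centred_l2_scale: "f \<in> centred_l2 \<Longrightarrow> (\<lambda>t. c * f t) \<in> centred_l2"
  by (simp add: centred_l2_def l2_scale)

lemma centred_l2_zero: "(\<lambda>t. 0) \<in> centred_l2"
  by (simp add: centred_l2_def l2_zero)

lemma centred_l2_sum:
  "(\<And>i. i \<in> I \<Longrightarrow> f i \<in> centred_l2) \<Longrightarrow> (\<lambda>t. \<Sum>i\<in>I. f i t) \<in> centred_l2"
  by (auto simp: centred_l2_def l2_sum integrable_l2_unit_ival)

lemma phi_centred: "j \<ge> 1 \<Longrightarrow> phi j \<in> centred_l2"
  by (simp add: centred_l2_def phi_l2 integral_phi)

lemma psi_centred: "psi j \<in> centred_l2"
  by (simp add: centred_l2_def psi_l2 integral_psi)

lemma oplusI: "(\<And>k. g k \<in> S k) \<Longrightarrow> (\<lambda>x. \<Sum>k\<in>UNIV. g k (x k)) \<in> oplus S"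
  by (auto simp: oplus_def)

lemma oplusE:
  assumes "f \<in> oplus S"
  obtains g where "f = (\<lambda>x. \<Sum>k\<in>UNIV. g k (x k))" "\<And>k. g k \<in> S k"
  using assms by (auto simp: oplus_def)

lemma additive_sum_l2: "(\<And>k. f k \<in> l2 unit_ival) \<Longrightarrow> (\<lambda>x. \<Sum>k\<in>UNIV. f k (x k)) \<in> l2 cube"
  by (intro l2_sum l2_cube_component)

lemma additive_l2_l2: "f \<in> additive_l2 \<Longrightarrow> f \<in> l2 cube"
  unfolding additive_l2_eq by (auto elim!: oplusE intro: additive_sum_l2 centred_l2_l2)

text \<open>Functions of different coordinates are independent and, being centred, orthogonal.
  Because of this the loss and the adjoint both split into sums over the components.\<close>

lemma inner_cube_components:
  assumes "f \<in> centred_l2" "g \<in> centred_l2"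
  shows "l2_inner cube (\<lambda>x. f (x k)) (\<lambda>x. g (x l)) = (if k = l then l2_inner unit_ival f g else 0)"
proof (cases "k = l")
  case True
  have "(\<lambda>t. f t * g t) \<in> borel_measurable unit_ival"
    using assms by (intro borel_measurable_times l2_measurable centred_l2_l2)
  from integral_cube_component[OF this, of l] True show ?thesis by (simp add: l2_inner_def)
next
  case False
  with cube_component_product(2)[OF False, of f g] assms show ?thesis
    by (simp add: l2_inner_def centred_l2_def integrable_l2_unit_ival)
qed

lemma inner_additive:
  assumes "\<And>k. f k \<in> centred_l2" "\<And>k. g k \<in> centred_l2"
  shows "l2_inner cube (\<lambda>x. \<Sum>k\<in>UNIV. f k (x k)) (\<lambda>x. \<Sum>k\<in>UNIV. g k (x k))
       = (\<Sum>k\<in>UNIV. l2_inner unit_ival (f k) (g k))"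
proof -
  have "l2_inner cube (\<lambda>x. \<Sum>k\<in>UNIV. f k (x k)) (\<lambda>x. \<Sum>k\<in>UNIV. g k (x k))
      = (\<Sum>k\<in>UNIV. \<Sum>l\<in>UNIV. l2_inner cube (\<lambda>x. f k (x k)) (\<lambda>x. g l (x l)))"
    using assms
    by (subst l2_inner_sum_left)
       (auto intro!: l2_cube_component additive_sum_l2 centred_l2_l2 sum.cong l2_inner_sum_right)
  also have "\<dots> = (\<Sum>k\<in>UNIV. l2_inner unit_ival (f k) (g k))"
    using assms by (simp add: inner_cube_components)
  finally show ?thesis .
qed

lemma norm_additive:
  assumes "\<And>k. f k \<in> centred_l2"
  shows "(l2_norm cube (\<lambda>x. \<Sum>k\<in>UNIV. f k (x k)))\<^sup>2 = (\<Sum>k\<in>UNIV. (l2_norm unit_ival (f k))\<^sup>2)"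
  using inner_additive[of f f] assms by (simp add: l2_norm_eq_inner)

lemma norm_additive_diff:
  assumes "\<And>k. f k \<in> centred_l2" "\<And>k. g k \<in> centred_l2"
  shows "(l2_norm cube (\<lambda>x. (\<Sum>k\<in>UNIV. f k (x k)) - (\<Sum>k\<in>UNIV. g k (x k))))\<^sup>2
       = (\<Sum>k\<in>UNIV. (l2_norm unit_ival (\<lambda>t. f k t - g k t))\<^sup>2)"
  using norm_additive[of "\<lambda>k t. f k t - g k t"] assms by (simp add: sum_subtractf centred_l2_diff)

lemma additive_l2_component: "f \<in> centred_l2 \<Longrightarrow> (\<lambda>x. f (x k)) \<in> additive_l2"
proof -
  assume f: "f \<in> centred_l2"
  have "(\<lambda>x. \<Sum>l\<in>UNIV. (if l = k then f else (\<lambda>_. 0)) (x l)) \<in> oplus (\<lambda>k. centred_l2)"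
    using f by (intro oplusI) (simp add: centred_l2_zero)
  moreover have "(\<Sum>l\<in>UNIV. (if l = k then f else (\<lambda>_. 0)) (x l)) = f (x k)" for x
    by (subst sum.remove[of _ k]) auto
  ultimately show ?thesis by (simp add: additive_l2_eq)
qed

lemma inner_component_additive:
  assumes "f \<in> centred_l2" "\<And>k. g k \<in> centred_l2"
  shows "l2_inner cube (\<lambda>x. f (x k)) (\<lambda>x. \<Sum>l\<in>UNIV. g l (x l)) = l2_inner unit_ival f (g k)"
  using assms
  by (subst l2_inner_sum_right)
     (auto intro!: l2_cube_component centred_l2_l2 simp: inner_cube_components)

section \<open>Periodic shifts in one coordinate\<close>

lemma measurable_frac_unit_ival:
  assumes "f \<in> borel_measurable M"
  shows "(\<lambda>x. frac (f x)) \<in> measurable M unit_ival"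
proof -
  have "(\<lambda>x. frac (f x)) \<in> measurable M (restrict_space borel {0..1})"
    using measurable_compose[OF assms borel_measurable_frac]
    by (intro measurable_restrict_space2) (auto intro: less_imp_le[OF frac_lt_1])
  then show ?thesis by (simp add: measurable_cong_sets[OF refl sets_unit_ival])
qed

lemma integral_frac_shift:
  fixes f :: "real \<Rightarrow> real"
  assumes "y \<in> {0..1}" "f \<in> borel_measurable unit_ival"
  shows "(\<integral>t. f (frac (t - y)) \<partial>unit_ival) = (\<integral>t. f t \<partial>unit_ival)"
  using integral_distr[OF distr_frac_unit_ival(1)[OF assms(1)] assms(2)]
  by (simp add: distr_frac_unit_ival(2)[OF assms(1)])

lemma integrable_frac_shift:
  fixes f :: "real \<Rightarrow> real"
  assumes "y \<in> {0..1}" "integrable unit_ival f"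
  shows "integrable unit_ival (\<lambda>t. f (frac (t - y)))"
  by (rule integrable_distr[OF distr_frac_unit_ival(1)[OF assms(1)]])
     (simp add: distr_frac_unit_ival(2)[OF assms(1)] assms(2))

lemma cos_frac: "cos (2 * pi * real j * frac t) = cos (2 * pi * real j * t)"
  and sin_frac: "sin (2 * pi * real j * frac t) = sin (2 * pi * real j * t)"
proof -
  have "2 * pi * real j * frac t = 2 * pi * real j * t + 2 * pi * of_int (- int j * \<lfloor>t\<rfloor>)"
    by (simp add: frac_def algebra_simps)
  then have e: "2 * pi * real j * frac t = 2 * pi * real j * t + of_int (- int j * \<lfloor>t\<rfloor>) * (2 * pi)"
    by (simp only: mult.commute)
  show "cos (2 * pi * real j * frac t) = cos (2 * pi * real j * t)"
    unfolding e using cos.plus_of_int[of "2 * pi * real j * t" "- int j * \<lfloor>t\<rfloor>"] by (simp add: ac_simps)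
  show "sin (2 * pi * real j * frac t) = sin (2 * pi * real j * t)"
    unfolding e using sin.plus_of_int[of "2 * pi * real j * t" "- int j * \<lfloor>t\<rfloor>"] by (simp add: ac_simps)
qed

lemma phi_frac: "phi j (frac t) = phi j t"
  using cos_frac[of j t] by (simp add: phi_def)

lemma psi_frac: "psi j (frac t) = psi j t"
  using sin_frac[of j t] by (simp add: psi_def)

text \<open>The angle is split into y and t - y so that t enters through \<open>frac (t - y)\<close>
  alone. An integral of a shifted function against \<open>phi j\<close> thus becomes the integral of
  one function of the rotated variable.\<close>

lemma phi_shift:
  assumes "j \<ge> 1"
  shows "phi j t = cos (2 * pi * real j * y) * phi j (frac (t - y)) -
      sin (2 * pi * real j * y) * psi j (frac (t - y))"
proof -
  have "2 * pi * real j * t = 2 * pi * real j * y + 2 * pi * real j * (t - y)"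
    by (simp add: algebra_simps)
  then show ?thesis
    unfolding phi_frac psi_frac unfolding phi_pos[OF assms] psi_def
        by (simp only: cos_add) (simp add: right_diff_distrib)
qed

lemma phi_diff: "j \<ge> 1 \<Longrightarrow> phi j (t - y) =
    cos (2 * pi * real j * y) * phi j t + sin (2 * pi * real j * y) * psi j t"
  by (simp add: phi_pos psi_def right_diff_distrib cos_diff algebra_simps)

lemma psi_diff: "j \<ge> 1 \<Longrightarrow> psi j (t - y) =
    cos (2 * pi * real j * y) * psi j t - sin (2 * pi * real j * y) * phi j t"
  by (simp add: phi_pos psi_def right_diff_distrib sin_diff algebra_simps)

lemma integral_shift_phi:
  assumes f: "f \<in> l2 unit_ival" and y: "y \<in> {0..1}" and j: "j \<ge> 1"
  shows "(\<integral>t. f (frac (t - y)) * phi j t \<partial>unit_ival) =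
     cos (2 * pi * real j * y) * l2_inner unit_ival f (phi j) - sin (2 * pi * real j * y) * l2_inner unit_ival f (psi j)"
proof -
  define g where "g s = cos (2 * pi * real j * y) * (f s * phi j s) -
      sin (2 * pi * real j * y) * (f s * psi j s)" for s
  have i: "integrable unit_ival (\<lambda>s. f s * phi j s)" "integrable unit_ival (\<lambda>s. f s * psi j s)"
    using f by (auto intro: l2_mult_integrable phi_l2 psi_l2)
  then have "integrable unit_ival g" unfolding g_def by simp
  then have gm: "g \<in> borel_measurable unit_ival" by simp
  have "(\<integral>t. f (frac (t - y)) * phi j t \<partial>unit_ival) = (\<integral>t. g (frac (t - y)) \<partial>unit_ival)"
    by (subst phi_shift[OF j, of _ y]) (simp add: g_def algebra_simps)
  also have "\<dots> = (\<integral>t. g t \<partial>unit_ival)" by (rule integral_frac_shift[OF y gm])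
  finally show ?thesis using i by (simp add: g_def l2_inner_def)
qed

text \<open>Fubini's theorem with coordinate k split off, written with \<open>y(k := t)\<close> to
  match \<open>marginal\<close>. For the kernel, measurability of the inner integral will come from
  the L2 expansion of its marginal.\<close>

lemma cube_eq_pair:
  fixes F :: "('d::finite \<Rightarrow> real) \<Rightarrow> real"
  assumes "integrable cube F" "(\<lambda>t. \<integral>y. F (y(k := t)) \<partial>(\<Pi>\<^sub>M l\<in>UNIV - {k}. unit_ival)) \<in>
      borel_measurable unit_ival"
  shows "(\<integral>x. F x \<partial>cube) = (\<integral>t. \<integral>y. F (y(k := t)) \<partial>(\<Pi>\<^sub>M l\<in>UNIV - {k}. unit_ival) \<partial>unit_ival)"
proof -
  have U: "{k} \<union> (UNIV - {k}) = UNIV" by auto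
  have "(\<integral>x. F x \<partial>cube) = (\<integral>x. F x \<partial>(\<Pi>\<^sub>M l\<in>{k} \<union> (UNIV - {k}). unit_ival))"
    by (simp add: cube_def)
  also have "\<dots> = (\<integral>x. (\<integral>y. F (merge {k} (UNIV - {k}) (x, y)) \<partial>(\<Pi>\<^sub>M l\<in>UNIV -
      {k}. unit_ival)) \<partial>(\<Pi>\<^sub>M l\<in>{k}. unit_ival))"
    using assms(1) by (intro unit_prod.product_integral_fold) (auto simp: U cube_def)
  also have "\<dots> = (\<integral>x. (\<integral>y. F (y(k := x k)) \<partial>(\<Pi>\<^sub>M l\<in>UNIV - {k}. unit_ival)) \<partial>(\<Pi>\<^sub>M l\<in>{k}. unit_ival))"
  proof (intro Bochner_Integration.integral_cong refl)
    fix x y :: "'d \<Rightarrow> real"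
    have "merge {k} (UNIV - {k}) (x, y) = y(k := x k)" by (auto simp: merge_def fun_eq_iff)
    then show "F (merge {k} (UNIV - {k}) (x, y)) = F (y(k := x k))" by simp
  qed
  also have "\<dots> = (\<integral>t. \<integral>y. F (y(k := t)) \<partial>(\<Pi>\<^sub>M l\<in>UNIV - {k}. unit_ival) \<partial>unit_ival)"
    by (rule unit_prod.product_integral_singleton[OF assms(2)])
  finally show ?thesis .
qed

section \<open>The convolution as a Fourier multiplier\<close>

locale convolution_kernel =
  fixes a :: "('d::finite \<Rightarrow> real) \<Rightarrow> real" and b :: "'d \<Rightarrow> nat \<Rightarrow> real"
  assumes a_integrable: "integrable cube a"
    and a_expansion: "\<And>k. l2_sums unit_ival (\<lambda>j t. b k j * phi j t) (marginal a k)"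
begin

text \<open>A function of coordinate k is constant in the integral over the other coordinates, so
  against it the kernel acts through its kth marginal.\<close>

lemma integral_kernel_component:
  assumes g: "g \<in> borel_measurable borel" "\<And>t. \<bar>g t\<bar> \<le> B"
  shows "integrable cube (\<lambda>y. a y * g (y k))"
    and "(\<integral>y. a y * g (y k) \<partial>cube) = l2_inner unit_ival (marginal a k) g"
proof -
  show i: "integrable cube (\<lambda>y. a y * g (y k))"
    using g by (intro integrable_mult_bounded[OF a_integrable]) auto
  have e: "(\<integral>y. a (y(k := t)) * g ((y(k := t)) k) \<partial>(\<Pi>\<^sub>M l\<in>UNIV - {k}. unit_ival)) =
      marginal a k t * g t" for t
    by (simp add: marginal_def)
  have "marginal a k \<in> borel_measurable unit_ival"
    using a_expansion[of k] by (auto simp: l2_sums_def l2_def)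
  then have "(\<lambda>t. marginal a k t * g t) \<in> borel_measurable unit_ival"
    using measurable_unit_ival[OF g(1)] by simp
  then show "(\<integral>y. a y * g (y k) \<partial>cube) = l2_inner unit_ival (marginal a k) g"
    using cube_eq_pair[OF i, of k] by (simp only: e l2_inner_def)
qed

text \<open>The cosine expansion gives \<open>b k j\<close> as the coefficient along
  \<open>phi j\<close>, and \<open>phi j\<close> is sqrt 2 times the cosine. This is the source of
  the multiplier \<open>b k j / sqrt 2\<close>.\<close>

lemma kernel_cos:
  assumes "j \<ge> 1"
  shows "integrable cube (\<lambda>y. a y * cos (2 * pi * real j * y k))"
    and "(\<integral>y. a y * cos (2 * pi * real j * y k) \<partial>cube) = b k j / sqrt 2"
proof -
  show "integrable cube (\<lambda>y. a y * cos (2 * pi * real j * y k))"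
    by (rule integral_kernel_component(1)[where B=1]) auto
  have "(\<lambda>i. l2_inner unit_ival (\<lambda>t. b k i *
      phi i t) (phi j)) sums l2_inner unit_ival (marginal a k) (phi j)"
    by (intro l2_sums_inner a_expansion phi_l2 l2_scale)
  moreover have "l2_inner unit_ival (\<lambda>t. b k i * phi i t) (phi j) = (if i = j then b k j else 0)" for i
    using inner_phi_phi[OF assms, of i]
        by (simp add: l2_inner_scale_left l2_inner_commute[of _ "phi i"])
  ultimately have "(\<lambda>i. if i = j then b k j else 0) sums l2_inner unit_ival (marginal a k) (phi j)"
      by simp
  moreover have "(\<lambda>i. if i = j then b k j else 0) sums b k j" by (rule sums_single)
  ultimately have "l2_inner unit_ival (marginal a k) (phi j) = b k j" by (rule sums_unique2)
  moreover have "phi j = (\<lambda>t. sqrt 2 * cos (2 * pi * real j * t))" using assms by (auto simp: phi_pos)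
  ultimately have "sqrt 2 * l2_inner unit_ival (marginal a k) (\<lambda>t. cos (2 * pi * real j * t)) = b k j"
    by (simp add: l2_inner_scale_right)
  moreover have "(\<integral>y. a y * cos (2 * pi * real j * y k) \<partial>cube) =
      l2_inner unit_ival (marginal a k) (\<lambda>t. cos (2 * pi * real j * t))"
    by (rule integral_kernel_component(2)[where B=1]) auto
  ultimately show "(\<integral>y. a y * cos (2 * pi * real j * y k) \<partial>cube) = b k j / sqrt 2"
    by (simp add: field_simps)
qed

text \<open>A cosine series is orthogonal to all sines. Hence the convolution does not mix
  \<open>phi j\<close> with \<open>psi j\<close> and is diagonal in the trigonometric
  system.\<close>

lemma kernel_sin:
  shows "integrable cube (\<lambda>y. a y * sin (2 * pi * real j * y k))"
    and "(\<integral>y. a y * sin (2 * pi * real j * y k) \<partial>cube) = 0"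
proof -
  show "integrable cube (\<lambda>y. a y * sin (2 * pi * real j * y k))"
    by (rule integral_kernel_component(1)[where B=1]) auto
  have "(\<lambda>i. l2_inner unit_ival (\<lambda>t. b k i *
      phi i t) (psi j)) sums l2_inner unit_ival (marginal a k) (psi j)"
    by (intro l2_sums_inner a_expansion phi_l2 psi_l2 l2_scale)
  then have "(\<lambda>i. 0) sums l2_inner unit_ival (marginal a k) (psi j)"
    by (simp add: l2_inner_scale_left inner_phi_psi)
  then have "l2_inner unit_ival (marginal a k) (psi j) = 0" by (simp add: sums_0 sums_unique2)
  moreover have "psi j = (\<lambda>t. sqrt 2 * sin (2 * pi * real j * t))" by (auto simp: psi_def)
  ultimately have "sqrt 2 * l2_inner unit_ival (marginal a k) (\<lambda>t. sin (2 * pi * real j * t)) = 0"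
    by (simp add: l2_inner_scale_right)
  moreover have "(\<integral>y. a y * sin (2 * pi * real j * y k) \<partial>cube) =
      l2_inner unit_ival (marginal a k) (\<lambda>t. sin (2 * pi * real j * t))"
    by (rule integral_kernel_component(2)[where B=1]) auto
  ultimately show "(\<integral>y. a y * sin (2 * pi * real j * y k) \<partial>cube) = 0" by simp
qed

lemma conv_phi_integrand:
  assumes "j \<ge> 1"
  shows "integrable cube (\<lambda>y. phi j (frac (x k - y k)) * a y)"
    and "(\<integral>y. phi j (frac (x k - y k)) * a y \<partial>cube) = b k j / sqrt 2 * phi j (x k)"
proof -
  have e: "phi j (frac (x k - y k)) * a y =
      phi j (x k) * (a y * cos (2 * pi * real j * y k)) + psi j (x k) * (a y * sin (2 * pi * real j * y k))" for y
    by (simp add: phi_frac phi_diff[OF assms] algebra_simps)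
  show "integrable cube (\<lambda>y. phi j (frac (x k - y k)) * a y)"
    unfolding e using kernel_cos(1)[OF assms] kernel_sin(1)
    by (intro Bochner_Integration.integrable_add integrable_mult_right) auto
  show "(\<integral>y. phi j (frac (x k - y k)) * a y \<partial>cube) = b k j / sqrt 2 * phi j (x k)"
    unfolding e using kernel_cos[OF assms, of k] kernel_sin[of j k] by simp
qed

text \<open>The sines share the multiplier of the cosines. They do not occur in the expansions of
  the function classes; they serve as test functions when \<open>inv_adjoint\<close> is identified
  in the whole additive space.\<close>

lemma conv_psi:
  assumes "j \<ge> 1"
  shows "conv a (\<lambda>x. psi j (x k)) x = b k j / sqrt 2 * psi j (x k)"
proof -
  have e: "psi j (frac (x k - y k)) * a y =
      psi j (x k) * (a y * cos (2 * pi * real j * y k)) - phi j (x k) * (a y * sin (2 * pi * real j * y k))" for y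
    by (simp add: psi_frac psi_diff[OF assms] algebra_simps)
  show ?thesis
    unfolding conv_def e using kernel_cos[OF assms, of k] kernel_sin[of j k] by simp
qed

lemma conv_phi_poly:
  assumes "finite I" "\<And>i. i \<in> I \<Longrightarrow> i \<ge> 1"
  shows "conv a (\<lambda>x. \<Sum>i\<in>I. c i * phi i (x k)) x = (\<Sum>i\<in>I. c i * (b k i / sqrt 2 * phi i (x k)))"
proof -
  have "conv a (\<lambda>x. \<Sum>i\<in>I. c i * phi i (x k)) x =
      (\<integral>y. (\<Sum>i\<in>I. c i * (phi i (frac (x k - y k)) * a y)) \<partial>cube)"
    by (simp add: conv_def sum_distrib_right mult.assoc)
  also have "\<dots> = (\<Sum>i\<in>I. \<integral>y. c i * (phi i (frac (x k - y k)) * a y) \<partial>cube)"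
    using assms conv_phi_integrand(1)
        by (intro Bochner_Integration.integral_sum integrable_mult_right) auto
  also have "\<dots> = (\<Sum>i\<in>I. c i * (b k i / sqrt 2 * phi i (x k)))"
    using assms by (intro sum.cong refl) (simp add: conv_phi_integrand(2))
  finally show ?thesis .
qed

lemma conv_phi:
  assumes "j \<ge> 1"
  shows "conv a (\<lambda>x. phi j (x k)) x = b k j / sqrt 2 * phi j (x k)"
  using conv_phi_poly[of "{j}" "\<lambda>_. 1" k x] assms by simp

end

section \<open>The adjoint of the inverse convolution\<close>

context convolution_kernel
begin

text \<open>Integrating over x before y, rotation invariance turns the inner integral of the
  absolute value into \<open>\<bar>a y\<bar>\<close> times the L1 norm of f, so integrability of the
  kernel suffices.\<close>

lemma conv_integrand_integrable:
  assumes f: "f \<in> l2 unit_ival"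
  shows "integrable (cube \<Otimes>\<^sub>M cube) (\<lambda>(y, x). f (frac (x l - y l)) * a y)"
proof -
  interpret P: pair_prob_space "cube :: ('d \<Rightarrow> real) measure" "cube :: ('d \<Rightarrow> real) measure" ..
  have fi: "integrable unit_ival f" using f by (rule integrable_l2_unit_ival)
  have fm: "f \<in> borel_measurable unit_ival" using f by (rule l2_measurable)
  have [measurable]: "a \<in> borel_measurable cube" using a_integrable by simp
  have fr: "(\<lambda>z. frac (snd z l - fst z l)) \<in> measurable (cube \<Otimes>\<^sub>M cube) unit_ival"
    by (rule measurable_frac_unit_ival) measurable
  have shift: "(\<integral>x. \<bar>f (frac (x l - y l))\<bar> \<partial>cube) = (\<integral>t. \<bar>f t\<bar> \<partial>unit_ival)"
    "integrable cube (\<lambda>x. f (frac (x l - y l)))" if y: "y \<in> space cube" for y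
  proof -
    have y01: "y l \<in> {0..1}" using y by (auto simp: space_cube PiE_iff)
    have i: "integrable unit_ival (\<lambda>t. f (frac (t - y l)))"
      by (rule integrable_frac_shift[OF y01 fi])
    then show "integrable cube (\<lambda>x. f (frac (x l - y l)))" by (rule integrable_cube_component)
    have "(\<lambda>t. \<bar>f (frac (t - y l))\<bar>) \<in> borel_measurable unit_ival" using i by simp
    then have "(\<integral>x. \<bar>f (frac (x l - y l))\<bar> \<partial>cube) = (\<integral>t. \<bar>f (frac (t - y l))\<bar> \<partial>unit_ival)"
      by (rule integral_cube_component)
    also have "\<dots> = (\<integral>t. \<bar>f t\<bar> \<partial>unit_ival)"
      using integral_frac_shift[OF y01, of "\<lambda>t. \<bar>f t\<bar>"] fm by simp
    finally show "(\<integral>x. \<bar>f (frac (x l - y l))\<bar> \<partial>cube) = (\<integral>t. \<bar>f t\<bar> \<partial>unit_ival)" .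
  qed
  show ?thesis
  proof (rule P.Fubini_integrable)
    show "(\<lambda>(y, x). f (frac (x l - y l)) * a y) \<in> borel_measurable (cube \<Otimes>\<^sub>M cube)"
      using measurable_compose[OF fr fm] by (simp add: split_beta)
    have "(\<integral>x. norm (case (y, x) of (y, x) \<Rightarrow> f (frac (x l - y l)) * a y) \<partial>cube) =
        (\<integral>t. \<bar>f t\<bar> \<partial>unit_ival) * \<bar>a y\<bar>" if "y \<in> space cube" for y
      using shift(1)[OF that] by (simp add: abs_mult)
    then show "integrable cube (\<lambda>y. \<integral>x. norm (case (y, x) of (y, x) \<Rightarrow> f (frac (x l - y l)) *
        a y) \<partial>cube)"
      using a_integrable by (simp cong: Bochner_Integration.integrable_cong)
    show "AE y in cube. integrable cube (\<lambda>x. case (y, x) of (y, x) \<Rightarrow> f (frac (x l - y l)) * a y)"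
      using shift(2) by (intro AE_I2) auto
  qed
qed

text \<open>The components \<open>f l\<close> are arbitrary centred functions and may contain sines,
  so they are not expanded. Instead the order of integration is exchanged: for fixed y the integral
  over x is a coefficient of the rotated \<open>f k\<close>, and integration against the kernel
  leaves its cosine part.\<close>

lemma conv_inner_phi:
  assumes f: "\<And>l. f l \<in> centred_l2" and j: "j \<ge> 1"
  defines "F \<equiv> \<lambda>x. \<Sum>l\<in>UNIV. f l (x l)"
  shows "integrable cube (\<lambda>x. conv a F x * phi j (x k))"
    and "l2_inner cube (conv a F) (\<lambda>x. phi j (x k)) = b k j / sqrt 2 * l2_inner unit_ival (f k) (phi j)"
proof -
  interpret P: pair_prob_space "cube :: ('d \<Rightarrow> real) measure" "cube :: ('d \<Rightarrow> real) measure" ..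
  define H where "H y x = (\<Sum>l\<in>UNIV. f l (frac (x l - y l)) * a y) * phi j (x k)" for y x
  have H: "integrable (cube \<Otimes>\<^sub>M cube) (case_prod H)"
  proof -
    have "integrable (cube \<Otimes>\<^sub>M cube) (\<lambda>z. (\<Sum>l\<in>UNIV. f l (frac (snd z l - fst z l)) * a (fst z)) *
        phi j (snd z k))"
    proof (rule integrable_mult_bounded[where B=2])
      show "integrable (cube \<Otimes>\<^sub>M cube) (\<lambda>z. \<Sum>l\<in>UNIV. f l (frac (snd z l - fst z l)) * a (fst z))"
        using conv_integrand_integrable[OF centred_l2_l2[OF f]]
        by (intro Bochner_Integration.integrable_sum) (simp add: case_prod_beta')
      show "(\<lambda>z. phi j (snd z k)) \<in> borel_measurable (cube \<Otimes>\<^sub>M cube)" by measurable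
    qed (rule abs_phi_le)
    moreover have "case_prod H =
        (\<lambda>z. (\<Sum>l\<in>UNIV. f l (frac (snd z l - fst z l)) * a (fst z)) * phi j (snd z k))"
      by (auto simp: H_def fun_eq_iff)
    ultimately show ?thesis by simp
  qed
  have cH: "conv a F x * phi j (x k) = (\<integral>y. H y x \<partial>cube)" for x
  proof -
    have "conv a F x = (\<integral>y. (\<Sum>l\<in>UNIV. f l (frac (x l - y l)) * a y) \<partial>cube)"
      by (simp add: conv_def F_def sum_distrib_right)
    then show ?thesis by (simp add: H_def)
  qed
  show "integrable cube (\<lambda>x. conv a F x * phi j (x k))"
    unfolding cH using P.integrable_snd[OF H] .
  have inner: "(\<integral>x. H y x \<partial>cube) =
      a y * cos (2 * pi * real j * y k) * l2_inner unit_ival (f k) (phi j)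
    - a y * sin (2 * pi * real j * y k) * l2_inner unit_ival (f k) (psi j)"
    if y: "y \<in> space cube" for y
  proof -
    have y01: "y l \<in> {0..1}" for l using y by (auto simp: space_cube PiE_iff)
    have sh: "integrable unit_ival (\<lambda>t. f l (frac (t - y l)))" for l
      by (intro integrable_frac_shift y01 integrable_l2_unit_ival centred_l2_l2 f)
    have shm: "integrable unit_ival (\<lambda>t. f l (frac (t - y l)) * phi j t)" for l
      by (rule integrable_mult_bounded[OF sh, where B=2]) (auto intro: abs_phi_le measurable_unit_ival)
    \<comment> \<open>Coordinates l other than k contribute nothing, since \<open>phi j\<close> has
      mean zero and is taken in an independent coordinate.\<close>
    have z: "integrable cube (\<lambda>x. f l (frac (x l - y l)) * phi j (x k)) \<and>
        (\<integral>x. f l (frac (x l - y l)) * phi j (x k) \<partial>cube) =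
         (if l = k then \<integral>t. f k (frac (t - y k)) * phi j t \<partial>unit_ival else 0)" for l
    proof (cases "l = k")
      case True
      then show ?thesis
        using integrable_cube_component[OF shm[of k], of k] integral_cube_component[OF borel_measurable_integrable[OF shm[of k]], of k]
        by simp
    next
      case False
      have pi: "integrable unit_ival (phi j)" by (intro integrable_l2_unit_ival phi_l2)
      from cube_component_product[OF False sh[of l] pi] False integral_phi[OF j] show ?thesis by simp
    qed
    have "(\<integral>x. H y x \<partial>cube) = (\<integral>x. a y * (\<Sum>l\<in>UNIV. f l (frac (x l - y l)) * phi j (x k)) \<partial>cube)"
      by (simp add: H_def sum_distrib_right sum_distrib_left mult_ac)
    also have "\<dots> = a y * (\<Sum>l\<in>UNIV. \<integral>x. f l (frac (x l - y l)) * phi j (x k) \<partial>cube)"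
      using z by (simp add: Bochner_Integration.integral_sum)
    also have "\<dots> = a y * (\<integral>t. f k (frac (t - y k)) * phi j t \<partial>unit_ival)"
      using z by simp
    finally show ?thesis
      unfolding integral_shift_phi[OF centred_l2_l2[OF f] y01 j] by (simp add: algebra_simps)
  qed
  have "l2_inner cube (conv a F) (\<lambda>x. phi j (x k)) = (\<integral>x. \<integral>y. H y x \<partial>cube \<partial>cube)"
    by (simp add: l2_inner_def cH)
  also have "\<dots> = (\<integral>y. \<integral>x. H y x \<partial>cube \<partial>cube)"
    by (rule P.Fubini_integral[OF H])
  also have "\<dots> = (\<integral>y. a y * cos (2 * pi * real j * y k) * l2_inner unit_ival (f k) (phi j)
    - a y * sin (2 * pi * real j * y k) * l2_inner unit_ival (f k) (psi j) \<partial>cube)"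
    by (intro Bochner_Integration.integral_cong refl inner)
  also have "\<dots> = b k j / sqrt 2 * l2_inner unit_ival (f k) (phi j)"
    using kernel_cos[OF j, of k] kernel_sin[of j k] by simp
  finally show "l2_inner cube (conv a F) (\<lambda>x. phi j (x k)) =
      b k j / sqrt 2 * l2_inner unit_ival (f k) (phi j)" .
qed

end

section \<open>Cosine polynomials and the explicit form of Q\<close>

definition cos_poly :: "nat \<Rightarrow> (nat \<Rightarrow> real) \<Rightarrow> real \<Rightarrow> real" where
  "cos_poly m \<theta> t = (\<Sum>j=1..m. \<theta> j * phi j t)"

lemma cos_poly_centred: "cos_poly m \<theta> \<in> centred_l2"
  unfolding cos_poly_def[abs_def] by (intro centred_l2_sum centred_l2_scale phi_centred) simp

lemma cos_poly_diff: "cos_poly m \<theta> t - cos_poly m \<eta> t = cos_poly m (\<lambda>j. \<theta> j - \<eta> j) t"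
  by (simp add: cos_poly_def sum_subtractf left_diff_distrib)

lemma inner_phi_cos_poly:
  assumes "f \<in> centred_l2"
  shows "l2_inner unit_ival f (cos_poly m \<theta>) = (\<Sum>j=1..m. \<theta> j * l2_inner unit_ival f (phi j))"
  unfolding cos_poly_def[abs_def] using assms
  by (subst l2_inner_sum_right) (auto intro: l2_scale phi_l2 centred_l2_l2 simp: l2_inner_scale_right)

lemma norm_cos_poly: "(l2_norm unit_ival (cos_poly m \<theta>))\<^sup>2 = (\<Sum>j=1..m. (\<theta> j)\<^sup>2)"
proof -
  have "l2_inner unit_ival (cos_poly m \<theta>) (phi j) = \<theta> j" if "j \<in> {1..m}" for j
  proof -
    have "l2_inner unit_ival (cos_poly m \<theta>) (phi j) = l2_inner unit_ival (phi j) (cos_poly m \<theta>)"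
      by (rule l2_inner_commute)
    also have "\<dots> = (\<Sum>i=1..m. \<theta> i * (if j = i then 1 else 0))"
      using that by (subst inner_phi_cos_poly) (auto intro!: phi_centred simp: inner_phi_phi)
    also have "\<dots> = \<theta> j" using that by (simp add: if_distrib[of "\<lambda>t. _ * t"] cong: if_cong)
    finally show ?thesis .
  qed
  then show ?thesis
    unfolding l2_norm_eq_inner
    by (simp add: inner_phi_cos_poly[OF cos_poly_centred] power2_eq_square)
qed

lemma centred_l2_trig_complete:
  assumes h: "h \<in> centred_l2"
    and "\<And>j. j \<ge> 1 \<Longrightarrow> l2_inner unit_ival h (phi j) = 0" "\<And>j. j \<ge> 1 \<Longrightarrow> l2_inner unit_ival h (psi j) = 0"
  shows "l2_norm unit_ival h = 0"
  using trig_complete[of h] assms l2_norm_eq_0_iff[OF centred_l2_l2[OF h]]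
  by (simp add: centred_l2_def integrable_l2_unit_ival l2_inner_def)

context convolution_kernel
begin

text \<open>The multiplier of the convolution is inverted coefficient by coefficient, which gives
  the kth component of an explicit representative of Qg.\<close>

definition inv_cos_poly :: "('d \<Rightarrow> nat) \<Rightarrow> ('d \<Rightarrow> nat \<Rightarrow> real) \<Rightarrow> 'd \<Rightarrow> real \<Rightarrow> real" where
  "inv_cos_poly m \<theta> k = cos_poly (m k) (\<lambda>j. sqrt 2 / b k j * \<theta> k j)"

text \<open>The polynomial \<open>u0\<close> has the adjoint property, so the choice in
  \<open>inv_adjoint\<close> is made from a nonempty set and inherits this property. The candidates
  are determined up to null sets, which is why the last claim is a vanishing seminorm and not an
  equation.\<close>

lemma inv_adjoint_cos_poly:
  fixes m :: "'d \<Rightarrow> nat" and \<theta> :: "'d \<Rightarrow> nat \<Rightarrow> real" and f :: "('d \<Rightarrow> real) \<Rightarrow> real"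
  assumes b: "\<And>k j. j \<ge> 1 \<Longrightarrow> b k j \<noteq> 0"
  defines "g \<equiv> \<lambda>x. \<Sum>k\<in>UNIV. cos_poly (m k) (\<theta> k) (x k)"
  defines "u0 \<equiv> \<lambda>x. \<Sum>k\<in>UNIV. inv_cos_poly m \<theta> k (x k)"
  shows "inv_adjoint a g \<in> additive_l2"
    and "f \<in> additive_l2 \<Longrightarrow> l2_inner cube f g = l2_inner cube (conv a f) (inv_adjoint a g)"
    and "l2_norm cube (\<lambda>x. inv_adjoint a g x - u0 x) = 0"
proof -
  let ?P = "\<lambda>u. u \<in> additive_l2 \<and> (\<forall>f\<in>additive_l2. l2_inner cube f g = l2_inner cube (conv a f) u)"
  have u0: "u0 \<in> additive_l2"
    unfolding u0_def additive_l2_eq inv_cos_poly_def by (intro oplusI cos_poly_centred)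
  have P0: "?P u0"
  proof (intro conjI ballI u0)
    fix F :: "('d \<Rightarrow> real) \<Rightarrow> real" assume "F \<in> additive_l2"
    then obtain f where F: "F = (\<lambda>x. \<Sum>l\<in>UNIV. f l (x l))" and f: "\<And>l. f l \<in> centred_l2"
      unfolding additive_l2_eq by (elim oplusE) auto
    have "l2_inner cube (conv a F) u0 =
        (\<integral>x. (\<Sum>k\<in>UNIV. \<Sum>j=1..m k. sqrt 2 / b k j * \<theta> k j * (conv a F x * phi j (x k))) \<partial>cube)"
      by (simp add: l2_inner_def u0_def inv_cos_poly_def cos_poly_def sum_distrib_left mult_ac)
    also have "\<dots> = (\<Sum>k\<in>UNIV. \<Sum>j=1..m k. sqrt 2 / b k j * \<theta> k j *
        l2_inner cube (conv a F) (\<lambda>x. phi j (x k)))"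
    proof -
      have i: "integrable cube (\<lambda>x. conv a F x * phi j (x k))" if "j \<in> {1..m k}" for j k
        using conv_inner_phi(1)[of f j k] f that by (simp add: F)
      show ?thesis
        by (subst Bochner_Integration.integral_sum Bochner_Integration.integrable_sum,
            intro Bochner_Integration.integrable_sum integrable_mult_right i, assumption,
            intro sum.cong refl,
            subst Bochner_Integration.integral_sum,
            intro integrable_mult_right i, assumption,
            simp add: l2_inner_def)
    qed
    also have "\<dots> = (\<Sum>k\<in>UNIV. \<Sum>j=1..m k. \<theta> k j * l2_inner unit_ival (f k) (phi j))"
      using conv_inner_phi(2)[of f] f b
      by (intro sum.cong refl) (simp add: F)
    also have "\<dots> = l2_inner cube F g"
      unfolding F g_def using f
      by (subst inner_additive) (auto intro: cos_poly_centred simp: inner_phi_cos_poly)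
    finally show "l2_inner cube F g = l2_inner cube (conv a F) u0" ..
  qed
  have P: "?P (inv_adjoint a g)"
    unfolding inv_adjoint_def by (rule someI[of ?P, OF P0])
  then show "inv_adjoint a g \<in> additive_l2"
    and "f \<in> additive_l2 \<Longrightarrow> l2_inner cube f g = l2_inner cube (conv a f) (inv_adjoint a g)" by auto
  from P obtain v where v: "inv_adjoint a g = (\<lambda>x. \<Sum>k\<in>UNIV. v k (x k))" "\<And>k. v k \<in> centred_l2"
    unfolding additive_l2_eq by (auto elim!: oplusE)
  have vz: "l2_norm unit_ival (\<lambda>t. v k t - inv_cos_poly m \<theta> k t) = 0" for k
  proof -
    have d: "(\<lambda>t. v k t - inv_cos_poly m \<theta> k t) \<in> centred_l2"
      unfolding inv_cos_poly_def by (intro centred_l2_diff v cos_poly_centred)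
    \<comment> \<open>A function of coordinate k that the convolution multiplies by a nonzero c can
      be used as test function: c cancels, and \<open>v k\<close> has the same coefficient along e
      as the explicit polynomial.\<close>
    have orth: "l2_inner unit_ival (\<lambda>t. v k t - inv_cos_poly m \<theta> k t) e = 0"
      if e: "e \<in> centred_l2" and c: "c \<noteq> 0" "\<And>x. conv a (\<lambda>x. e (x k)) x = c * e (x k)" for e c
    proof -
      have "l2_inner cube (conv a (\<lambda>x. e (x k))) (inv_adjoint a g) =
          l2_inner cube (conv a (\<lambda>x. e (x k))) u0"
        using P P0 additive_l2_component[OF e, of k] by metis
      then have "l2_inner cube (\<lambda>x. e (x k)) (inv_adjoint a g) = l2_inner cube (\<lambda>x. e (x k)) u0"
        using c by (simp add: c(2)[abs_def] l2_inner_scale_left)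
      then have "l2_inner unit_ival e (v k) = l2_inner unit_ival e (inv_cos_poly m \<theta> k)"
        unfolding v(1) u0_def
        using inner_component_additive[OF e, of v k] inner_component_additive[OF e, of "inv_cos_poly m \<theta>" k] v(2)
        by (simp add: inv_cos_poly_def cos_poly_centred)
      then show ?thesis
        using e v(2)[of k]
        by (simp add: l2_inner_diff_left centred_l2_l2 inv_cos_poly_def cos_poly_centred l2_inner_commute[of _ e])
    qed
    show ?thesis
    proof (rule centred_l2_trig_complete[OF d])
      fix j :: nat assume j: "j \<ge> 1"
      show "l2_inner unit_ival (\<lambda>t. v k t - inv_cos_poly m \<theta> k t) (phi j) = 0"
        using b[OF j, of k] by (intro orth[where c="b k j / sqrt 2"] phi_centred j conv_phi) auto
      show "l2_inner unit_ival (\<lambda>t. v k t - inv_cos_poly m \<theta> k t) (psi j) = 0"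
        using b[OF j, of k] by (intro orth[where c="b k j / sqrt 2"] psi_centred conv_psi j) auto
    qed
  qed
  have "(l2_norm cube (\<lambda>x. inv_adjoint a g x - u0 x))\<^sup>2 = 0"
    unfolding v(1) u0_def using v(2) vz
    by (subst norm_additive_diff) (auto simp: inv_cos_poly_def cos_poly_centred)
  then show "l2_norm cube (\<lambda>x. inv_adjoint a g x - u0 x) = 0" by simp
qed

end

section \<open>Characteristic functions of finite families\<close>

lemma char_eq_cis: "char M t = (\<integral>x. cis (t * x) \<partial>M)"
  by (simp add: char_def cis_conv_exp)

lemma integrable_cis:
  assumes "finite_measure P" "X \<in> borel_measurable P"
  shows "integrable P (\<lambda>\<omega>. cis (X \<omega>))"
proof -
  interpret finite_measure P by fact
  show ?thesis using assms(2) by (intro integrable_const_bound[where B=1]) auto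
qed

text \<open>Normalisation reduces this to Levy's theorem for probability measures. The value at s =
  0 shows that the total masses agree; mass zero, where one cannot divide, is trivial.\<close>

lemma finite_measure_eqI_char:
  assumes "finite_measure M" "finite_measure N"
      and [measurable_cong]: "sets M = sets borel" "sets N = sets borel"
    and eq: "\<And>s. (\<integral>x. cis (s * x) \<partial>M) = (\<integral>x. cis (s * x) \<partial>N)"
  shows "M = N"
proof -
  interpret M: finite_measure M by fact
  interpret N: finite_measure N by fact
  have sp: "space M = UNIV" "space N = UNIV" using assms(3,4) by (auto dest: sets_eq_imp_space_eq)
  have m: "measure M UNIV = measure N UNIV" using eq[of 0] by (simp add: sp)
  define m where "m = measure M UNIV"
  show ?thesis
  proof (cases "m = 0")
    case True
    then have "emeasure M (space M) = 0" "emeasure N (space N) = 0"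
      using m by (simp_all add: m_def sp M.emeasure_eq_measure N.emeasure_eq_measure)
    then have "emeasure M A = 0" "emeasure N A = 0" for A
      by (metis emeasure_space le_zero_eq)+
    then show ?thesis using assms(3,4) by (intro measure_eqI) auto
  next
    case False
    then have m0: "m > 0" by (simp add: m_def order_less_le)
    define nz where "nz K = density K (\<lambda>_. ennreal (1 / m))" for K :: "real measure"
    have rd: "real_distribution (nz K)" if "finite_measure K" "sets K = sets borel" "measure K UNIV = m"
        for K
    proof -
      interpret K: finite_measure K by fact
      have spK: "space K = UNIV" using that(2) by (auto dest: sets_eq_imp_space_eq)
      have "emeasure (nz K) (space (nz K)) = ennreal (1 / m) * emeasure K (space K)"
        by (simp add: nz_def emeasure_density nn_integral_cmult_indicator del: nn_integral_indicator)
      also have "\<dots> = 1"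
        using m0 that(3) by (simp add: K.emeasure_eq_measure spK flip: ennreal_mult)
      finally have "prob_space (nz K)" by (rule prob_spaceI)
      then show ?thesis
        by (auto simp: real_distribution_def real_distribution_axioms_def nz_def spK that(2))
    qed
    have ch: "char (nz K) s = complex_of_real (1 / m) * (\<integral>x. cis (s * x) \<partial>K)" if "sets K = sets borel"
        for K s
    proof -
      have [measurable_cong]: "sets K = sets borel" by fact
      have [measurable]: "(\<lambda>x. cis (s * x)) \<in> borel_measurable K"
        unfolding measurable_cong_sets[OF that refl] by measurable
      have "char (nz K) s = (\<integral>x. (1 / m) *\<^sub>R cis (s * x) \<partial>K)"
        unfolding char_eq_cis nz_def using m0 by (subst integral_density) auto
      then show ?thesis by (simp add: scaleR_conv_of_real)
    qed
    have "nz M = nz N"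
      using assms m m_def eq by (intro Levy_uniqueness rd) (auto simp: ch fun_eq_iff)
    then have d: "emeasure (nz M) A = emeasure (nz N) A" for A by simp
    show ?thesis
    proof (rule measure_eqI)
      fix A assume A: "A \<in> sets M"
      have e: "emeasure (nz K) A = ennreal (1 / m) * emeasure K A" if "sets K = sets borel" for K
        using A assms(3) that by (simp add: nz_def emeasure_density nn_integral_cmult_indicator)
      have "ennreal m * emeasure (nz M) A = ennreal m * emeasure (nz N) A" by (simp add: d)
      then show "emeasure M A = emeasure N A"
        using m0 by (simp add: e assms(3,4) mult.assoc[symmetric] ennreal_mult[symmetric])
    qed (use assms in simp)
  qed
qed

lemma finite_measure_density_bounded:
  fixes h :: "'a \<Rightarrow> real"
  assumes "finite_measure R" "h \<in> borel_measurable R" "\<And>\<omega>. h \<omega> \<le> 2"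
  shows "finite_measure (density R (\<lambda>\<omega>. ennreal (h \<omega>)))"
proof (rule finite_measureI)
  interpret finite_measure R by fact
  have "emeasure (density R (\<lambda>\<omega>. ennreal (h \<omega>))) (space R) \<le> (\<integral>\<^sup>+\<omega>. 2 * indicator (space R) \<omega> \<partial>R)"
    using assms(2,3) ennreal_leI[OF assms(3)]
    by (subst emeasure_density) (auto intro!: nn_integral_mono simp: indicator_def)
  also have "\<dots> = 2 * emeasure R (space R)" by (rule nn_integral_cmult_indicator) simp
  also have "\<dots> < \<infinity>" by (simp add: ennreal_mult_less_top emeasure_eq_measure)
  finally show "emeasure (density R (\<lambda>\<omega>. ennreal (h \<omega>))) (space (density R (\<lambda>\<omega>. ennreal (h \<omega>)))) \<noteq> \<infinity>"
    by simp
qed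

text \<open>The two sides are the masses of B under the images of the measures with densities f and
  g, and \<open>eq\<close> compares their characteristic functions. The bound 2 fits the weights 1 +
  cos to which this is applied.\<close>

lemma char_determines_weighted:
  fixes X :: "'a \<Rightarrow> real" and Y :: "'b \<Rightarrow> real"
  assumes fin: "finite_measure P" "finite_measure Q"
    and X: "X \<in> borel_measurable P" and Y: "Y \<in> borel_measurable Q"
    and f: "f \<in> borel_measurable P" "\<And>\<omega>. 0 \<le> f \<omega>" "\<And>\<omega>. f \<omega> \<le> 2"
    and g: "g \<in> borel_measurable Q" "\<And>\<omega>. 0 \<le> g \<omega>" "\<And>\<omega>. g \<omega> \<le> 2"
    and eq: "\<And>s. (\<integral>\<omega>. complex_of_real (f \<omega>) * cis (s * X \<omega>) \<partial>P) =
        (\<integral>\<omega>. complex_of_real (g \<omega>) * cis (s * Y \<omega>) \<partial>Q)"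
    and B: "B \<in> sets borel"
  shows "(\<integral>\<omega>. f \<omega> * indicator B (X \<omega>) \<partial>P) = (\<integral>\<omega>. g \<omega> * indicator B (Y \<omega>) \<partial>Q)"
proof -
  have fm: "finite_measure (distr (density R h) borel Z)"
    if "finite_measure R" "h \<in> borel_measurable R" "\<And>\<omega>. h \<omega> \<le> 2" "Z \<in> borel_measurable R"
    for R and h Z :: "'c \<Rightarrow> real"
    using finite_measure_density_bounded[of R h] that
        by (intro finite_measure.finite_measure_distr) auto
  have ch: "(\<integral>x. cis (s * x) \<partial>distr (density R h) borel Z) =
      (\<integral>\<omega>. complex_of_real (h \<omega>) * cis (s * Z \<omega>) \<partial>R)"
    if "h \<in> borel_measurable R" "\<And>\<omega>. 0 \<le> h \<omega>" "Z \<in> borel_measurable R"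
    for R s and h Z :: "'c \<Rightarrow> real"
    using that
    by (subst integral_distr) (simp_all add: integral_density scaleR_conv_of_real)
  have em: "measure (distr (density R h) borel Z) B = (\<integral>\<omega>. h \<omega> * indicator B (Z \<omega>) \<partial>R)"
    if "h \<in> borel_measurable R" "\<And>\<omega>. 0 \<le> h \<omega>" "Z \<in> borel_measurable R"
    for R and h Z :: "'c \<Rightarrow> real"
  proof -
    have "measure (distr (density R h) borel Z) B = (\<integral>x. indicator B x \<partial>distr (density R h) borel Z)"
      using B by simp
    also have "\<dots> = (\<integral>\<omega>. h \<omega> * indicator B (Z \<omega>) \<partial>R)"
      using that B by (subst integral_distr) (simp_all add: integral_density)
    finally show ?thesis .
  qed
  have "distr (density P f) borel X = distr (density Q g) borel Y"
    using fin X Y f g eq by (intro finite_measure_eqI_char fm) (auto simp: ch)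
  then have "measure (distr (density P f) borel X) B = measure (distr (density Q g) borel Y) B" by simp
  then show ?thesis using X Y f g by (simp add: em)
qed

lemma integral_linear3:
  fixes u v w :: "'a \<Rightarrow> complex"
  assumes "integrable R u" "integrable R v" "integrable R w"
  shows "(\<integral>\<omega>. u \<omega> + a * v \<omega> + b * w \<omega> \<partial>R) = (\<integral>\<omega>. u \<omega> \<partial>R) + a * (\<integral>\<omega>. v \<omega> \<partial>R) + b * (\<integral>\<omega>. w \<omega> \<partial>R)"
  using assms by simp

text \<open>Coordinates are turned into events one at a time. The remaining trigonometric factor is not
  positive, so the one-dimensional theorem is applied to the finite positive measures with
  densities $1 + \cos(t \cdot X + c)$.\<close>

theorem finite_dim_char_uniqueness:
  fixes X :: "'i \<Rightarrow> 'a \<Rightarrow> real" and Y :: "'i \<Rightarrow> 'b \<Rightarrow> real"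
  assumes "finite I" "finite_measure P" "finite_measure Q"
    and "\<And>i. i \<in> I \<Longrightarrow> X i \<in> borel_measurable P" "\<And>i. i \<in> I \<Longrightarrow> Y i \<in> borel_measurable Q"
    and "\<And>t. (\<integral>\<omega>. cis (\<Sum>i\<in>I. t i * X i \<omega>) \<partial>P) = (\<integral>\<omega>. cis (\<Sum>i\<in>I. t i * Y i \<omega>) \<partial>Q)"
    and "\<And>i. i \<in> I \<Longrightarrow> B i \<in> sets borel"
  shows "measure P {\<omega> \<in> space P. \<forall>i\<in>I. X i \<omega> \<in> B i} = measure Q {\<omega> \<in> space Q. \<forall>i\<in>I. Y i \<omega> \<in> B i}"
  using assms
proof (induction I arbitrary: P Q rule: finite_induct)
  case empty
  \<comment> \<open>For an empty family the hypothesis says that the total masses agree.\<close>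
  from empty.prems(5)[of "\<lambda>_. 0"] show ?case by simp
next
  case (insert i J)
  interpret P: finite_measure P by fact
  interpret Q: finite_measure Q by fact
  note [measurable] = insert.prems(3,4,6)
  define SX where "SX t \<omega> = (\<Sum>j\<in>J. t j * X j \<omega>)" for t \<omega>
  define SY where "SY t \<omega> = (\<Sum>j\<in>J. t j * Y j \<omega>)" for t \<omega>
  have mS: "SX t \<in> borel_measurable P" "SY t \<in> borel_measurable Q" for t
    unfolding SX_def[abs_def] SY_def[abs_def]
        by (intro borel_measurable_sum borel_measurable_times; simp add: insert.prems)+
  have mX: "X i \<in> borel_measurable P" "Y i \<in> borel_measurable Q" by (simp_all add: insert.prems)
  have Bi: "B i \<in> sets borel" by (simp add: insert.prems)
  have ch: "(\<integral>\<omega>. cis (s * X i \<omega> + SX t \<omega>) \<partial>P) = (\<integral>\<omega>. cis (s * Y i \<omega> + SY t \<omega>) \<partial>Q)" for s t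
  proof -
    have e: "(\<Sum>j\<in>insert i J. (t(i := s)) j * Z j) = s * Z i + (\<Sum>j\<in>J. t j * Z j)" for Z :: "'i \<Rightarrow> real"
      using insert.hyps by (auto intro!: sum.cong)
    show ?thesis using insert.prems(5)[of "t(i := s)"] by (simp only: e SX_def SY_def)
  qed
  have SX_neg: "SX (\<lambda>j. - t j) \<omega> = - SX t \<omega>" "SY (\<lambda>j. - t j) \<omega>' = - SY t \<omega>'" for t \<omega> \<omega>'
    by (simp_all add: SX_def SY_def sum_negf)
  \<comment> \<open>The weight is expanded into exponentials; each term is a joint characteristic
    function with the remaining arguments at 0, t and -t.\<close>
  have cosch: "(\<integral>\<omega>. complex_of_real (1 + cos (SX t \<omega> + c)) * cis (s * X i \<omega>) \<partial>P) =
      (\<integral>\<omega>. complex_of_real (1 + cos (SY t \<omega> + c)) * cis (s * Y i \<omega>) \<partial>Q)" for t s c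
  proof -
    have e: "complex_of_real (1 + cos (u + c)) * cis v =
        cis (v + 0) + (cis c / 2) * cis (v + u) + (cis (- c) / 2) * cis (v + - u)" for u v
    proof -
      have "complex_of_real (cos x) = (cis x + cis (- x)) / 2" for x
        by (simp add: complex_eq_iff)
      from this[of "u + c"] have "complex_of_real (cos (u + c)) = (cis (u + c) + cis (- (u + c))) / 2" .
      then show ?thesis by (simp add: algebra_simps add_divide_distrib cis_mult)
    qed
    have z: "SX (\<lambda>_. 0) \<omega> = 0" "SY (\<lambda>_. 0) \<omega>' = 0" for \<omega> \<omega>' by (simp_all add: SX_def SY_def)
    have iP: "integrable P (\<lambda>\<omega>. cis (s * X i \<omega> + SX t \<omega>))" for t
      by (intro integrable_cis P.finite_measure_axioms borel_measurable_add borel_measurable_times mX mS) simp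
    have iQ: "integrable Q (\<lambda>\<omega>. cis (s * Y i \<omega> + SY t \<omega>))" for t
      by (intro integrable_cis Q.finite_measure_axioms borel_measurable_add borel_measurable_times mX mS) simp
    show ?thesis
      unfolding e
      using iP[of "\<lambda>_. 0"] iP[of t] iP[of "\<lambda>j. - t j"] iQ[of "\<lambda>_. 0"] iQ[of t] iQ[of "\<lambda>j. - t j"]
        ch[of s "\<lambda>_. 0"] ch[of s t] ch[of s "\<lambda>j. - t j"]
      unfolding z SX_neg by (simp only: integral_linear3)
  qed
  have wt: "(\<integral>\<omega>. (1 + cos (SX t \<omega> + c)) * indicator (B i) (X i \<omega>) \<partial>P) =
      (\<integral>\<omega>. (1 + cos (SY t \<omega> + c)) * indicator (B i) (Y i \<omega>) \<partial>Q)" for t c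
  proof (rule char_determines_weighted[OF insert.prems(1,2) mX _ _ _ _ _ _ cosch Bi])
    show "(\<lambda>\<omega>. 1 + cos (SX t \<omega> + c)) \<in> borel_measurable P" "(\<lambda>\<omega>. 1 + cos (SY t \<omega> + c)) \<in>
        borel_measurable Q"
      using mS[of t] by measurable
    show "0 \<le> 1 + cos x" "1 + cos x \<le> 2" for x :: real
      using cos_ge_minus_one[of x] cos_le_one[of x] by linarith+
    show "0 \<le> 1 + cos x" "1 + cos x \<le> 2" for x :: real
      using cos_ge_minus_one[of x] cos_le_one[of x] by linarith+
  qed
  \<comment> \<open>Both measures are restricted to the event in coordinate i. The results are
    finite but in general not probability measures, which is why the induction runs over arbitrary
    finite P and Q.\<close>
  define P' Q' where "P' = density P (\<lambda>\<omega>. ennreal (indicator (B i) (X i \<omega>)))"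
    and "Q' = density Q (\<lambda>\<omega>. ennreal (indicator (B i) (Y i \<omega>)))"
  have mI: "(\<lambda>\<omega>. indicator (B i) (X i \<omega>) :: real) \<in> borel_measurable P"
       "(\<lambda>\<omega>. indicator (B i) (Y i \<omega>) :: real) \<in> borel_measurable Q"
    using mX Bi by measurable
  have fin': "finite_measure P'" "finite_measure Q'"
    unfolding P'_def Q'_def
    by (intro finite_measure_density_bounded mI insert.prems(1,2); simp add: indicator_def)+
  \<comment> \<open>Subtracting the constant part of the weight leaves integrals of shifted cosines
    over the event; the phases 0 and -pi/2 give real and imaginary part.\<close>
  have charJ: "(\<integral>\<omega>. cis (SX t \<omega>) \<partial>P') = (\<integral>\<omega>. cis (SY t \<omega>) \<partial>Q')" for t
  proof -
    have bP: "integrable P (\<lambda>\<omega>. cos (SX t \<omega> +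
        c) * indicator (B i) (X i \<omega>))" "integrable P (\<lambda>\<omega>. indicator (B i) (X i \<omega>) :: real)" for t c
      using mS(1)[of t] mI(1) by (auto intro!: P.integrable_const_bound[where B=1] simp: abs_mult indicator_def)
    have bQ: "integrable Q (\<lambda>\<omega>. cos (SY t \<omega> +
        c) * indicator (B i) (Y i \<omega>))" "integrable Q (\<lambda>\<omega>. indicator (B i) (Y i \<omega>) :: real)" for t c
      using mS(2)[of t] mI(2) by (auto intro!: Q.integrable_const_bound[where B=1] simp: abs_mult indicator_def)
    have one: "(\<integral>\<omega>. (indicator (B i) (X i \<omega>) :: real) \<partial>P) = (\<integral>\<omega>. indicator (B i) (Y i \<omega>) \<partial>Q)"
      using wt[of "\<lambda>_. 0" 0] by (simp add: SX_def SY_def)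
    have c: "(\<integral>\<omega>. cos (SX t \<omega> + c) * indicator (B i) (X i \<omega>) \<partial>P) =
        (\<integral>\<omega>. cos (SY t \<omega> + c) * indicator (B i) (Y i \<omega>) \<partial>Q)" for c
      using wt[of t c] one bP bQ by (simp add: distrib_right)
    have e: "(\<integral>\<omega>. cis (S \<omega>) \<partial>density R (\<lambda>\<omega>. ennreal (indicator (B i) (Z \<omega>)))) =
        complex_of_real (\<integral>\<omega>. cos (S \<omega> + 0) * indicator (B i) (Z \<omega>) \<partial>R)
        + \<i> * complex_of_real (\<integral>\<omega>. cos (S \<omega> + (- pi / 2)) * indicator (B i) (Z \<omega>) \<partial>R)"
      if m: "S \<in> borel_measurable R" "Z \<in> borel_measurable R"
        and b: "\<And>c. integrable R (\<lambda>\<omega>. cos (S \<omega> + c) * indicator (B i) (Z \<omega>))"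
      for R and S Z :: "'c \<Rightarrow> real"
    proof -
      have mcis: "(\<lambda>\<omega>. cis (S \<omega>)) \<in> borel_measurable R" using m(1) by measurable
      have mIR: "(\<lambda>\<omega>. indicator (B i) (Z \<omega>) :: real) \<in> borel_measurable R" using m(2) Bi by measurable
      have "(\<integral>\<omega>. cis (S \<omega>) \<partial>density R (\<lambda>\<omega>. ennreal (indicator (B i) (Z \<omega>)))) =
          (\<integral>\<omega>. indicator (B i) (Z \<omega>) *\<^sub>R cis (S \<omega>) \<partial>R)"
        using mcis mIR by (intro integral_density) auto
      also have "\<dots> = (\<integral>\<omega>. complex_of_real (cos (S \<omega> + 0) * indicator (B i) (Z \<omega>)) +
          \<i> * complex_of_real (cos (S \<omega> + (- pi / 2)) * indicator (B i) (Z \<omega>)) \<partial>R)"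
        by (intro Bochner_Integration.integral_cong) (auto simp: complex_eq_iff cos_diff)
      also have "\<dots> = complex_of_real (\<integral>\<omega>. cos (S \<omega> + 0) * indicator (B i) (Z \<omega>) \<partial>R)
        + \<i> * complex_of_real (\<integral>\<omega>. cos (S \<omega> + (- pi / 2)) * indicator (B i) (Z \<omega>) \<partial>R)"
        using b[of 0] b[of "- pi / 2"]
        by (subst Bochner_Integration.integral_add)
           (auto simp del: of_real_mult simp: integral_complex_of_real)
      finally show ?thesis .
    qed
    show ?thesis
      unfolding P'_def Q'_def e[OF mS(1) mX(1) bP(1)] e[OF mS(2) mX(2) bQ(1)] by (simp only: c)
  qed
  have IH: "measure P' {\<omega> \<in> space P'. \<forall>j\<in>J. X j \<omega> \<in> B j} = measure Q' {\<omega> \<in> space Q'. \<forall>j\<in>J. Y j \<omega> \<in> B j}"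
  proof (rule insert.IH[OF fin'])
    show "X j \<in> borel_measurable P'" "Y j \<in> borel_measurable Q'" "B j \<in> sets borel" if "j \<in> J" for j
      using insert.prems(3,4,6)[of j] that by (auto simp: P'_def Q'_def)
    show "(\<integral>\<omega>. cis (\<Sum>j\<in>J. t j * X j \<omega>) \<partial>P') = (\<integral>\<omega>. cis (\<Sum>j\<in>J. t j * Y j \<omega>) \<partial>Q')" for t
      using charJ[of t] by (simp add: SX_def SY_def)
  qed
  have meas: "measure (density R (\<lambda>\<omega>. ennreal (indicator (B i) (Z i \<omega>)))) {\<omega> \<in> space R. \<forall>j\<in>J. Z j \<omega> \<in>
      B j} =
      measure R {\<omega> \<in> space R. \<forall>j\<in>insert i J. Z j \<omega> \<in> B j}"
    if Z: "\<And>j. j \<in> insert i J \<Longrightarrow> Z j \<in> borel_measurable R" for R and Z :: "'i \<Rightarrow> 'c \<Rightarrow> real"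
  proof -
    have S: "{\<omega> \<in> space R. \<forall>j\<in>K. Z j \<omega> \<in> B j} \<in> sets R" if "K \<subseteq> insert i J" for K
    proof -
      have "finite K" using that insert.hyps(1) by (simp add: finite_subset)
      moreover have "{\<omega> \<in> space R. Z j \<omega> \<in> B j} \<in> sets R" if "j \<in> K" for j
        using measurable_sets[OF Z, of j "B j"] insert.prems(6)[of j] that \<open>K \<subseteq> insert i J\<close>
        by (auto simp: vimage_def Int_def conj_commute)
      ultimately show ?thesis by (intro sets.sets_Collect_finite_All) auto
    qed
    have "emeasure (density R (\<lambda>\<omega>. ennreal (indicator (B i) (Z i \<omega>)))) {\<omega> \<in> space R. \<forall>j\<in>J. Z j \<omega> \<in>
        B j} =
        (\<integral>\<^sup>+\<omega>. ennreal (indicator (B i) (Z i \<omega>)) * indicator {\<omega> \<in> space R. \<forall>j\<in>J. Z j \<omega> \<in> B j} \<omega> \<partial>R)"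
      using S[of J] Z[of i] Bi by (intro emeasure_density) auto
    also have "\<dots> = (\<integral>\<^sup>+\<omega>. indicator {\<omega> \<in> space R. \<forall>j\<in>insert i J. Z j \<omega> \<in> B j} \<omega> \<partial>R)"
      by (intro nn_integral_cong) (auto simp: indicator_def)
    also have "\<dots> = emeasure R {\<omega> \<in> space R. \<forall>j\<in>insert i J. Z j \<omega> \<in> B j}"
      using S[of "insert i J"] by simp
    finally show ?thesis by (simp add: measure_def)
  qed
  show ?case
    using IH meas[of X P, OF insert.prems(3)] meas[of Y Q, OF insert.prems(4)]
        by (simp add: P'_def Q'_def)
qed

section \<open>White noise\<close>

text \<open>A scaled standard normal covers the point mass at v = 0 along with the densities, so
  that later computations need no case distinction.\<close>

lemma centred_gaussian_eq_distr:
  assumes "0 \<le> v"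
  shows "centred_gaussian v = distr std_normal_distribution borel (\<lambda>x. sqrt v * x)"
proof -
  interpret N: real_distribution std_normal_distribution by (rule real_dist_normal_dist)
  show ?thesis
  proof (cases "v = 0")
    case True
    have "distr std_normal_distribution borel (\<lambda>x. 0) = return borel (0::real)"
      by (rule measure_eqI) (auto simp: emeasure_distr indicator_def N.emeasure_space_1[simplified])
    with True show ?thesis by (simp add: centred_gaussian_def)
  next
    case False
    have "distributed std_normal_distribution lborel (\<lambda>x. x) std_normal_density"
      by (auto simp: distributed_def intro!: measure_eqI simp: emeasure_distr)
    from N.normal_density_affine[OF this, of "sqrt v" 0] False assms
    have "distributed std_normal_distribution lborel (\<lambda>x. sqrt v * x) (normal_density 0 (sqrt v))"
      by simp
    then have "distr std_normal_distribution lborel (\<lambda>x. sqrt v * x) =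
        density lborel (normal_density 0 (sqrt v))"
      by (simp add: distributed_def)
    moreover have "distr std_normal_distribution lborel (\<lambda>x. sqrt v * x) =
        distr std_normal_distribution borel (\<lambda>x. sqrt v * x)"
      by (rule distr_cong) auto
    ultimately show ?thesis using False by (simp add: centred_gaussian_def)
  qed
qed

text \<open>The factor halves the Gaussian exponent and so leaves sqrt 2 times the density of
  variance 2.\<close>

lemma nn_integral_exp_square_quarter:
  "(\<integral>\<^sup>+x. ennreal (exp (x\<^sup>2 / 4)) \<partial>std_normal_distribution) = ennreal (sqrt 2)"
proof -
  have e: "std_normal_density x * exp (x\<^sup>2 / 4) = sqrt 2 * normal_density 0 (sqrt 2) x" for x
  proof -
    have "exp (- x\<^sup>2 / 2) * exp (x\<^sup>2 / 4) = exp (- x\<^sup>2 / 4)"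
      by (simp flip: exp_add)
    then show ?thesis
      by (simp add: normal_density_def real_sqrt_mult mult.assoc) (simp add: field_simps)
  qed
  have "(\<integral>\<^sup>+x. ennreal (exp (x\<^sup>2 / 4)) \<partial>std_normal_distribution)
      = (\<integral>\<^sup>+x. ennreal (sqrt 2) * ennreal (normal_density 0 (sqrt 2) x) \<partial>lborel)"
    by (subst nn_integral_density) (auto intro!: nn_integral_cong simp: e simp flip: ennreal_mult)
  also have "\<dots> = ennreal (sqrt 2) * (\<integral>\<^sup>+x. ennreal (normal_density 0 (sqrt 2) x) \<partial>lborel)"
    by (subst nn_integral_cmult) auto
  also have "(\<integral>\<^sup>+x. ennreal (normal_density 0 (sqrt 2) x) \<partial>lborel) = 1"
    by (subst nn_integral_eq_integral) auto
  finally show ?thesis by simp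
qed

locale white_noise_process =
  fixes M :: "'a measure" and P :: "'w measure" and W :: "('a \<Rightarrow> real) \<Rightarrow> 'w \<Rightarrow> real"
  assumes white_noise: "white_noise M P W"
begin

sublocale prob_space P
  using white_noise by (simp add: white_noise_def)

lemma measurable_W [measurable]: "h \<in> l2 M \<Longrightarrow> W h \<in> borel_measurable P"
  using white_noise by (simp add: white_noise_def)

lemma distr_W_pair:
  assumes h: "h1 \<in> l2 M" "h2 \<in> l2 M"
  shows "distr P borel (\<lambda>\<omega>. c1 * W h1 \<omega> + c2 * W h2 \<omega>) =
     distr std_normal_distribution borel (\<lambda>x. l2_norm M (\<lambda>t. c1 * h1 t + c2 * h2 t) * x)"
proof -
  have v: "c1\<^sup>2 * (l2_norm M h1)\<^sup>2 + 2 * c1 * c2 * l2_inner M h1 h2 + c2\<^sup>2 * (l2_norm M h2)\<^sup>2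
      = (l2_norm M (\<lambda>t. c1 * h1 t + c2 * h2 t))\<^sup>2"
    using h by (subst l2_norm_power2_add)
      (auto simp: l2_scale l2_inner_scale_left l2_inner_scale_right l2_norm_scale power_mult_distrib)
  have "distr P borel (\<lambda>\<omega>. c1 * W h1 \<omega> + c2 * W h2 \<omega>) =
      centred_gaussian (c1\<^sup>2 * (l2_norm M h1)\<^sup>2 + 2 * c1 * c2 * l2_inner M h1 h2 + c2\<^sup>2 * (l2_norm M h2)\<^sup>2)"
    using white_noise h unfolding white_noise_def by blast
  then show ?thesis
    unfolding v by (simp add: centred_gaussian_eq_distr l2_norm_nonneg)
qed

lemma distr_W:
  assumes "h \<in> l2 M"
  shows "distr P borel (W h) = distr std_normal_distribution borel (\<lambda>x. l2_norm M h * x)"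
  using distr_W_pair[OF assms assms, of 1 0] by simp

lemma square_moment:
  assumes h: "h1 \<in> l2 M" "h2 \<in> l2 M"
  shows "integrable P (\<lambda>\<omega>. (c1 * W h1 \<omega> + c2 * W h2 \<omega>)\<^sup>2)"
    and "(\<integral>\<omega>. (c1 * W h1 \<omega> + c2 * W h2 \<omega>)\<^sup>2 \<partial>P) = (l2_norm M (\<lambda>t. c1 * h1 t + c2 * h2 t))\<^sup>2"
proof -
  let ?n = "l2_norm M (\<lambda>t. c1 * h1 t + c2 * h2 t)"
  have m: "(\<lambda>\<omega>. c1 * W h1 \<omega> + c2 * W h2 \<omega>) \<in> borel_measurable P" using h by measurable
  have i2: "integrable std_normal_distribution (\<lambda>x. (?n * x)\<^sup>2)"
    using std_normal_distribution_even_moments(2)[of 1] by (simp add: power_mult_distrib)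
  have "integrable (distr P borel (\<lambda>\<omega>. c1 * W h1 \<omega> + c2 * W h2 \<omega>)) (\<lambda>x. x\<^sup>2)"
    unfolding distr_W_pair[OF h] by (subst integrable_distr_eq) (auto simp: i2)
  then show "integrable P (\<lambda>\<omega>. (c1 * W h1 \<omega> + c2 * W h2 \<omega>)\<^sup>2)"
    using m by (subst (asm) integrable_distr_eq) auto
  have "(\<integral>\<omega>. (c1 * W h1 \<omega> + c2 * W h2 \<omega>)\<^sup>2 \<partial>P) =
      (\<integral>x. x\<^sup>2 \<partial>distr P borel (\<lambda>\<omega>. c1 * W h1 \<omega> + c2 * W h2 \<omega>))"
    using m by (subst integral_distr) auto
  also have "\<dots> = (\<integral>x. (?n * x)\<^sup>2 \<partial>std_normal_distribution)"
    unfolding distr_W_pair[OF h] by (subst integral_distr) auto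
  also have "\<dots> = ?n\<^sup>2"
    using std_normal_distribution_even_moments(1)[of 1] by (simp add: power_mult_distrib)
  finally show "(\<integral>\<omega>. (c1 * W h1 \<omega> + c2 * W h2 \<omega>)\<^sup>2 \<partial>P) = ?n\<^sup>2" .
qed

text \<open>Polarisation: the product is a quarter of the square of the sum minus the square of the
  difference, and the moments of these are squared norms.\<close>

lemma covariance:
  assumes h: "h1 \<in> l2 M" "h2 \<in> l2 M"
  shows "integrable P (\<lambda>\<omega>. W h1 \<omega> * W h2 \<omega>)"
    and "(\<integral>\<omega>. W h1 \<omega> * W h2 \<omega> \<partial>P) = l2_inner M h1 h2"
proof -
  note p = square_moment[OF h, of 1 1] and m = square_moment[OF h, of 1 "-1"]
  have e: "W h1 \<omega> * W h2 \<omega> = ((1 * W h1 \<omega> + 1 * W h2 \<omega>)\<^sup>2 - (1 * W h1 \<omega> + (- 1) * W h2 \<omega>)\<^sup>2) / 4" for \<omega>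
    by (simp add: power2_eq_square algebra_simps)
  show "integrable P (\<lambda>\<omega>. W h1 \<omega> * W h2 \<omega>)"
    unfolding e using p(1) m(1) by (intro integrable_divide Bochner_Integration.integrable_diff) auto
  have "(\<integral>\<omega>. W h1 \<omega> * W h2 \<omega> \<partial>P) =
      ((l2_norm M (\<lambda>t. h1 t + h2 t))\<^sup>2 - (l2_norm M (\<lambda>t. h1 t - h2 t))\<^sup>2) / 4"
    unfolding e using p m by simp
  also have "\<dots> = l2_inner M h1 h2"
    using h by (simp add: l2_norm_power2_add l2_norm_power2_diff)
  finally show "(\<integral>\<omega>. W h1 \<omega> * W h2 \<omega> \<partial>P) = l2_inner M h1 h2" .
qed

text \<open>Linearity follows from the covariances: expanded by them, the second moment of the
  difference of the two sides is the squared norm in \<open>eq\<close>. The null set depends on the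
  functions and coefficients. With I empty this says that \<open>W g\<close> vanishes almost surely
  if g has norm zero.\<close>

lemma AE_W_linear:
  assumes I: "finite I" and h: "\<And>i. i \<in> I \<Longrightarrow> h i \<in> l2 M" and g: "g \<in> l2 M"
    and eq: "l2_norm M (\<lambda>t. g t - (\<Sum>i\<in>I. c i * h i t)) = 0"
  shows "AE \<omega> in P. W g \<omega> = (\<Sum>i\<in>I. c i * W (h i) \<omega>)"
proof -
  define D where "D \<omega> = W g \<omega> - (\<Sum>i\<in>I. c i * W (h i) \<omega>)" for \<omega>
  have e: "(D \<omega>)\<^sup>2 = W g \<omega> * W g \<omega> - 2 * (\<Sum>i\<in>I. c i * (W g \<omega> * W (h i) \<omega>))
      + (\<Sum>i\<in>I. \<Sum>j\<in>I. c i * c j * (W (h i) \<omega> * W (h j) \<omega>))" for \<omega>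
    by (simp add: D_def power2_diff) (simp add: power2_eq_square sum_product sum_distrib_left mult_ac)
  have i1: "integrable P (\<lambda>\<omega>. W g \<omega> * W g \<omega>)" by (rule covariance[OF g g])
  have i2: "integrable P (\<lambda>\<omega>. \<Sum>i\<in>I. c i * (W g \<omega> * W (h i) \<omega>))"
    by (intro Bochner_Integration.integrable_sum integrable_mult_right covariance(1) g h)
  have i3: "integrable P (\<lambda>\<omega>. \<Sum>i\<in>I. \<Sum>j\<in>I. c i * c j * (W (h i) \<omega> * W (h j) \<omega>))"
    by (intro Bochner_Integration.integrable_sum integrable_mult_right covariance(1) g h)
  have D: "integrable P (\<lambda>\<omega>. (D \<omega>)\<^sup>2)"
    unfolding e by (intro Bochner_Integration.integrable_add Bochner_Integration.integrable_diff integrable_mult_right i1 i2 i3)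
  have s: "(\<lambda>t. \<Sum>i\<in>I. c i * h i t) \<in> l2 M" by (intro l2_sum l2_scale h)
  have "(\<integral>\<omega>. (D \<omega>)\<^sup>2 \<partial>P) = l2_inner M g g - 2 * (\<Sum>i\<in>I. c i * l2_inner M g (h i))
      + (\<Sum>i\<in>I. \<Sum>j\<in>I. c i * c j * l2_inner M (h i) (h j))"
  proof -
    have "(\<integral>\<omega>. (\<Sum>i\<in>I. c i * (W g \<omega> * W (h i) \<omega>)) \<partial>P) = (\<Sum>i\<in>I. c i * l2_inner M g (h i))"
      using g h covariance by (subst Bochner_Integration.integral_sum) (auto intro!: integrable_mult_right)
    moreover have "(\<integral>\<omega>. (\<Sum>i\<in>I. \<Sum>j\<in>I. c i * c j * (W (h i) \<omega> * W (h j) \<omega>)) \<partial>P) =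
        (\<Sum>i\<in>I. \<Sum>j\<in>I. c i * c j * l2_inner M (h i) (h j))"
      using h covariance
      by (subst Bochner_Integration.integral_sum)
         (auto intro!: Bochner_Integration.integrable_sum integrable_mult_right sum.cong
               simp: Bochner_Integration.integral_sum)
    ultimately show ?thesis
      unfolding e using i1 i2 i3 covariance(2)[OF g g] by simp
  qed
  also have "\<dots> = (l2_norm M (\<lambda>t. g t - (\<Sum>i\<in>I. c i * h i t)))\<^sup>2"
    unfolding l2_norm_power2_diff[OF g s] using g h s
    by (simp add: l2_norm_eq_inner l2_inner_sum_right l2_inner_sum_left l2_scale
        l2_inner_scale_right l2_inner_scale_left sum_distrib_left mult.assoc)
       (intro sum.cong refl, simp add: l2_inner_commute)
  also have "\<dots> = 0" using eq by simp
  finally have "AE \<omega> in P. (D \<omega>)\<^sup>2 = 0"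
    using integral_nonneg_eq_0_iff_AE[OF D] by simp
  then show ?thesis by eventually_elim (simp add: D_def)
qed

lemma char_W:
  assumes "h \<in> l2 M"
  shows "(\<integral>\<omega>. cis (W h \<omega>) \<partial>P) = complex_of_real (exp (- (l2_norm M h)\<^sup>2 / 2))"
proof -
  have "(\<integral>\<omega>. cis (W h \<omega>) \<partial>P) = (\<integral>x. cis x \<partial>distr P borel (W h))"
    using assms by (subst integral_distr) auto
  also have "\<dots> = (\<integral>x. cis (l2_norm M h * x) \<partial>std_normal_distribution)"
    unfolding distr_W[OF assms] by (subst integral_distr) auto
  also have "\<dots> = complex_of_real (exp (- (l2_norm M h)\<^sup>2 / 2))"
    using char_std_normal_distribution[THEN fun_cong, of "l2_norm M h"] by (simp add: char_eq_cis)
  finally show ?thesis .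
qed

text \<open>After rescaling, the exponent is at most a quarter of the square of a standard normal
  variable, and sqrt 2 is rounded up to 2. For \<tau> = 0 the quotient is 0 by convention and the
  bound still holds.\<close>

lemma exp_moment:
  assumes h: "h \<in> l2 M" and \<tau>: "l2_norm M h \<le> \<tau>"
  shows "(\<integral>\<^sup>+\<omega>. ennreal (exp ((W h \<omega>)\<^sup>2 / (4 * \<tau>\<^sup>2))) \<partial>P) \<le> 2"
proof -
  have "(\<integral>\<^sup>+\<omega>. ennreal (exp ((W h \<omega>)\<^sup>2 / (4 * \<tau>\<^sup>2))) \<partial>P)
      = (\<integral>\<^sup>+x. ennreal (exp (x\<^sup>2 / (4 * \<tau>\<^sup>2))) \<partial>distr P borel (W h))"
    using h by (subst nn_integral_distr) auto
  also have "\<dots> = (\<integral>\<^sup>+x. ennreal (exp ((l2_norm M h * x)\<^sup>2 / (4 * \<tau>\<^sup>2))) \<partial>std_normal_distribution)"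
    unfolding distr_W[OF h] by (subst nn_integral_distr) auto
  also have "\<dots> \<le> (\<integral>\<^sup>+x. ennreal (exp (x\<^sup>2 / 4)) \<partial>std_normal_distribution)"
  proof (intro nn_integral_mono ennreal_leI iffD2[OF exp_le_cancel_iff])
    fix x
    show "(l2_norm M h * x)\<^sup>2 / (4 * \<tau>\<^sup>2) \<le> x\<^sup>2 / 4"
    proof (cases "\<tau> = 0")
      case False
      have "(l2_norm M h)\<^sup>2 \<le> \<tau>\<^sup>2" using \<tau> l2_norm_nonneg[of M h] by (rule power_mono)
      then have "(l2_norm M h)\<^sup>2 / \<tau>\<^sup>2 \<le> 1" using False by simp
      then have "(l2_norm M h)\<^sup>2 / \<tau>\<^sup>2 * (x\<^sup>2 / 4) \<le> 1 * (x\<^sup>2 / 4)" by (rule mult_right_mono) simp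
      then show ?thesis by (simp add: power_mult_distrib)
    qed simp
  qed
  also have "\<dots> = ennreal (sqrt 2)" by (rule nn_integral_exp_square_quarter)
  also have "\<dots> \<le> ennreal 2" by (intro ennreal_leI real_le_lsqrt) auto
  finally show ?thesis by simp
qed

text \<open>The path of W minus its regression on \<open>W e\<close>; for a unit vector e each
  coordinate is uncorrelated with \<open>W e\<close>. The restriction to \<open>l2 M\<close> makes
  it a point of the observation space.\<close>

definition residual :: "('a \<Rightarrow> real) \<Rightarrow> 'w \<Rightarrow> ('a \<Rightarrow> real) \<Rightarrow> real" where
  "residual e \<omega> = (\<lambda>h\<in>l2 M. W h \<omega> - l2_inner M h e * W e \<omega>)"

lemma measurable_residual [measurable]: "e \<in> l2 M \<Longrightarrow> residual e \<in> measurable P (obs_space M)"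
  unfolding residual_def[abs_def] obs_space_def by (rule measurable_restrict) measurable

text \<open>The pair on the left is compared with its independent copy on the product space
  through characteristic functions.\<close>

lemma residual_indep_finite:
  assumes e: "e \<in> l2 M" "l2_norm M e = 1" and J: "finite J" "J \<subseteq> l2 M"
    and A: "A \<in> sets borel" and B: "\<And>h. h \<in> J \<Longrightarrow> B h \<in> sets borel"
  shows "measure P {\<omega> \<in> space P. W e \<omega> \<in> A \<and> (\<forall>h\<in>J. residual e \<omega> h \<in> B h)} =
     measure P {\<omega> \<in> space P. W e \<omega> \<in> A} * measure P {\<omega> \<in> space P. \<forall>h\<in>J. residual e \<omega> h \<in> B h}"
proof -
  interpret PP: pair_prob_space P P ..
  \<comment> \<open>\<open>None\<close> indexes the coordinate \<open>W e\<close> and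
    \<open>Some h\<close> the residual at h. \<open>Y\<close> evaluates the two kinds at separate
    points of the product space and so makes them independent.\<close>
  define I where "I = insert None (Some ` J)"
  define R where "R h \<omega> = W h \<omega> - l2_inner M h e * W e \<omega>" for h \<omega>
  define X where "X i \<omega> = (case i of None \<Rightarrow> W e \<omega> | Some h \<Rightarrow> R h \<omega>)" for i \<omega>
  define Y where "Y i z = (case i of None \<Rightarrow> W e (fst z) | Some h \<Rightarrow> R h (snd z))" for i z
  define C where "C i = (case i of None \<Rightarrow> A | Some h \<Rightarrow> B h)" for i
  have mR: "R h \<in> borel_measurable P" if "h \<in> J" for h
    unfolding R_def[abs_def] using e J that
        by (intro borel_measurable_diff borel_measurable_times measurable_W) auto
  have res: "residual e \<omega> h = R h \<omega>" if "h \<in> J" for h \<omega>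
    using that J by (auto simp: residual_def R_def)
  have sum: "(\<Sum>i\<in>I. t i * Z i) = t None * Z None + (\<Sum>h\<in>J. t (Some h) * Z (Some h))"
      for t Z :: "_ \<Rightarrow> real"
    unfolding I_def using J(1) by (subst sum.insert) (auto simp: sum.reindex)
  have main: "measure P {\<omega> \<in> space P. \<forall>i\<in>I. X i \<omega> \<in> C i} =
      measure (P \<Otimes>\<^sub>M P) {z \<in> space (P \<Otimes>\<^sub>M P). \<forall>i\<in>I. Y i z \<in> C i}"
  proof (rule finite_dim_char_uniqueness)
    show "finite I" using J by (simp add: I_def)
    show "finite_measure P" "finite_measure (P \<Otimes>\<^sub>M P)" by unfold_locales
    show "X i \<in> borel_measurable P" if "i \<in> I" for i
      using that mR e by (auto simp: I_def X_def[abs_def])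
    show "Y i \<in> borel_measurable (P \<Otimes>\<^sub>M P)" if "i \<in> I" for i
      using that e measurable_compose[OF measurable_snd mR] measurable_compose[OF measurable_fst measurable_W[OF e(1)]]
      by (auto simp: I_def Y_def[abs_def])
    show "C i \<in> sets borel" if "i \<in> I" for i using that A B by (auto simp: C_def I_def)
    fix t :: "('a \<Rightarrow> real) option \<Rightarrow> real"
    define s where "s = t None"
    define p where "p h x = h x - l2_inner M h e * e x" for h x
    define G where "G x = (\<Sum>h\<in>J. t (Some h) * p h x)" for x
    have p: "p h \<in> l2 M" if "h \<in> J" for h
      unfolding p_def[abs_def] using that J e by (intro l2_diff l2_scale) auto
    have G: "G \<in> l2 M" unfolding G_def[abs_def] by (intro l2_sum l2_scale p)
    have pe: "l2_inner M (p h) e = 0" if "h \<in> J" for h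
    proof -
      have "l2_inner M (p h) e = l2_inner M h e - l2_inner M h e * l2_inner M e e"
        unfolding p_def[abs_def] using that J e
        by (subst l2_inner_diff_left) (auto intro: l2_scale simp: l2_inner_scale_left)
      then show ?thesis using e(2) by (simp flip: l2_norm_eq_inner)
    qed
    \<comment> \<open>Since G is orthogonal to e, the squared norm of s e + G is a sum, and the
      Gaussian characteristic function factors.\<close>
    have Ge: "l2_inner M G e = 0"
      unfolding G_def[abs_def] using p e pe
      by (subst l2_inner_sum_left) (auto intro: l2_scale simp: l2_inner_scale_left)
    have AG: "AE \<omega> in P. W G \<omega> = (\<Sum>h\<in>J. t (Some h) * R h \<omega>)"
    proof -
      have 1: "AE \<omega> in P. W G \<omega> = (\<Sum>h\<in>J. t (Some h) * W (p h) \<omega>)"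
        by (rule AE_W_linear[OF J(1) p G]) (simp_all add: G_def l2_norm_def)
      have "AE \<omega> in P. W (p h) \<omega> = R h \<omega>" if "h \<in> J" for h
      proof -
        have "AE \<omega> in P. W (p h) \<omega> =
            (\<Sum>b\<in>UNIV. (if b then 1 else - l2_inner M h e) * W (if b then h else e) \<omega>)"
          using that J e by (intro AE_W_linear) (auto simp: p UNIV_bool p_def l2_norm_def)
        then show ?thesis by eventually_elim (simp add: UNIV_bool R_def)
      qed
      then have "AE \<omega> in P. \<forall>h\<in>J. W (p h) \<omega> = R h \<omega>"
        using J(1) by (simp add: AE_finite_all)
      with 1 show ?thesis by eventually_elim simp
    qed
    define H where "H x = s * e x + 1 * G x" for x
    have H: "H \<in> l2 M" unfolding H_def[abs_def] by (intro l2_add l2_scale e G)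
    have AH: "AE \<omega> in P. W H \<omega> = s * W e \<omega> + W G \<omega>"
    proof -
      have "AE \<omega> in P. W H \<omega> = (\<Sum>b\<in>UNIV. (if b then s else 1) * W (if b then e else G) \<omega>)"
        using e G by (intro AE_W_linear) (auto simp: UNIV_bool H l2_norm_def H_def)
      then show ?thesis by eventually_elim (simp add: UNIV_bool)
    qed
    have nH: "(l2_norm M H)\<^sup>2 = s\<^sup>2 + (l2_norm M G)\<^sup>2"
      unfolding H_def[abs_def] using e G Ge
      by (subst l2_norm_power2_add)
         (auto intro: l2_scale simp: l2_inner_scale_left l2_norm_scale l2_inner_commute[of M e] power_mult_distrib)
    have mS: "(\<lambda>\<omega>. \<Sum>h\<in>J. t (Some h) * R h \<omega>) \<in> borel_measurable P"
      by (intro borel_measurable_sum borel_measurable_times mR) auto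
    have "(\<integral>\<omega>. cis (\<Sum>i\<in>I. t i * X i \<omega>) \<partial>P) = (\<integral>\<omega>. cis (W H \<omega>) \<partial>P)"
    proof (rule integral_cong_AE)
      show "AE \<omega> in P. cis (\<Sum>i\<in>I. t i * X i \<omega>) = cis (W H \<omega>)"
        using AG AH by eventually_elim (simp add: sum X_def s_def)
    qed (use mS H e in \<open>auto simp: sum X_def\<close>)
    also have "\<dots> = complex_of_real (exp (- s\<^sup>2 / 2) * exp (- (l2_norm M G)\<^sup>2 / 2))"
      unfolding char_W[OF H] nH by (simp add: add_divide_distrib flip: exp_add)
    also have "\<dots> = (\<integral>\<omega>. cis (s * W e \<omega>) \<partial>P) * (\<integral>\<omega>. cis (\<Sum>h\<in>J. t (Some h) * R h \<omega>) \<partial>P)"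
    proof -
      have se: "(\<lambda>x. s * e x) \<in> l2 M" using e by (intro l2_scale)
      have "AE \<omega> in P. W (\<lambda>x. s * e x) \<omega> = (\<Sum>b\<in>{()}. s * W e \<omega>)"
        using e se by (intro AE_W_linear) (auto simp: l2_norm_def)
      then have "(\<integral>\<omega>. cis (W (\<lambda>x. s * e x) \<omega>) \<partial>P) = (\<integral>\<omega>. cis (s * W e \<omega>) \<partial>P)"
        using e se by (intro integral_cong_AE) auto
      moreover have "(\<integral>\<omega>. cis (W G \<omega>) \<partial>P) = (\<integral>\<omega>. cis (\<Sum>h\<in>J. t (Some h) * R h \<omega>) \<partial>P)"
        using AG G mS by (intro integral_cong_AE) auto
      ultimately show ?thesis
        using char_W[OF se] char_W[OF G] e(2) by (simp add: l2_norm_scale)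
    qed
    also have "\<dots> = (\<integral>\<omega>1. \<integral>\<omega>2. cis (s * W e \<omega>1) * cis (\<Sum>h\<in>J. t (Some h) * R h \<omega>2) \<partial>P \<partial>P)"
      by simp
    also have "\<dots> = (\<integral>z. cis (s * W e (fst z)) * cis (\<Sum>h\<in>J. t (Some h) * R h (snd z)) \<partial>(P \<Otimes>\<^sub>M P))"
    proof -
      have m1: "(\<lambda>z. s * W e (fst z) + (\<Sum>h\<in>J. t (Some h) * R h (snd z))) \<in> borel_measurable (P \<Otimes>\<^sub>M P)"
        using measurable_compose[OF measurable_snd mS] measurable_compose[OF measurable_fst measurable_W[OF e(1)]]
        by measurable
      have "integrable (P \<Otimes>\<^sub>M P) (\<lambda>z. cis (s * W e (fst z) + (\<Sum>h\<in>J. t (Some h) * R h (snd z))))"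
        by (intro integrable_cis m1) unfold_locales
      from PP.integral_fst'[OF this] show ?thesis by (simp add: cis_mult)
    qed
    also have "\<dots> = (\<integral>z. cis (\<Sum>i\<in>I. t i * Y i z) \<partial>(P \<Otimes>\<^sub>M P))"
      by (simp add: sum Y_def cis_mult s_def)
    finally show "(\<integral>\<omega>. cis (\<Sum>i\<in>I. t i * X i \<omega>) \<partial>P) = (\<integral>z. cis (\<Sum>i\<in>I. t i * Y i z) \<partial>(P \<Otimes>\<^sub>M P))" .
  qed
  have S1: "{\<omega> \<in> space P. W e \<omega> \<in> A} \<in> sets P"
    using measurable_sets[OF measurable_W[OF e(1)] A] by (simp add: vimage_def Int_def conj_commute)
  have S2: "{\<omega> \<in> space P. \<forall>h\<in>J. residual e \<omega> h \<in> B h} \<in> sets P"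
  proof (intro sets.sets_Collect_finite_All J(1))
    fix h assume "h \<in> J"
    then show "{\<omega> \<in> space P. residual e \<omega> h \<in> B h} \<in> sets P"
      using measurable_sets[OF mR B] by (simp add: vimage_def Int_def conj_commute res)
  qed
  have "{z \<in> space (P \<Otimes>\<^sub>M P). \<forall>i\<in>I. Y i z \<in> C i} =
      {\<omega> \<in> space P. W e \<omega> \<in> A} \<times> {\<omega> \<in> space P. \<forall>h\<in>J. residual e \<omega> h \<in> B h}"
    by (auto simp: I_def Y_def C_def space_pair_measure res)
  then have "measure (P \<Otimes>\<^sub>M P) {z \<in> space (P \<Otimes>\<^sub>M P). \<forall>i\<in>I. Y i z \<in> C i} =
      measure P {\<omega> \<in> space P. W e \<omega> \<in> A} * measure P {\<omega> \<in> space P. \<forall>h\<in>J. residual e \<omega> h \<in> B h}"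
    using S1 S2 by (simp add: measure_def emeasure_pair_measure_Times enn2real_mult)
  moreover have "{\<omega> \<in> space P. \<forall>i\<in>I. X i \<omega> \<in> C i} =
      {\<omega> \<in> space P. W e \<omega> \<in> A \<and> (\<forall>h\<in>J. residual e \<omega> h \<in> B h)}"
    by (auto simp: I_def X_def C_def res)
  ultimately show ?thesis using main by simp
qed

text \<open>For a fixed event A in the first coordinate both sides are finite measures of the
  residual path. On the infinite product these are determined by cylinder sets, where
  finite-dimensional independence applies.\<close>

lemma distr_W_residual:
  assumes e: "e \<in> l2 M" "l2_norm M e = 1"
  shows "std_normal_distribution \<Otimes>\<^sub>M distr P (obs_space M) (residual e) =
     distr P (borel \<Otimes>\<^sub>M obs_space M) (\<lambda>\<omega>. (W e \<omega>, residual e \<omega>))"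
proof (rule pair_measure_eqI)
  interpret N: real_distribution std_normal_distribution by (rule real_dist_normal_dist)
  interpret R: prob_space "distr P (obs_space M) (residual e)" using e by (intro prob_space_distr) simp
  show "sigma_finite_measure std_normal_distribution" "sigma_finite_measure (distr P (obs_space M) (residual e))"
    by unfold_locales
  show "sets (std_normal_distribution \<Otimes>\<^sub>M distr P (obs_space M) (residual e)) =
    sets (distr P (borel \<Otimes>\<^sub>M obs_space M) (\<lambda>\<omega>. (W e \<omega>, residual e \<omega>)))"
    by (simp cong: sets_pair_measure_cong)
  fix A B assume "A \<in> sets std_normal_distribution" "B \<in> sets (distr P (obs_space M) (residual e))"
  then have A: "A \<in> sets borel" and B: "B \<in> sets (obs_space M)" by auto
  let ?E = "{\<omega> \<in> space P. W e \<omega> \<in> A}"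
  have E: "?E \<in> sets P"
    using measurable_sets[OF measurable_W[OF e(1)] A] by (simp add: vimage_def Int_def conj_commute)
  have res: "{\<omega> \<in> space P. residual e \<omega> \<in> S} \<in> sets P" if "S \<in> sets (obs_space M)" for S
    using measurable_sets[OF measurable_residual[OF e(1)] that]
        by (simp add: vimage_def Int_def conj_commute)
  have std: "emeasure std_normal_distribution A = emeasure P ?E"
  proof -
    have "std_normal_distribution = distr P borel (W e)"
      using distr_W[OF e(1)] e(2) distr_id2[of borel std_normal_distribution] by simp
    then have "emeasure std_normal_distribution A = emeasure (distr P borel (W e)) A" by simp
    then show ?thesis
      using e A by (simp add: emeasure_distr vimage_def Int_def conj_commute)
  qed
  define \<nu>1 where "\<nu>1 = distr (density P (indicator ?E)) (obs_space M) (residual e)"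
  define \<nu>2 where "\<nu>2 = density (distr P (obs_space M) (residual e)) (\<lambda>_. emeasure P ?E)"
  have v1: "emeasure \<nu>1 S = emeasure P {\<omega> \<in> space P. W e \<omega> \<in> A \<and> residual e \<omega> \<in> S}"
      if S: "S \<in> sets (obs_space M)" for S
  proof -
    have "emeasure \<nu>1 S = emeasure (density P (indicator ?E)) {\<omega> \<in> space P. residual e \<omega> \<in> S}"
      using S e unfolding \<nu>1_def
      by (subst emeasure_distr) (auto simp: vimage_def Int_def conj_commute)
    also have "\<dots> = (\<integral>\<^sup>+\<omega>. indicator ?E \<omega> * indicator {\<omega> \<in> space P. residual e \<omega> \<in> S} \<omega> \<partial>P)"
      using E res[OF S] by (intro emeasure_density) auto
    also have "\<dots> = (\<integral>\<^sup>+\<omega>. indicator (?E \<inter> {\<omega> \<in> space P. residual e \<omega> \<in> S}) \<omega> \<partial>P)"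
      by (intro nn_integral_cong) (auto simp: indicator_def)
    also have "\<dots> = emeasure P (?E \<inter> {\<omega> \<in> space P. residual e \<omega> \<in> S})"
      using E res[OF S] by simp
    finally show ?thesis by (simp add: Int_def conj_ac)
  qed
  have v2: "emeasure \<nu>2 S = emeasure P ?E * emeasure P {\<omega> \<in> space P. residual e \<omega> \<in> S}"
      if S: "S \<in> sets (obs_space M)" for S
  proof -
    have "emeasure \<nu>2 S = emeasure P ?E * emeasure (distr P (obs_space M) (residual e)) S"
      using S unfolding \<nu>2_def by (simp add: emeasure_density nn_integral_cmult_indicator)
    then show ?thesis using S e by (simp add: emeasure_distr vimage_def Int_def conj_commute)
  qed
  have "\<nu>1 = \<nu>2"
  proof (rule measure_eqI_PiM_infinite)
    show "sets \<nu>1 = sets (PiM (l2 M) (\<lambda>_. borel :: real measure))" "sets \<nu>2 =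
        sets (PiM (l2 M) (\<lambda>_. borel :: real measure))"
      by (simp_all add: \<nu>1_def \<nu>2_def obs_space_def)
    show "finite_measure \<nu>1"
    proof (rule finite_measureI)
      have "emeasure \<nu>1 (space \<nu>1) = emeasure \<nu>1 (space (obs_space M))" by (simp add: \<nu>1_def)
      then show "emeasure \<nu>1 (space \<nu>1) \<noteq> \<infinity>" using v1[of "space (obs_space M)"] by simp
    qed
    fix B :: "('a \<Rightarrow> real) \<Rightarrow> real set" and J assume J: "finite J" "J \<subseteq> l2 M"
        and B: "\<And>i. i \<in> J \<Longrightarrow> B i \<in> sets borel"
    let ?S = "prod_emb (l2 M) (\<lambda>_. borel :: real measure) J (Pi\<^sub>E J B)"
    have S: "?S \<in> sets (obs_space M)" unfolding obs_space_def using J B by (intro sets_PiM_I) auto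
    have mem: "residual e \<omega> \<in> ?S \<longleftrightarrow> (\<forall>h\<in>J. residual e \<omega> h \<in> B h)" for \<omega>
      using J by (auto simp: prod_emb_def residual_def PiE_iff restrict_def space_PiM extensional_def)
    show "emeasure \<nu>1 ?S = emeasure \<nu>2 ?S"
      unfolding v1[OF S] v2[OF S] mem
      using residual_indep_finite[OF e J A, of B] B
      by (simp add: emeasure_eq_measure flip: ennreal_mult)
  qed
  then have "emeasure \<nu>1 B = emeasure \<nu>2 B" by simp
  moreover have "emeasure (distr P (borel \<Otimes>\<^sub>M obs_space M) (\<lambda>\<omega>. (W e \<omega>, residual e \<omega>))) (A \<times> B) =
      emeasure P {\<omega> \<in> space P. W e \<omega> \<in> A \<and> residual e \<omega> \<in> B}"
    using A B e by (subst emeasure_distr) (auto intro!: arg_cong[where f="emeasure P"])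
  moreover have "emeasure (distr P (obs_space M) (residual e)) B =
      emeasure P {\<omega> \<in> space P. residual e \<omega> \<in> B}"
    using B e by (simp add: emeasure_distr vimage_def Int_def conj_commute)
  ultimately show "emeasure std_normal_distribution A *
      emeasure (distr P (obs_space M) (residual e)) B =
      emeasure (distr P (borel \<Otimes>\<^sub>M obs_space M) (\<lambda>\<omega>. (W e \<omega>, residual e \<omega>))) (A \<times> B)"
    using v1[OF B] v2[OF B] std by simp
qed

text \<open>Given the residual path, \<open>W e\<close> is still standard normal. Integrals over the
  noise thus reduce to a single real variable with explicit density, with the residual as a
  parameter.\<close>

lemma nn_integral_W_residual:
  assumes e: "e \<in> l2 M" "l2_norm M e = 1" and f: "f \<in> borel_measurable (borel \<Otimes>\<^sub>M obs_space M)"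
  shows "(\<integral>\<^sup>+\<omega>. f (W e \<omega>, residual e \<omega>) \<partial>P) =
     (\<integral>\<^sup>+r. \<integral>\<^sup>+x. f (x, r) * ennreal (std_normal_density x) \<partial>lborel \<partial>distr P (obs_space M) (residual e))"
proof -
  interpret N: real_distribution std_normal_distribution by (rule real_dist_normal_dist)
  interpret R: prob_space "distr P (obs_space M) (residual e)" using e by (intro prob_space_distr) simp
  interpret pair_sigma_finite std_normal_distribution "distr P (obs_space M) (residual e)" ..
  have f': "f \<in> borel_measurable (std_normal_distribution \<Otimes>\<^sub>M distr P (obs_space M) (residual e))"
    using f by (simp cong: measurable_cong_sets sets_pair_measure_cong)
  have "(\<integral>\<^sup>+\<omega>. f (W e \<omega>, residual e \<omega>) \<partial>P) =
      (\<integral>\<^sup>+z. f z \<partial>distr P (borel \<Otimes>\<^sub>M obs_space M) (\<lambda>\<omega>. (W e \<omega>, residual e \<omega>)))"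
    using e f by (subst nn_integral_distr) auto
  also have "\<dots> = (\<integral>\<^sup>+z. f z \<partial>(std_normal_distribution \<Otimes>\<^sub>M distr P (obs_space M) (residual e)))"
    by (simp add: distr_W_residual[OF e])
  also have "\<dots> = (\<integral>\<^sup>+r. \<integral>\<^sup>+x. f (x, r) \<partial>std_normal_distribution \<partial>distr P (obs_space M) (residual e))"
    by (rule nn_integral_snd[OF f', symmetric])
  also have "\<dots> = (\<integral>\<^sup>+r. \<integral>\<^sup>+x. f (x, r) *
      ennreal (std_normal_density x) \<partial>lborel \<partial>distr P (obs_space M) (residual e))"
  proof (rule nn_integral_cong)
    fix r assume "r \<in> space (distr P (obs_space M) (residual e))"
    then have "r \<in> space (obs_space M)" by simp
    then have "(\<lambda>x. f (x, r)) \<in> borel_measurable borel"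
      using f by measurable
    then show "(\<integral>\<^sup>+x. f (x, r) \<partial>std_normal_distribution) =
        (\<integral>\<^sup>+x. f (x, r) * ennreal (std_normal_density x) \<partial>lborel)"
      by (subst nn_integral_density) (auto simp: mult.commute)
  qed
  finally show ?thesis .
qed

end

section \<open>The upper bound\<close>

locale deconvolution = convolution_kernel a b + white_noise_process "cube :: ('d \<Rightarrow> real) measure" P W
  for a :: "('d::finite \<Rightarrow> real) \<Rightarrow> real" and b :: "'d \<Rightarrow> nat \<Rightarrow> real"
    and P :: "'w measure" and W :: "(('d \<Rightarrow> real) \<Rightarrow> real) \<Rightarrow> 'w \<Rightarrow> real" +
  fixes C2 C3 :: real and q :: "'d \<Rightarrow> real"
  assumes C2: "C2 > 0" and C3: "C3 > 0" and q: "\<And>k. q k \<ge> 0"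
    and b_lower: "\<And>k j. j \<ge> 1 \<Longrightarrow> C2 * real j powr (- q k) \<le> b k j"
    and b_upper: "\<And>k j. j \<ge> 1 \<Longrightarrow> b k j \<le> C3 * real j powr (- q k)"
begin

lemma b_pos: "j \<ge> 1 \<Longrightarrow> b k j > 0"
  by (rule less_le_trans[OF _ b_lower]) (simp_all add: C2)

lemma b_nonzero: "j \<ge> 1 \<Longrightarrow> b k j \<noteq> 0"
  using b_pos[of j k] by simp

lemma observation_space: "observation a W n f \<omega> \<in> space (obs_space cube)"
  by (simp add: observation_def obs_space_def space_PiM)

lemma gamma_observation:
  fixes m :: "'d \<Rightarrow> nat" and \<theta> :: "'d \<Rightarrow> nat \<Rightarrow> real"
  assumes F: "F \<in> additive_l2" and g_def: "g = (\<lambda>x. \<Sum>k\<in>UNIV. cos_poly (m k) (\<theta> k) (x k))"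
  shows "gamma_n a (observation a W n F \<omega>) g =
    (l2_norm cube (\<lambda>x. g x - F x))\<^sup>2 - (l2_norm cube F)\<^sup>2 - 2 / sqrt n * W (inv_adjoint a g) \<omega>"
proof -
  have u: "inv_adjoint a g \<in> additive_l2"
    and *: "l2_inner cube F g = l2_inner cube (conv a F) (inv_adjoint a g)"
    unfolding g_def using inv_adjoint_cos_poly(1,2)[OF b_nonzero] F by auto
  have g: "g \<in> l2 cube"
    unfolding g_def by (intro additive_sum_l2 centred_l2_l2 cos_poly_centred)
  have F': "F \<in> l2 cube" by (rule additive_l2_l2[OF F])
  have "observation a W n F \<omega> (inv_adjoint a g) = l2_inner cube F g + W (inv_adjoint a g) \<omega> / sqrt n"
    using additive_l2_l2[OF u] * by (simp add: observation_def l2_inner_commute[of _ "inv_adjoint a g"])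
  then show ?thesis
    by (simp add: gamma_n_def l2_norm_power2_diff[OF g F'] l2_inner_commute[of _ g] field_simps)
qed

text \<open>A bound for the norm of Q on cosine polynomials of degree at most m in coordinate k: the
  inverse multiplier \<open>sqrt 2 / b k j\<close> is at most
  \<open>sqrt 2 / C2 * real j powr q k\<close>, which is largest at the last frequency.\<close>

definition inv_norm :: "'d \<Rightarrow> nat \<Rightarrow> real" where
  "inv_norm k m = sqrt 2 / C2 * real m powr q k"

lemma inv_norm_nonneg: "inv_norm k m \<ge> 0"
  using C2 by (simp add: inv_norm_def)

lemma norm_inv_cos_poly_le:
  "l2_norm unit_ival (cos_poly m (\<lambda>j. sqrt 2 / b k j * \<eta> j)) \<le>
      inv_norm k m * l2_norm unit_ival (cos_poly m \<eta>)"
proof (rule power2_le_imp_le)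
  have "(\<Sum>j=1..m. (sqrt 2 / b k j * \<eta> j)\<^sup>2) \<le> (\<Sum>j=1..m. (inv_norm k m)\<^sup>2 * (\<eta> j)\<^sup>2)"
  proof (rule sum_mono)
    fix j assume j: "j \<in> {1..m}"
    have "C2 * real m powr (- q k) \<le> C2 * real j powr (- q k)"
      using j C2 q[of k] by (intro mult_left_mono powr_mono2') auto
    also have "\<dots> \<le> b k j" using b_lower[of j k] j by simp
    finally have le: "C2 * real m powr (- q k) \<le> b k j" .
    have pos: "C2 * real m powr (- q k) > 0" using C2 j by simp
    have "sqrt 2 / b k j \<le> sqrt 2 / (C2 * real m powr (- q k))"
      using le pos by (intro divide_left_mono) auto
    also have "\<dots> = inv_norm k m" using j by (simp add: inv_norm_def powr_minus field_simps)
    finally have "(sqrt 2 / b k j)\<^sup>2 \<le> (inv_norm k m)\<^sup>2"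
      using b_pos[of j k] j by (intro power_mono) auto
    then show "(sqrt 2 / b k j * \<eta> j)\<^sup>2 \<le> (inv_norm k m)\<^sup>2 * (\<eta> j)\<^sup>2"
      by (simp only: power_mult_distrib) (intro mult_right_mono, auto)
  qed
  then show "(l2_norm unit_ival (cos_poly m (\<lambda>j. sqrt 2 / b k j * \<eta> j)))\<^sup>2
      \<le> (inv_norm k m * l2_norm unit_ival (cos_poly m \<eta>))\<^sup>2"
    by (simp only: norm_cos_poly power_mult_distrib sum_distrib_left)
qed (simp add: inv_norm_nonneg l2_norm_nonneg)

text \<open>A risk bound for fixed n and any finite sets of cosine polynomials. The noise is at most
  half the loss plus half the loss of the competitor \<open>g0\<close> plus a stochastic remainder.
  Moving half the loss to the left and doubling produces 3 = 2 (1 + 1/2) and 32 = 2 * 16. The 2 next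
  to the logarithm bounds the mean exponential moment over the net.\<close>

theorem net_estimator_risk:
  fixes S :: "'d \<Rightarrow> (real \<Rightarrow> real) set" and m :: "'d \<Rightarrow> nat"
  assumes n: "n \<ge> 1" and S: "\<And>k. finite (S k)" "\<And>k g. g \<in> S k \<Longrightarrow> \<exists>\<theta>. g = cos_poly (m k) \<theta>"
    and f: "\<And>k. f k \<in> centred_l2" "\<And>k. \<exists>g\<in>S k. l2_norm unit_ival (\<lambda>t. f k t - g t) \<le> d k"
    and est: "delta_net_estimator a S fhat"
  defines "F \<equiv> \<lambda>x. \<Sum>k\<in>UNIV. f k (x k)"
  shows "risk a P W n fhat F \<le>
    ennreal (\<Sum>k\<in>UNIV. 3 * (d k)\<^sup>2 + 32 * (inv_norm k (m k))\<^sup>2 / n * (ln (card (S k)) + 2))"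
proof -
  define c where "c k g = (SOME \<theta>. g = cos_poly (m k) \<theta>)" for k g
  have c: "g = cos_poly (m k) (c k g)" if "g \<in> S k" for k g
    unfolding c_def by (rule someI_ex[OF S(2)[OF that]])
  obtain g0 where g0: "\<And>k. g0 k \<in> S k" "\<And>k. l2_norm unit_ival (\<lambda>t. f k t - g0 k t) \<le> d k"
    using bchoice[of UNIV "\<lambda>k g. g \<in> S k \<and> l2_norm unit_ival (\<lambda>t. f k t - g t) \<le> d k"] f(2) by blast
  have Sc: "g \<in> centred_l2" if "g \<in> S k" for g k by (subst c[OF that]) (rule cos_poly_centred)
  have FA: "F \<in> additive_l2" unfolding F_def additive_l2_eq using f(1) by (intro oplusI)
  define T where "T g x = (\<Sum>k\<in>UNIV. g k (x k))" for g :: "'d \<Rightarrow> real \<Rightarrow> real" and x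
  have Tc: "T g = (\<lambda>x. \<Sum>k\<in>UNIV. cos_poly (m k) (c k (g k)) (x k))" if "\<And>k. g k \<in> S k" for g
    unfolding T_def[abs_def] using c[OF that] by simp
  \<comment> \<open>The kth component of the explicit representative of Qg, as a function on the
    cube.\<close>
  define V where "V k g = (\<lambda>x :: 'd \<Rightarrow> real. cos_poly (m k) (\<lambda>j. sqrt 2 / b k j * c k g j) (x k))"
      for k g
  have V: "V k g \<in> l2 cube" for k g
    unfolding V_def by (intro l2_cube_component centred_l2_l2 cos_poly_centred)
  \<comment> \<open>The component of the competitor is subtracted, so that the size of the noise is
    controlled by the distance \<open>\<Delta> k g\<close> from \<open>g0 k\<close>.\<close>
  define D where "D k g = (\<lambda>x :: 'd \<Rightarrow> real. V k g x - V k (g0 k) x)" for k g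
  have D: "D k g \<in> l2 cube" for k g unfolding D_def by (intro l2_diff V)
  define \<Delta> where "\<Delta> k g = l2_norm unit_ival (\<lambda>t. g t - g0 k t)" for k g
  define \<tau> where "\<tau> k = inv_norm k (m k)" for k
  have normD: "l2_norm cube (D k g) \<le> \<tau> k * \<Delta> k g" if g: "g \<in> S k" for k g
  proof -
    let ?p = "cos_poly (m k) (\<lambda>j. sqrt 2 / b k j * (c k g j - c k (g0 k) j))"
    have "D k g x = ?p (x k)" for x
      by (simp add: D_def V_def cos_poly_diff right_diff_distrib)
    then have Dp: "D k g = (\<lambda>x. ?p (x k))" by (rule ext)
    have "(l2_norm cube (D k g))\<^sup>2 = (l2_norm unit_ival ?p)\<^sup>2"
      unfolding Dp l2_norm_eq_inner by (subst inner_cube_components) (auto intro: cos_poly_centred)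
    then have "l2_norm cube (D k g) = l2_norm unit_ival ?p"
      by (simp add: power2_eq_iff_nonneg l2_norm_nonneg)
    also have "\<dots> \<le> \<tau> k * l2_norm unit_ival (cos_poly (m k) (\<lambda>j. c k g j - c k (g0 k) j))"
      unfolding \<tau>_def by (rule norm_inv_cos_poly_le)
    also have "cos_poly (m k) (\<lambda>j. c k g j - c k (g0 k) j) = (\<lambda>t. g t - g0 k t)"
      by (subst (2) c[OF g], subst (2) c[OF g0(1)]) (simp add: cos_poly_diff fun_eq_iff)
    finally show ?thesis by (simp add: \<Delta>_def)
  qed
  define N where "N k = real (card (S k))" for k
  have N: "N k \<ge> 1" for k
    using S(1)[of k] g0(1)[of k] by (auto simp: N_def card_gt_0_iff Suc_le_eq)
  \<comment> \<open>The noise is divided by its own scale before the exponential moments are summed,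
    so one random variable controls all candidates at once.\<close>
  define Z where "Z k \<omega> = (\<Sum>g\<in>S k. exp ((W (D k g) \<omega>)\<^sup>2 / (4 * (\<tau> k * \<Delta> k g)\<^sup>2)))" for k \<omega>
  have Z0: "Z k \<omega> \<ge> 0" for k \<omega> unfolding Z_def by (intro sum_nonneg) simp
  define A where "A k \<omega> = ln (N k) + Z k \<omega> / N k" for k \<omega>
  have A0: "A k \<omega> \<ge> 0" for k \<omega> using N[of k] Z0[of k \<omega>] by (simp add: A_def)
  have mZ: "Z k \<in> borel_measurable P" for k
    unfolding Z_def[abs_def] using D by measurable
  have EZ: "(\<integral>\<^sup>+\<omega>. ennreal (A k \<omega>) \<partial>P) \<le> ennreal (ln (N k) + 2)" for k
  proof -
    have mW: "(\<lambda>\<omega>. ennreal (exp ((W (D k g) \<omega>)\<^sup>2 / (4 * (\<tau> k * \<Delta> k g)\<^sup>2)))) \<in> borel_measurable P" for g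
      using D[of k g] by measurable
    have "(\<integral>\<^sup>+\<omega>. ennreal (Z k \<omega>) \<partial>P) =
        (\<Sum>g\<in>S k. \<integral>\<^sup>+\<omega>. ennreal (exp ((W (D k g) \<omega>)\<^sup>2 / (4 * (\<tau> k * \<Delta> k g)\<^sup>2))) \<partial>P)"
      unfolding Z_def using mW by (subst nn_integral_sum[symmetric]) (auto simp: sum_ennreal)
    also have "\<dots> \<le> (\<Sum>g\<in>S k. 2)"
      using D normD by (intro sum_mono exp_moment) auto
    also have "\<dots> = ennreal (2 * N k)"
      by (simp add: N_def ennreal_mult' mult.commute flip: ennreal_of_nat_eq_real_of_nat)
    finally have EZ: "(\<integral>\<^sup>+\<omega>. ennreal (Z k \<omega>) \<partial>P) \<le> ennreal (2 * N k)" .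
    have "(\<integral>\<^sup>+\<omega>. ennreal (A k \<omega>) \<partial>P) =
        (\<integral>\<^sup>+\<omega>. ennreal (ln (N k)) + ennreal (1 / N k) * ennreal (Z k \<omega>) \<partial>P)"
      unfolding A_def using N[of k] Z0
      by (intro nn_integral_cong) (simp add: ennreal_plus ennreal_mult'[symmetric] divide_inverse mult.commute)
    also have "\<dots> = ennreal (ln (N k)) + ennreal (1 / N k) * (\<integral>\<^sup>+\<omega>. ennreal (Z k \<omega>) \<partial>P)"
      using mZ[of k] by (subst nn_integral_add) (auto simp: nn_integral_cmult emeasure_space_1)
    also have "\<dots> \<le> ennreal (ln (N k)) + ennreal (1 / N k) * ennreal (2 * N k)"
      by (intro add_left_mono mult_left_mono EZ) simp
    also have "\<dots> = ennreal (ln (N k) + 2)"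
      using N[of k] by (simp add: ennreal_mult'[symmetric] ennreal_plus)
    finally show ?thesis .
  qed
  have fin: "finite (\<Pi>\<^sub>E k\<in>UNIV. S k)" using S(1) by (intro finite_PiE) auto
  \<comment> \<open>As there are finitely many combinations of net elements, one null set serves
    them all, whichever of them the estimator selects at \<omega>.\<close>
  have AE1: "AE \<omega> in P. \<forall>g\<in>(\<Pi>\<^sub>E k\<in>UNIV. S k). W (inv_adjoint a (T g)) \<omega> = (\<Sum>k\<in>UNIV. W (V k (g k)) \<omega>)"
  proof (rule AE_finite_allI[OF fin])
    fix g assume "g \<in> (\<Pi>\<^sub>E k\<in>UNIV. S k)"
    then have g: "g k \<in> S k" for k by (auto simp: PiE_iff)
    note Q = inv_adjoint_cos_poly[OF b_nonzero, where m=m and \<theta>="\<lambda>k. c k (g k)", folded Tc[OF g]]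
    have "AE \<omega> in P. W (inv_adjoint a (T g)) \<omega> = (\<Sum>k\<in>UNIV. 1 * W (V k (g k)) \<omega>)"
      using Q(3) by (intro AE_W_linear V additive_l2_l2 Q(1)) (auto simp: V_def inv_cos_poly_def)
    then show "AE \<omega> in P. W (inv_adjoint a (T g)) \<omega> = (\<Sum>k\<in>UNIV. W (V k (g k)) \<omega>)" by simp
  qed
  \<comment> \<open>The second clause is for candidates with
    \<open>\<tau> k * \<Delta> k g = 0\<close>, such as \<open>g0 k\<close> itself, where dividing
    by the scale gives no information.\<close>
  have AE2: "AE \<omega> in P. \<forall>k\<in>UNIV. \<forall>g\<in>S k. W (D k g) \<omega> = W (V k g) \<omega> - W (V k (g0 k)) \<omega> \<and>
      (l2_norm cube (D k g) = 0 \<longrightarrow> W (D k g) \<omega> = 0)"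
  proof (intro AE_finite_allI S(1) finite)
    fix k g
    have "AE \<omega> in P. W (D k g) \<omega> =
        (\<Sum>i\<in>UNIV. (if i then 1 else - 1) * W (if i then V k g else V k (g0 k)) \<omega>)"
      using V D by (intro AE_W_linear) (auto simp: UNIV_bool D_def l2_norm_def)
    moreover have "AE \<omega> in P. l2_norm cube (D k g) = 0 \<longrightarrow> W (D k g) \<omega> = 0"
    proof (cases "l2_norm cube (D k g) = 0")
      case True
      with AE_W_linear[of "{}" "\<lambda>_. D k g" "D k g" "\<lambda>_. 0"] D[of k g] show ?thesis by simp
    qed simp
    ultimately show "AE \<omega> in P. W (D k g) \<omega> = W (V k g) \<omega> - W (V k (g0 k)) \<omega> \<and>
      (l2_norm cube (D k g) = 0 \<longrightarrow> W (D k g) \<omega> = 0)"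
      by eventually_elim (simp add: UNIV_bool)
  qed
  have bound: "AE \<omega> in P. (l2_norm cube (\<lambda>x. fhat (observation a W n F \<omega>) x - F x))\<^sup>2 \<le>
      (\<Sum>k\<in>UNIV. 3 * (d k)\<^sup>2 + 32 * (\<tau> k)\<^sup>2 / n * A k \<omega>)"
    using AE1 AE2
  proof eventually_elim
    fix \<omega>
    assume lin: "\<forall>g\<in>(\<Pi>\<^sub>E k\<in>UNIV. S k). W (inv_adjoint a (T g)) \<omega> = (\<Sum>k\<in>UNIV. W (V k (g k)) \<omega>)"
      and dif: "\<forall>k\<in>UNIV. \<forall>g\<in>S k. W (D k g) \<omega> = W (V k g) \<omega> - W (V k (g0 k)) \<omega> \<and>
          (l2_norm cube (D k g) = 0 \<longrightarrow> W (D k g) \<omega> = 0)"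
    define Y where "Y = observation a W n F \<omega>"
    have arg: "is_arg_min (gamma_n a Y) (\<lambda>g. g \<in> oplus S) (fhat Y)"
      using est observation_space by (auto simp: delta_net_estimator_def Y_def)
    then have "fhat Y \<in> oplus S" by (simp add: is_arg_min_def)
    then obtain g where g: "fhat Y = T g" "\<And>k. g k \<in> S k" by (auto simp: T_def[abs_def] elim!: oplusE)
    have T0: "T g0 \<in> oplus S" unfolding T_def[abs_def] using g0(1) by (intro oplusI)
    have min: "gamma_n a Y (T g) \<le> gamma_n a Y (T g0)"
      using arg T0 by (auto simp: is_arg_min_linorder g(1))
    have gam: "gamma_n a Y (T h) = (l2_norm cube (\<lambda>x. T h x - F x))\<^sup>2 - (l2_norm cube F)\<^sup>2
        - 2 / sqrt n * (\<Sum>k\<in>UNIV. W (V k (h k)) \<omega>)" if h: "\<And>k. h k \<in> S k" for h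
      unfolding Y_def using gamma_observation[OF FA Tc[OF h], of n \<omega>] lin h
      by (auto simp: PiE_iff)
    have nrm: "(l2_norm cube (\<lambda>x. T h x - F x))\<^sup>2 =
        (\<Sum>k\<in>UNIV. (l2_norm unit_ival (\<lambda>t. h k t - f k t))\<^sup>2)"
      if h: "\<And>k. h k \<in> S k" for h
      unfolding T_def F_def using Sc[OF h] f(1) by (rule norm_additive_diff)
    define E E0 where "E k = l2_norm unit_ival (\<lambda>t. g k t - f k t)"
        and "E0 k = l2_norm unit_ival (\<lambda>t. g0 k t - f k t)" for k
    \<comment> \<open>The minimiser does no worse than \<open>g0\<close>. The term ||F||^2 cancels,
      and the two noise sums combine into the noise of the differences.\<close>
    have "(\<Sum>k\<in>UNIV. (E k)\<^sup>2) \<le> (\<Sum>k\<in>UNIV. (E0 k)\<^sup>2) + 2 / sqrt n * (\<Sum>k\<in>UNIV. W (D k (g k)) \<omega>)"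
      using min dif g(2) unfolding gam[OF g(2)] gam[OF g0(1)] nrm[OF g(2)] nrm[OF g0(1)] E_def[symmetric] E0_def[symmetric]
      by (simp add: sum_subtractf right_diff_distrib)
    also have "\<dots> = (\<Sum>k\<in>UNIV. (E0 k)\<^sup>2 + 2 / sqrt n * W (D k (g k)) \<omega>)"
      by (simp add: sum.distrib sum_distrib_left)
    also have "\<dots> \<le> (\<Sum>k\<in>UNIV. (E0 k)\<^sup>2 + ((E k)\<^sup>2 / 2 + (E0 k)\<^sup>2 / 2 + 16 * (\<tau> k)\<^sup>2 / n * A k \<omega>))"
    proof (intro sum_mono add_left_mono)
      fix k
      \<comment> \<open>The noise is at most \<open>B * \<Delta> k (g k)\<close>; by AM-GM this is absorbed into the loss
        up to the term with \<open>A k\<close>.\<close>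
      define B where "B = 2 * \<tau> k * sqrt (A k \<omega>)"
      have tri: "\<Delta> k (g k) \<le> E k + E0 k"
      proof -
        have "l2_norm unit_ival (\<lambda>t. (g k t - f k t) + (f k t - g0 k t)) \<le>
            l2_norm unit_ival (\<lambda>t. g k t - f k t) + l2_norm unit_ival (\<lambda>t. f k t - g0 k t)"
          using g(2) g0(1) f(1) by (intro l2_norm_triangle l2_diff) (auto intro: centred_l2_l2 Sc)
        then show ?thesis by (simp add: \<Delta>_def E_def E0_def l2_norm_minus_commute[of _ "f k" "g0 k"])
      qed
      have WB: "W (D k (g k)) \<omega> \<le> B * \<Delta> k (g k)"
      proof (cases "\<tau> k * \<Delta> k (g k) = 0")
        case True
        then have "l2_norm cube (D k (g k)) \<le> 0"
          using normD[OF g(2), of k] by (simp only:)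
        then have "l2_norm cube (D k (g k)) = 0"
          using l2_norm_nonneg[of cube "D k (g k)"] by linarith
        then have "W (D k (g k)) \<omega> = 0" using dif g(2) by blast
        then show ?thesis using True by (auto simp: B_def)
      next
        case False
        \<comment> \<open>$y \le \ln N + e^y / N$ bounds the maximum over the net by a sum of exponential moments.\<close>
        define y where "y = (W (D k (g k)) \<omega>)\<^sup>2 / (4 * (\<tau> k * \<Delta> k (g k))\<^sup>2)"
        have "y - ln (N k) \<le> exp (y - ln (N k))" using exp_ge_add_one_self[of "y - ln (N k)"]
            by linarith
        also have "\<dots> = exp y / N k" using N[of k] by (simp add: exp_diff)
        also have "\<dots> \<le> Z k \<omega> / N k"
        proof (intro divide_right_mono)
          show "exp y \<le> Z k \<omega>" unfolding Z_def y_def using S(1) g(2)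
            by (rule member_le_sum[of "g k" "S k" "\<lambda>g. exp ((W (D k g) \<omega>)\<^sup>2 / (4 *
                (\<tau> k * \<Delta> k g)\<^sup>2))", rotated 2])
               simp_all
        qed (use N[of k] in simp)
        finally have "y \<le> A k \<omega>" by (simp add: A_def)
        then have "(W (D k (g k)) \<omega>)\<^sup>2 \<le> A k \<omega> * (4 * (\<tau> k * \<Delta> k (g k))\<^sup>2)"
          using False by (simp add: y_def divide_le_eq)
        also have "\<dots> = (B * \<Delta> k (g k))\<^sup>2"
          using A0[of k \<omega>] by (simp add: B_def power_mult_distrib)
        finally show ?thesis
          by (rule power2_le_imp_le)
             (simp add: B_def \<tau>_def inv_norm_nonneg A0 \<Delta>_def l2_norm_nonneg)
      qed
      define s where "s = sqrt n"
      have s: "s > 0" "s\<^sup>2 = n" using n by (auto simp: s_def)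
      have "2 / s * W (D k (g k)) \<omega> \<le> 2 / s * (B * \<Delta> k (g k))"
        using WB s by (intro mult_left_mono) auto
      also have "\<dots> \<le> (\<Delta> k (g k))\<^sup>2 / 4 + (2 / s * B)\<^sup>2"
      proof -
        have "0 \<le> (\<Delta> k (g k) / 2 - 2 / s * B)\<^sup>2" by simp
        then show ?thesis by (simp add: power2_diff power_divide) (simp add: field_simps)
      qed
      also have "(\<Delta> k (g k))\<^sup>2 \<le> 2 * (E k)\<^sup>2 + 2 * (E0 k)\<^sup>2"
      proof -
        have "(\<Delta> k (g k))\<^sup>2 \<le> (E k + E0 k)\<^sup>2"
          using tri l2_norm_nonneg by (intro power_mono) (auto simp: \<Delta>_def)
        also have "\<dots> \<le> 2 * (E k)\<^sup>2 + 2 * (E0 k)\<^sup>2"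
          using zero_le_power2[of "E k - E0 k"] by (simp add: power2_diff power2_sum)
        finally show ?thesis .
      qed
      also have "(2 / s * B)\<^sup>2 = 16 * (\<tau> k)\<^sup>2 / n * A k \<omega>"
        using A0[of k \<omega>] s by (simp add: B_def power_mult_distrib power_divide)
      finally show "2 / sqrt n * W (D k (g k)) \<omega> \<le>
          (E k)\<^sup>2 / 2 + (E0 k)\<^sup>2 / 2 + 16 * (\<tau> k)\<^sup>2 / n * A k \<omega>"
        by (simp add: s_def add_divide_distrib)
    qed
    finally have "(\<Sum>k\<in>UNIV. (E k)\<^sup>2) \<le> (\<Sum>k\<in>UNIV. 3 * (E0 k)\<^sup>2 + 32 * (\<tau> k)\<^sup>2 / n * A k \<omega>)"
      by (simp add: sum.distrib sum_divide_distrib[symmetric] sum_distrib_left[symmetric] mult.assoc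
            times_divide_eq_right[symmetric] del: times_divide_eq_right)
    also have "\<dots> \<le> (\<Sum>k\<in>UNIV. 3 * (d k)\<^sup>2 + 32 * (\<tau> k)\<^sup>2 / n * A k \<omega>)"
    proof (intro sum_mono add_right_mono mult_left_mono power_mono)
      show "E0 k \<le> d k" for k using g0(2)[of k] by (simp add: E0_def l2_norm_minus_commute[of _ "g0 k"])
    qed (auto simp: E0_def l2_norm_nonneg)
    finally show "(l2_norm cube (\<lambda>x. fhat (observation a W n F \<omega>) x - F x))\<^sup>2 \<le>
      (\<Sum>k\<in>UNIV. 3 * (d k)\<^sup>2 + 32 * (\<tau> k)\<^sup>2 / n * A k \<omega>)"
      using nrm[OF g(2)] by (simp add: E_def flip: Y_def) (simp add: g(1))
  qed
  have sum_eq: "ennreal (\<Sum>k\<in>UNIV. x k + y k * z k) =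
      (\<Sum>k\<in>UNIV. ennreal (x k) + ennreal (y k) * ennreal (z k))"
    if "\<And>k. x k \<ge> 0" "\<And>k. y k \<ge> 0" "\<And>k. z k \<ge> 0" for x y z :: "'d \<Rightarrow> real"
  proof -
    have "(\<Sum>k\<in>UNIV. ennreal (x k) + ennreal (y k) * ennreal (z k)) =
        (\<Sum>k\<in>UNIV. ennreal (x k + y k * z k))"
      using that by (intro sum.cong refl) (simp add: ennreal_plus ennreal_mult)
    also have "\<dots> = ennreal (\<Sum>k\<in>UNIV. x k + y k * z k)"
      using that by (intro sum_ennreal) auto
    finally show ?thesis by (rule sym)
  qed
  have "risk a P W n fhat F \<le> (\<integral>\<^sup>+\<omega>. ennreal (\<Sum>k\<in>UNIV. 3 * (d k)\<^sup>2 + 32 * (\<tau> k)\<^sup>2 / n * A k \<omega>) \<partial>P)"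
    unfolding risk_def using bound
    by (intro nn_integral_mono_AE) (auto elim!: eventually_mono intro: ennreal_leI)
  also have "\<dots> = (\<integral>\<^sup>+\<omega>. (\<Sum>k\<in>UNIV. ennreal (3 * (d k)\<^sup>2) +
      ennreal (32 * (\<tau> k)\<^sup>2 / n) * ennreal (A k \<omega>)) \<partial>P)"
    using A0 by (intro nn_integral_cong sum_eq) auto
  also have "\<dots> = (\<Sum>k\<in>UNIV. ennreal (3 * (d k)\<^sup>2) +
      ennreal (32 * (\<tau> k)\<^sup>2 / n) * (\<integral>\<^sup>+\<omega>. ennreal (A k \<omega>) \<partial>P))"
  proof -
    have mA: "(\<lambda>\<omega>. ennreal (A k \<omega>)) \<in> borel_measurable P" for k
      unfolding A_def using mZ[of k] by measurable
    show ?thesis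
      using mA by (subst nn_integral_sum) (auto simp: nn_integral_add nn_integral_cmult emeasure_space_1)
  qed
  also have "\<dots> \<le> (\<Sum>k\<in>UNIV. ennreal (3 * (d k)\<^sup>2) + ennreal (32 * (\<tau> k)\<^sup>2 / n) * ennreal (ln (N k) + 2))"
    by (intro sum_mono add_left_mono mult_left_mono EZ) simp
  also have "\<dots> = ennreal (\<Sum>k\<in>UNIV. 3 * (d k)\<^sup>2 + 32 * (\<tau> k)\<^sup>2 / n * (ln (N k) + 2))"
  proof -
    have "ln (N k) + 2 \<ge> 0" for k using N[of k] by (simp add: add_nonneg_nonneg)
    then show ?thesis by (intro sum_eq[symmetric]) auto
  qed
  finally show ?thesis by (simp add: \<tau>_def N_def)
qed

end

section \<open>The Sobolev ellipsoids and the rate of the estimator\<close>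

lemma ellipsoid_centred:
  assumes "f \<in> ellipsoid w L"
  shows "f \<in> centred_l2"
proof -
  obtain \<theta> where *: "l2_sums unit_ival (\<lambda>j t. \<theta> (Suc j) * phi (Suc j) t) f"
    using assms by (auto simp: ellipsoid_def)
  have f: "f \<in> l2 unit_ival" using * by (simp add: l2_sums_def)
  have "(\<lambda>j. l2_inner unit_ival (\<lambda>t. \<theta> (Suc j) *
      phi (Suc j) t) (phi 0)) sums l2_inner unit_ival f (phi 0)"
    by (intro l2_sums_inner * l2_scale phi_l2)
  then have "(\<lambda>j. 0) sums l2_inner unit_ival f (phi 0)"
    by (simp add: l2_inner_scale_left inner_phi_phi)
  then have "l2_inner unit_ival f (phi 0) = 0" using sums_0 sums_unique2 by blast
  then show ?thesis using f by (simp add: centred_l2_def l2_inner_def phi_def)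
qed

lemma cos_poly_ellipsoid:
  assumes "(\<Sum>j=1..m. (w j)\<^sup>2 * (\<theta> j)\<^sup>2) \<le> L\<^sup>2"
  shows "cos_poly m \<theta> \<in> ellipsoid w L"
proof -
  \<comment> \<open>Coefficients beyond m do not affect the polynomial but would enter the series,
    so they are set to zero.\<close>
  define \<eta> where "\<eta> j = (if j \<in> {1..m} then \<theta> j else 0)" for j
  have split: "(\<Sum>j<N. g (Suc j)) = (\<Sum>j=1..N. g j)" for g :: "nat \<Rightarrow> real" and N
    by (rule sum.reindex_bij_witness[of _ "\<lambda>j. j - 1" Suc]) auto
  have trunc: "(\<Sum>j=1..N. \<eta> j * phi j t) = cos_poly m \<theta> t" if "N \<ge> m" for N t
    unfolding cos_poly_def using that
    by (intro sum.mono_neutral_cong_right) (auto simp: \<eta>_def)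
  have "l2_sums unit_ival (\<lambda>j t. \<eta> (Suc j) * phi (Suc j) t) (cos_poly m \<theta>)"
    unfolding l2_sums_def
  proof
    show "cos_poly m \<theta> \<in> l2 unit_ival" by (intro centred_l2_l2 cos_poly_centred)
    have "\<forall>\<^sub>F N in sequentially. l2_norm unit_ival (\<lambda>x. cos_poly m \<theta> x -
        (\<Sum>j<N. \<eta> (Suc j) * phi (Suc j) x)) = 0"
      using eventually_ge_at_top[of m]
    proof eventually_elim
      fix N assume "m \<le> N"
      then have "cos_poly m \<theta> x - (\<Sum>j<N. \<eta> (Suc j) * phi (Suc j) x) = 0" for x
        by (simp only: split[of "\<lambda>j. \<eta> j * phi j x"] trunc diff_self)
      then show "l2_norm unit_ival (\<lambda>x. cos_poly m \<theta> x - (\<Sum>j<N. \<eta> (Suc j) * phi (Suc j) x)) = 0"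
        by (simp add: l2_norm_def)
    qed
    then show "(\<lambda>N. l2_norm unit_ival (\<lambda>x. cos_poly m \<theta> x - (\<Sum>j<N. \<eta> (Suc j) * phi (Suc j) x))) \<longlonglongrightarrow> 0"
      by (rule tendsto_eventually)
  qed
  moreover have "(\<lambda>j. (w (Suc j))\<^sup>2 * (\<eta> (Suc j))\<^sup>2) sums (\<Sum>j<m. (w (Suc j))\<^sup>2 * (\<eta> (Suc j))\<^sup>2)"
    by (rule sums_finite) (auto simp: \<eta>_def)
  moreover have "(\<Sum>j<m. (w (Suc j))\<^sup>2 * (\<eta> (Suc j))\<^sup>2) = (\<Sum>j=1..m. (w j)\<^sup>2 * (\<theta> j)\<^sup>2)"
    by (subst split[of "\<lambda>j. (w j)\<^sup>2 * (\<eta> j)\<^sup>2"]) (auto intro!: sum.cong simp: \<eta>_def)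
  ultimately show ?thesis
    using assms unfolding ellipsoid_def
        by (auto intro!: exI[of _ \<eta>] dest: sums_summable sums_unique[symmetric])
qed

context deconvolution
begin

text \<open>With D = 2s + 2q + 1 and \<rho> = n^(1/D), the degree and the log-cardinality of a net
  are at most of order \<rho>. The variance term is then at most of order \<rho>^(2q + 1) / n =
  n^(-2s/D), which is exactly the squared net radius; bias and noise are balanced in every
  component.\<close>

theorem upper_rate:
  fixes s :: "'d \<Rightarrow> real"
  assumes s: "\<And>k. s k > 0" and \<alpha>: "\<And>k. \<alpha> \<le> 2 * s k / (2 * s k + 2 * q k + 1)"
    and nets: "admissible_nets w L s q net"
        and est: "\<And>n. n \<ge> 1 \<Longrightarrow> delta_net_estimator a (net n) (fhat n)"
  shows "limsup (\<lambda>n. ennreal (real n powr \<alpha>) *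
      (SUP f\<in>oplus (\<lambda>k. ellipsoid (w k) (L k)). risk a P W n (fhat n) f)) < \<infinity>"
proof -
  let ?F = "oplus (\<lambda>k. ellipsoid (w k) (L k))"
  let ?S = "\<lambda>n. SUP f\<in>?F. risk a P W n (fhat n) f"
  obtain m :: "nat \<Rightarrow> 'd \<Rightarrow> nat" and C where
    m: "\<And>k. (\<lambda>n. real (m n k)) \<in> \<Theta>(\<lambda>n. delta (s k) (q k) n powr (- 1 / s k))" and
    net: "\<And>n k. n \<ge> 1 \<Longrightarrow> finite (net n k)"
      "\<And>n k f. n \<ge> 1 \<Longrightarrow> f \<in> ellipsoid (w k) (L k) \<Longrightarrow> \<exists>g\<in>net n k. l2_norm unit_ival (\<lambda>t. f t - g t) \<le>
          delta (s k) (q k) n"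
      "\<And>n k g. n \<ge> 1 \<Longrightarrow> g \<in> net n k \<Longrightarrow> \<exists>\<theta>. g = (\<lambda>t. \<Sum>j=1..m n k. \<theta> j * phi j t)"
      "\<And>n k. n \<ge> 1 \<Longrightarrow> ln (real (card (net n k))) \<le> C * delta (s k) (q k) n powr (- 1 / s k)"
    using nets unfolding admissible_nets_def by (elim exE conjE) (rule that; blast)
  define D where "D k = 2 * s k + 2 * q k + 1" for k
  have D: "D k > 0" for k using s[of k] q[of k] by (simp add: D_def)
  define \<rho> where "\<rho> n k = real n powr (1 / D k)" for n k
  have r: "delta (s k) (q k) n powr (- 1 / s k) = \<rho> n k" for n k
    using s[of k] by (simp add: delta_def \<rho>_def powr_powr D_def)
  have "\<exists>c>0. \<forall>\<^sub>F n in sequentially. real (m n k) \<le> c * \<rho> n k" for k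
  proof -
    from bigthetaD1[OF m[of k]] obtain c where "c > 0"
      "\<forall>\<^sub>F n in sequentially. norm (real (m n k)) \<le> c * norm (delta (s k) (q k) n powr (- 1 / s k))"
      by (elim landau_o.bigE) auto
    then show ?thesis unfolding r by (auto simp: \<rho>_def)
  qed
  then obtain c where c: "\<And>k. c k > 0" "\<And>k. \<forall>\<^sub>F n in sequentially. real (m n k) \<le> c k * \<rho> n k"
    using choice[of "\<lambda>k c. c > 0 \<and> (\<forall>\<^sub>F n in sequentially. real (m n k) \<le> c * \<rho> n k)"] by blast
  let ?B = "\<lambda>n k. 3 * (delta (s k) (q k) n)\<^sup>2 +
      32 * (inv_norm k (m n k))\<^sup>2 / n * (ln (card (net n k)) + 2)"
  \<comment> \<open>The 3 belongs to the squared net radius, 64 is 32 times the 2 in the square of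
    \<open>inv_norm\<close>, and \<open>\<bar>C\<bar> + 2\<close> bounds log-cardinality plus 2 in
    units of \<rho>, as \<rho> is at least 1.\<close>
  define K where "K k = 3 + 64 / C2\<^sup>2 * (c k powr (2 * q k)) * (\<bar>C\<bar> + 2)" for k
  have main: "real n powr \<alpha> * (?B n k) \<le> K k"
    if n: "n \<ge> 1" and mk: "real (m n k) \<le> c k * \<rho> n k" for n k
  proof -
    define \<beta> where "\<beta> = 2 * s k / D k"
    have \<rho>1: "\<rho> n k \<ge> 1" using n D[of k] by (simp add: \<rho>_def ge_one_powr_ge_zero)
    have d: "(delta (s k) (q k) n)\<^sup>2 = real n powr (- \<beta>)"
      using n by (simp add: delta_def D_def \<beta>_def power2_eq_square flip: powr_add)
    have i: "(inv_norm k (m n k))\<^sup>2 \<le> 2 / C2\<^sup>2 * (c k powr (2 * q k) * \<rho> n k powr (2 * q k))"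
    proof -
      have "(inv_norm k (m n k))\<^sup>2 = 2 / C2\<^sup>2 * (real (m n k) powr (2 * q k))"
      proof -
        have "(real (m n k) powr q k)\<^sup>2 = real (m n k) powr (2 * q k)"
          by (simp add: power2_eq_square flip: powr_add)
        then show ?thesis by (simp add: inv_norm_def power_mult_distrib power_divide)
      qed
      also have "\<dots> \<le> 2 / C2\<^sup>2 * ((c k * \<rho> n k) powr (2 * q k))"
        using mk q[of k] by (intro mult_left_mono powr_mono2) auto
      finally show ?thesis using c(1)[of k] by (simp add: powr_mult less_imp_le \<rho>_def)
    qed
    have l: "ln (card (net n k)) + 2 \<le> (\<bar>C\<bar> + 2) * \<rho> n k"
    proof -
      have "ln (card (net n k)) \<le> C * \<rho> n k" using net(4)[OF n, of k] unfolding r .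
      also have "\<dots> \<le> \<bar>C\<bar> * \<rho> n k" using \<rho>1 by (intro mult_right_mono) auto
      finally show ?thesis using \<rho>1 by (simp add: distrib_right)
    qed
    have "32 * (inv_norm k (m n k))\<^sup>2 / n * (ln (card (net n k)) + 2) \<le>
        32 * (inv_norm k (m n k))\<^sup>2 / n * ((\<bar>C\<bar> + 2) * \<rho> n k)"
      using l by (intro mult_left_mono) auto
    also have "\<dots> \<le> 32 * (2 / C2\<^sup>2 * (c k powr (2 * q k) * \<rho> n k powr (2 * q k))) / n *
        ((\<bar>C\<bar> + 2) * \<rho> n k)"
      using i \<rho>1 by (intro mult_right_mono divide_right_mono mult_left_mono) auto
    also have "\<dots> = (K k - 3) * ((\<rho> n k powr (2 * q k) * \<rho> n k) / n)"
      by (simp add: K_def)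
    also have "(\<rho> n k powr (2 * q k) * \<rho> n k) / n = real n powr (- \<beta>)"
    proof -
      have "(\<rho> n k powr (2 * q k) * \<rho> n k) / n =
          real n powr (2 * q k / D k) * real n powr (1 / D k) * real n powr (- 1)"
        using n by (simp add: \<rho>_def powr_powr powr_minus_divide)
      also have "\<dots> = real n powr (2 * q k / D k + 1 / D k + (- 1))" by (simp only: powr_add)
      also have "2 * q k / D k + 1 / D k + (- 1) = (2 * q k + 1 - D k) / D k"
        using D[of k] by (simp add: add_divide_distrib diff_divide_distrib)
      also have "\<dots> = - \<beta>" by (simp add: D_def \<beta>_def)
      finally show ?thesis .
    qed
    finally have "?B n k \<le> K k * real n powr (- \<beta>)"
      by (simp add: d algebra_simps)
    then have "real n powr \<alpha> * (?B n k)
        \<le> real n powr \<alpha> * (K k * real n powr (- \<beta>))" by (intro mult_left_mono) auto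
    also have "\<dots> = K k * real n powr (\<alpha> - \<beta>)" by (simp add: powr_diff powr_minus divide_inverse)
    also have "\<dots> \<le> K k * 1"
    proof (rule mult_left_mono)
      \<comment> \<open>The exponent \<alpha> is at most that of each component, so components with
        a faster rate do no harm.\<close>
      have "\<alpha> - \<beta> \<le> 0" using \<alpha>[of k] by (simp add: \<beta>_def D_def)
      then show "real n powr (\<alpha> - \<beta>) \<le> 1"
        using n powr_mono[of "\<alpha> - \<beta>" 0 "real n"] by simp
    qed (simp add: K_def)
    finally show ?thesis by simp
  qed
  have bd: "\<forall>\<^sub>F n in sequentially. ennreal (real n powr \<alpha>) *
      ?S n \<le> ennreal (\<Sum>k\<in>UNIV. K k)"
  proof -
    have "\<forall>\<^sub>F n in sequentially. \<forall>k\<in>UNIV. real (m n k) \<le> c k * \<rho> n k"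
      using c(2) by (intro eventually_ball_finite) auto
    then show ?thesis using eventually_ge_at_top[of 1]
    proof eventually_elim
      fix n :: nat assume mk: "\<forall>k\<in>UNIV. real (m n k) \<le> c k * \<rho> n k" and n: "1 \<le> n"
      have "?S n \<le> ennreal (\<Sum>k\<in>UNIV. ?B n k)"
      proof (rule SUP_least)
        fix F assume "F \<in> ?F"
        then obtain f where F: "F = (\<lambda>x. \<Sum>k\<in>UNIV. f k (x k))" and f: "\<And>k. f k \<in> ellipsoid (w k) (L k)"
          by (elim oplusE) auto
        show "risk a P W n (fhat n) F \<le> ennreal (\<Sum>k\<in>UNIV. ?B n k)"
          unfolding F
        proof (rule net_estimator_risk[OF n net(1)[OF n]])
          show "\<exists>\<theta>. g = cos_poly (m n k) \<theta>" if "g \<in> net n k" for k g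
            using net(3)[OF n that] by (auto simp: cos_poly_def[abs_def])
        qed (use net(2)[OF n] f est[OF n] ellipsoid_centred[OF f] in auto)
      qed
      then have "ennreal (real n powr \<alpha>) * ?S n \<le>
          ennreal (real n powr \<alpha>) * ennreal (\<Sum>k\<in>UNIV. ?B n k)" by (rule mult_left_mono) simp
      also have "\<dots> = ennreal (real n powr \<alpha> * (\<Sum>k\<in>UNIV. ?B n k))" by (simp add: ennreal_mult')
      also have "\<dots> \<le> ennreal (\<Sum>k\<in>UNIV. K k)"
        unfolding sum_distrib_left using main[OF n] mk by (intro ennreal_leI sum_mono) auto
      finally show "ennreal (real n powr \<alpha>) * ?S n
          \<le> ennreal (\<Sum>k\<in>UNIV. K k)" .
    qed
  qed
  have "limsup (\<lambda>n. ennreal (real n powr \<alpha>) * ?S n)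
      \<le> ennreal (\<Sum>k\<in>UNIV. K k)"
    using bd by (rule Limsup_bounded)
  also have "\<dots> < \<infinity>" by simp
  finally show ?thesis .
qed

end

section \<open>The lower bound\<close>

text \<open>By the Cauchy-Schwarz inequality the superlevel sets are open for the seminorm, and open
  sets generate \<open>l2_borel\<close>. So each Fourier coefficient of an estimator is a measurable
  real function of the observation.\<close>

lemma measurable_l2_inner:
  assumes e: "e \<in> l2 M"
  shows "(\<lambda>g. l2_inner M g e) \<in> borel_measurable (l2_borel M)"
proof (rule borel_measurableI_greater)
  fix y
  let ?U = "{g \<in> l2 M. y < l2_inner M g e}"
  let ?O = "{U. U \<subseteq> l2 M \<and> (\<forall>g\<in>U. \<exists>r>0. \<forall>h\<in>l2 M. l2_norm M (\<lambda>x. h x - g x) < r \<longrightarrow> h \<in> U)}"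
  have "?U \<in> ?O"
  proof (intro CollectI conjI ballI)
    fix g assume g: "g \<in> ?U"
    \<comment> \<open>The gap above y over a Lipschitz constant of the functional; 1 is added
      because e may have norm zero.\<close>
    define r where "r = (l2_inner M g e - y) / (l2_norm M e + 1)"
    have pos: "l2_norm M e + 1 > 0" using l2_norm_nonneg[of M e] by linarith
    have "r > 0" using g pos by (simp add: r_def)
    moreover have "h \<in> ?U" if h: "h \<in> l2 M" "l2_norm M (\<lambda>x. h x - g x) < r" for h
    proof -
      have "l2_inner M g e - l2_inner M h e \<le> \<bar>l2_inner M (\<lambda>x. h x - g x) e\<bar>"
        using g h e by (simp add: l2_inner_diff_left)
      also have "\<dots> \<le> l2_norm M (\<lambda>x. h x - g x) * l2_norm M e"
        using g h e by (intro l2_Cauchy_Schwarz l2_diff) auto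
      also have "\<dots> \<le> r * l2_norm M e" using h by (intro mult_right_mono) (auto simp: l2_norm_nonneg)
      also have "\<dots> < r * (l2_norm M e + 1)" using \<open>r > 0\<close> by simp
      also have "\<dots> = l2_inner M g e - y" using pos by (simp add: r_def)
      finally show ?thesis using h by simp
    qed
    ultimately show "\<exists>r>0. \<forall>h\<in>l2 M. l2_norm M (\<lambda>x. h x - g x) < r \<longrightarrow> h \<in> ?U" by blast
  qed auto
  moreover have "?O \<subseteq> Pow (l2 M)" by auto
  ultimately show "{g \<in> space (l2_borel M). y < l2_inner M g e} \<in> sets (l2_borel M)"
    unfolding l2_borel_def by (simp add: space_measure_of sets_measure_of)
qed

lemma std_normal_density_antimono:
  assumes "\<bar>y\<bar> \<le> B"
  shows "std_normal_density B \<le> std_normal_density y"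
proof -
  have "y\<^sup>2 \<le> B\<^sup>2" using assms by (simp add: abs_le_square_iff[symmetric])
  then show ?thesis by (simp add: std_normal_density_def divide_right_mono)
qed

context white_noise_process
begin

text \<open>Two normal densities with bounded shifts overlap on a set of positive mass, so no measurable
  function of the observation separates the two shifts.\<close>

lemma two_point_bound:
  fixes B :: "('a \<Rightarrow> real) \<Rightarrow> real" and v z z0 A :: real
  assumes e: "e \<in> l2 M" "l2_norm M e = 1" and T: "T \<in> borel_measurable (obs_space M)"
    and z: "\<bar>z\<bar> \<le> z0"
  defines "Y \<equiv> \<lambda>\<sigma> \<omega>. (\<lambda>h\<in>l2 M. B h + (W h \<omega> + \<sigma> * z * l2_inner M h e) / v)"
  shows "ennreal (4 * std_normal_density (1 + z0) * A\<^sup>2) \<le>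
    (\<integral>\<^sup>+\<omega>. ennreal ((T (Y 1 \<omega>) - A)\<^sup>2) \<partial>P) + (\<integral>\<^sup>+\<omega>. ennreal ((T (Y (- 1) \<omega>) + A)\<^sup>2) \<partial>P)"
proof -
  let ?d = "\<lambda>\<sigma> x. ennreal (std_normal_density (x - \<sigma> * z))"
  \<comment> \<open>Rebuilds the path from its noise coordinate along e and the residual. A shift of
    the signal along e changes the first argument only.\<close>
  define \<Psi> where "\<Psi> = (\<lambda>(x, r). \<lambda>h\<in>l2 M. B h + (r h + x * l2_inner M h e) / v)"
  have mPsi: "\<Psi> \<in> measurable (borel \<Otimes>\<^sub>M obs_space M) (obs_space M)"
    unfolding \<Psi>_def obs_space_def split_beta by (rule measurable_restrict) measurable
  have YPsi: "Y \<sigma> \<omega> = \<Psi> (W e \<omega> + \<sigma> * z, residual e \<omega>)" for \<sigma> \<omega>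
    by (auto simp: Y_def \<Psi>_def residual_def algebra_simps intro!: restrict_ext)
  define f where "f \<sigma> p = ennreal ((T (\<Psi> p) - \<sigma> * A)\<^sup>2)" for \<sigma> p
  have mf: "f \<sigma> \<in> borel_measurable (borel \<Otimes>\<^sub>M obs_space M)" for \<sigma>
    unfolding f_def[abs_def] using measurable_compose[OF mPsi T] by measurable
  let ?R = "distr P (obs_space M) (residual e)"
  interpret R: prob_space ?R using e by (intro prob_space_distr) simp
  have mfx: "(\<lambda>x. f \<sigma> (x, r)) \<in> borel_measurable borel" if "r \<in> space (obs_space M)" for \<sigma> r
    using mf[of \<sigma>] that by measurable
  have int: "(\<integral>\<^sup>+\<omega>. ennreal ((T (Y \<sigma> \<omega>) - \<sigma> * A)\<^sup>2) \<partial>P) =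
      (\<integral>\<^sup>+r. \<integral>\<^sup>+x. f \<sigma> (x, r) * ?d \<sigma> x \<partial>lborel \<partial>?R)" for \<sigma>
  proof -
    \<comment> \<open>Translating the real variable moves the shift into the normal density, so that
      the estimator is evaluated at the same path for both signs.\<close>
    define g where "g p = f \<sigma> (fst p + \<sigma> * z, snd p)" for p
    have "(\<lambda>p. (fst p + \<sigma> * z, snd p)) \<in> measurable (borel \<Otimes>\<^sub>M obs_space M) (borel \<Otimes>\<^sub>M obs_space M)"
      by measurable
    from measurable_compose[OF this mf[of \<sigma>]] have mg: "g \<in> borel_measurable (borel \<Otimes>\<^sub>M obs_space M)"
      unfolding g_def[abs_def] .
    have "(\<integral>\<^sup>+\<omega>. ennreal ((T (Y \<sigma> \<omega>) - \<sigma> * A)\<^sup>2) \<partial>P) = (\<integral>\<^sup>+\<omega>. g (W e \<omega>, residual e \<omega>) \<partial>P)"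
      by (simp add: g_def f_def YPsi)
    also have "\<dots> = (\<integral>\<^sup>+r. \<integral>\<^sup>+x. g (x, r) * ennreal (std_normal_density x) \<partial>lborel \<partial>?R)"
      by (rule nn_integral_W_residual[OF e mg])
    also have "\<dots> = (\<integral>\<^sup>+r. \<integral>\<^sup>+x. f \<sigma> (x, r) * ?d \<sigma> x \<partial>lborel \<partial>?R)"
    proof (rule nn_integral_cong)
      fix r assume "r \<in> space ?R"
      then have "(\<lambda>x. f \<sigma> (x, r)) \<in> borel_measurable borel" by (intro mfx) simp
      then have "(\<lambda>x. f \<sigma> (x, r) * ?d \<sigma> x) \<in> borel_measurable borel"
        by measurable
      from nn_integral_real_affine[OF this, of 1 "\<sigma> * z"]
      show "(\<integral>\<^sup>+x. g (x, r) * ennreal (std_normal_density x) \<partial>lborel) =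
          (\<integral>\<^sup>+x. f \<sigma> (x, r) * ?d \<sigma> x \<partial>lborel)"
        by (simp add: g_def add.commute)
    qed
    finally show ?thesis .
  qed
  define p where "p = std_normal_density (1 + z0)"
  have p: "p \<ge> 0" by (simp add: p_def)
  have mfr: "(\<lambda>r. \<integral>\<^sup>+x. f \<sigma> (x, r) * ?d \<sigma> x \<partial>lborel) \<in> borel_measurable ?R" for \<sigma>
  proof -
    have fm: "(\<lambda>q. f \<sigma> q * ?d \<sigma> (fst q)) \<in> borel_measurable (borel \<Otimes>\<^sub>M obs_space M)"
      using mf[of \<sigma>] by measurable
    have sw: "(\<lambda>p. (snd p, fst p)) \<in> measurable (obs_space M \<Otimes>\<^sub>M borel) (borel \<Otimes>\<^sub>M obs_space M)"
      by measurable
    have "(\<lambda>p. f \<sigma> (snd p, fst p) * ?d \<sigma> (snd p)) \<in> borel_measurable (obs_space M \<Otimes>\<^sub>M borel)"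
      using measurable_compose[OF sw fm] by simp
    then have "(\<lambda>(r, x). f \<sigma> (x, r) * ?d \<sigma> x) \<in> borel_measurable (?R \<Otimes>\<^sub>M lborel)"
      by (simp add: split_beta cong: measurable_cong_sets sets_pair_measure_cong)
    then show ?thesis using lborel.borel_measurable_nn_integral by simp
  qed
  \<comment> \<open>On [-1, 1] both shifted densities are at least p, and the two squared errors add
    up to at least 2 A^2 whatever the value t of the estimator.\<close>
  have pw: "2 * A\<^sup>2 * p * indicator {-1..1} x \<le>
      (t - 1 * A)\<^sup>2 * std_normal_density (x - 1 * z) + (t - (- 1) * A)\<^sup>2 * std_normal_density (x - (- 1) * z)" for x t
  proof (cases "x \<in> {-1..1}")
    case True
    then have "p \<le> std_normal_density (x - z)" "p \<le> std_normal_density (x + z)"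
      unfolding p_def using z by (auto intro!: std_normal_density_antimono)
    then have "(t - A)\<^sup>2 * p + (t + A)\<^sup>2 * p \<le>
        (t - A)\<^sup>2 * std_normal_density (x - z) + (t + A)\<^sup>2 * std_normal_density (x + z)"
      by (intro add_mono mult_left_mono) auto
    moreover have "(t - A)\<^sup>2 * p + (t + A)\<^sup>2 * p = 2 * A\<^sup>2 * p + 2 * t\<^sup>2 * p"
      by (simp add: power2_sum power2_diff algebra_simps)
    moreover have "2 * t\<^sup>2 * p \<ge> 0" using p by simp
    ultimately have "2 * A\<^sup>2 * p \<le>
        (t - A)\<^sup>2 * std_normal_density (x - z) + (t + A)\<^sup>2 * std_normal_density (x + z)"
      by linarith
    then show ?thesis using True by simp
  qed simp
  have inner: "ennreal (4 * p * A\<^sup>2) \<le>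
      (\<integral>\<^sup>+x. f 1 (x, r) * ?d 1 x \<partial>lborel) +
      (\<integral>\<^sup>+x. f (- 1) (x, r) * ?d (- 1) x \<partial>lborel)" if r: "r \<in> space ?R" for r
  proof -
    have m: "(\<lambda>x. f \<sigma> (x, r) * ?d \<sigma> x) \<in> borel_measurable lborel" for \<sigma>
      using mfx[of r \<sigma>] r by simp
    \<comment> \<open>The length 2 of the interval accounts for the change from 2 to 4.\<close>
    have "ennreal (4 * p * A\<^sup>2) = (\<integral>\<^sup>+x. ennreal (2 * A\<^sup>2 * p) * indicator {-1..1::real} x \<partial>lborel)"
      using p by (subst nn_integral_cmult_indicator) (auto simp: ennreal_mult'[symmetric] mult_ac simp flip: ennreal_numeral)
    also have "\<dots> \<le> (\<integral>\<^sup>+x. f 1 (x, r) * ?d 1 x +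
        f (- 1) (x, r) * ?d (- 1) x \<partial>lborel)"
    proof (rule nn_integral_mono)
      fix x :: real
      have "ennreal (2 * A\<^sup>2 * p) * indicator {-1..1} x = ennreal (2 * A\<^sup>2 * p * indicator {-1..1} x)"
        by (simp add: indicator_def)
      also have "\<dots> \<le> ennreal ((T (\<Psi> (x, r)) - 1 * A)\<^sup>2 * std_normal_density (x - 1 * z) +
          (T (\<Psi> (x, r)) - (- 1) * A)\<^sup>2 * std_normal_density (x - (- 1) * z))"
        by (intro ennreal_leI pw)
      also have "\<dots> = f 1 (x, r) * ?d 1 x +
        f (- 1) (x, r) * ?d (- 1) x"
        unfolding f_def by (subst ennreal_plus) (auto simp: ennreal_mult)
      finally show "ennreal (2 * A\<^sup>2 * p) * indicator {-1..1} x \<le> f 1 (x, r) * ?d 1 x +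
        f (- 1) (x, r) * ?d (- 1) x" .
    qed
    also have "\<dots> = (\<integral>\<^sup>+x. f 1 (x, r) * ?d 1 x \<partial>lborel) +
      (\<integral>\<^sup>+x. f (- 1) (x, r) * ?d (- 1) x \<partial>lborel)"
      by (rule nn_integral_add[OF m m])
    finally show ?thesis .
  qed
  have "ennreal (4 * p * A\<^sup>2) = (\<integral>\<^sup>+r. ennreal (4 * p * A\<^sup>2) \<partial>?R)"
    by (simp only: nn_integral_const R.emeasure_space_1 mult_1_right)
  also have "\<dots> \<le> (\<integral>\<^sup>+r. (\<integral>\<^sup>+x. f 1 (x, r) * ?d 1 x \<partial>lborel) +
      (\<integral>\<^sup>+x. f (- 1) (x, r) * ?d (- 1) x \<partial>lborel) \<partial>?R)"
    by (rule nn_integral_mono) (rule inner)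
  also have "\<dots> = (\<integral>\<^sup>+\<omega>. ennreal ((T (Y 1 \<omega>) - 1 * A)\<^sup>2) \<partial>P) +
      (\<integral>\<^sup>+\<omega>. ennreal ((T (Y (- 1) \<omega>) - (- 1) * A)\<^sup>2) \<partial>P)"
    unfolding int by (rule nn_integral_add[OF mfr mfr])
  finally show ?thesis by (simp add: p_def)
qed

end

text \<open>The bound s dominates the average over all sign vectors. Flipping coordinate j is an
  involution of the cube, so both terms on the right of \<open>flip\<close> have the same sum over
  it, whence the factor 2.\<close>

lemma Assouad_sum:
  fixes r :: "(nat \<Rightarrow> real) \<Rightarrow> nat \<Rightarrow> ennreal"
  assumes J: "finite J"
    and flip: "\<And>\<epsilon> j. \<epsilon> \<in> (\<Pi>\<^sub>E i\<in>J. {-1, 1}) \<Longrightarrow> j \<in> J \<Longrightarrow> \<kappa> \<le> r \<epsilon> j + r (\<epsilon>(j := - \<epsilon> j)) j"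
    and ub: "\<And>\<epsilon>. \<epsilon> \<in> (\<Pi>\<^sub>E i\<in>J. {-1, 1}) \<Longrightarrow> (\<Sum>j\<in>J. r \<epsilon> j) \<le> s"
  shows "of_nat (card J) * \<kappa> \<le> 2 * s"
proof -
  define E where "E = (\<Pi>\<^sub>E i\<in>J. {-1, 1::real})"
  have E: "finite E" unfolding E_def using J by (intro finite_PiE) auto
  have "E \<noteq> {}" unfolding E_def by (simp add: PiE_eq_empty_iff)
  then have cE: "card E > 0" using E by (simp add: card_gt_0_iff)
  have sw: "(\<Sum>\<epsilon>\<in>E. r (\<epsilon>(j := - \<epsilon> j)) j) = (\<Sum>\<epsilon>\<in>E. r \<epsilon> j)" if "j \<in> J" for j
    using that
    by (intro sum.reindex_bij_witness[of _ "\<lambda>\<epsilon>. \<epsilon>(j := - \<epsilon> j)" "\<lambda>\<epsilon>. \<epsilon>(j := - \<epsilon> j)"])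
       (auto simp: E_def PiE_iff extensional_def)
  have "of_nat (card E) * (of_nat (card J) * \<kappa>) = (\<Sum>j\<in>J. \<Sum>\<epsilon>\<in>E. \<kappa>)"
    by (simp add: mult.left_commute)
  also have "\<dots> \<le> (\<Sum>j\<in>J. \<Sum>\<epsilon>\<in>E. r \<epsilon> j + r (\<epsilon>(j := - \<epsilon> j)) j)"
    by (intro sum_mono flip) (auto simp: E_def)
  also have "\<dots> = (\<Sum>j\<in>J. 2 * (\<Sum>\<epsilon>\<in>E. r \<epsilon> j))"
    by (intro sum.cong refl) (simp add: sum.distrib sw mult_2)
  also have "\<dots> = 2 * (\<Sum>\<epsilon>\<in>E. \<Sum>j\<in>J. r \<epsilon> j)"
    by (simp add: sum_distrib_left[symmetric] sum.swap[of _ J E])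
  also have "\<dots> \<le> 2 * (\<Sum>\<epsilon>\<in>E. s)"
    by (intro mult_left_mono sum_mono ub) (auto simp: E_def)
  also have "\<dots> = of_nat (card E) * (2 * s)" by (simp add: mult.left_commute)
  finally have "of_nat (card E) * (of_nat (card J) * \<kappa>) \<le> of_nat (card E) * (2 * s)" .
  then show ?thesis
    using cE by (subst (asm) ennreal_mult_le_mult_iff) (auto simp: ennreal_of_nat_eq_real_of_nat)
qed

context deconvolution
begin

text \<open>Frequency j is singled out: the other frequencies form a deterministic drift, and the
  sign at j appears as a shift of the noise along \<open>phi j\<close> by
  \<open>sqrt n * A * b k j / sqrt 2\<close>. This is the shape required by the two-point
  comparison.\<close>

lemma observation_cos_poly:
  fixes \<epsilon> :: "nat \<Rightarrow> real" and A :: real and k :: 'd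
  assumes J: "J \<subseteq> {1..M}" "j \<in> J" and n: "n \<ge> 1"
  defines "f \<equiv> \<lambda>x. cos_poly M (\<lambda>i. if i \<in> J then \<epsilon> i * A else 0) (x k)"
  shows "observation a W n f \<omega> = (\<lambda>h\<in>l2 cube.
    (\<Sum>i\<in>J - {j}. \<epsilon> i * A * b k i / sqrt 2 * l2_inner cube h (\<lambda>x. phi i (x k))) +
    (W h \<omega> + \<epsilon> j * (sqrt n * A * b k j / sqrt 2) * l2_inner cube h (\<lambda>x. phi j (x k))) / sqrt n)"
  (is "_ = (\<lambda>h\<in>l2 cube. ?rhs h)")
proof -
  have e: "(\<lambda>x. phi i (x k)) \<in> l2 cube" for i by (intro l2_cube_component phi_l2)
  have finJ: "finite J" using J(1) by (rule finite_subset) simp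
  have cf: "conv a f = (\<lambda>x. \<Sum>i\<in>{1..M}. (if i \<in> J then \<epsilon> i * A else 0) * b k i / sqrt 2 * phi i (x k))"
    unfolding f_def cos_poly_def by (rule ext) (subst conv_phi_poly, auto intro!: sum.cong)
  have "l2_inner cube h (conv a f) + W h \<omega> / sqrt n = ?rhs h" if h: "h \<in> l2 cube" for h
  proof -
    have "l2_inner cube h (conv a f) =
        (\<Sum>i\<in>{1..M}. (if i \<in> J then \<epsilon> i * A else 0) * b k i / sqrt 2 * l2_inner cube h (\<lambda>x. phi i (x k)))"
      unfolding cf by (simp only: l2_inner_sum_right[OF l2_scale[OF e] h] l2_inner_scale_right)
    also have "\<dots> = (\<Sum>i\<in>J. \<epsilon> i * A * b k i / sqrt 2 * l2_inner cube h (\<lambda>x. phi i (x k)))"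
      using J(1) by (intro sum.mono_neutral_cong_right) auto
    also have "\<dots> = \<epsilon> j * A * b k j / sqrt 2 * l2_inner cube h (\<lambda>x. phi j (x k)) +
        (\<Sum>i\<in>J - {j}. \<epsilon> i * A * b k i / sqrt 2 * l2_inner cube h (\<lambda>x. phi i (x k)))"
      using finJ J(2) by (rule sum.remove)
    finally show ?thesis using n by (simp add: add_divide_distrib)
  qed
  then show ?thesis unfolding observation_def by (intro restrict_ext) auto
qed

text \<open>Bessel's inequality bounds the loss below by the squared errors of the coefficients of
  \<open>G\<close> along the frequencies in J, and each of them faces a two-point problem. The 4 of
  the two-point bound becomes 2 on averaging over signs.\<close>

theorem Assouad_risk:
  fixes A z0 :: real
  assumes G: "G \<in> estimators cube" and n: "n \<ge> 1" and J: "J \<subseteq> {1..M}" and A: "A \<ge> 0"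
    and hyp: "\<And>\<epsilon>. \<epsilon> \<in> (\<Pi>\<^sub>E i\<in>J. {-1, 1}) \<Longrightarrow>
        (\<lambda>x. cos_poly M (\<lambda>i. if i \<in> J then \<epsilon> i * A else 0) (x k)) \<in> F"
    and z: "\<And>j. j \<in> J \<Longrightarrow> sqrt n * A * b k j / sqrt 2 \<le> z0"
  shows "ennreal (2 * std_normal_density (1 + z0) * A\<^sup>2 * card J) \<le> (SUP f\<in>F. risk a P W n G f)"
proof -
  let ?S = "SUP f\<in>F. risk a P W n G f"
  define f where "f \<epsilon> = (\<lambda>x :: 'd \<Rightarrow> real. cos_poly M (\<lambda>i. if i \<in> J then \<epsilon> i * A else 0) (x k))"
      for \<epsilon> :: "nat \<Rightarrow> real"
  define e where "e j = (\<lambda>x :: 'd \<Rightarrow> real. phi j (x k))" for j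
  let ?Y = "\<lambda>\<epsilon>. observation a W n (f \<epsilon>)"
  have finJ: "finite J" using J by (rule finite_subset) simp
  have J1: "j \<ge> 1" if "j \<in> J" for j using J that by auto
  have e: "e j \<in> l2 cube" for j unfolding e_def by (intro l2_cube_component phi_l2)
  have ee: "l2_inner cube (e i) (e j) = (if i = j then 1 else 0)" if "i \<in> J" "j \<in> J" for i j
    unfolding e_def using J1 that inner_cube_components[OF phi_centred phi_centred, of i j k k]
        by (simp add: inner_phi_phi)
  have en: "l2_norm cube (e j) = 1" if "j \<in> J" for j
  proof -
    have "(l2_norm cube (e j))\<^sup>2 = 1" using ee[OF that that] by (simp add: l2_norm_eq_inner)
    then show ?thesis using l2_norm_nonneg[of cube "e j"] by (simp add: power2_eq_1_iff)
  qed
  have Gm: "G \<in> measurable (obs_space cube) (l2_borel cube)" using G by (simp add: estimators_def)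
  have Gl2: "G y \<in> l2 cube" if "y \<in> space (obs_space cube)" for y
    using measurable_space[OF Gm that] by (auto simp: l2_borel_def space_measure_of_conv)
  define T where "T j y = l2_inner cube (G y) (e j)" for j y
  have mT: "T j \<in> borel_measurable (obs_space cube)" for j
    unfolding T_def[abs_def] by (rule measurable_compose[OF Gm measurable_l2_inner[OF e]])
  define r where "r \<epsilon> j = (\<integral>\<^sup>+\<omega>. ennreal ((T j (?Y \<epsilon> \<omega>) - \<epsilon> j * A)\<^sup>2) \<partial>P)" for \<epsilon> j
  define \<kappa> where "\<kappa> = ennreal (4 * std_normal_density (1 + z0) * A\<^sup>2)"
  have obs: "?Y \<epsilon> \<omega> = (\<lambda>h\<in>l2 cube.
      (\<Sum>i\<in>J - {j}. \<epsilon> i * A * b k i / sqrt 2 * l2_inner cube h (e i)) +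
      (W h \<omega> + \<epsilon> j * (sqrt n * A * b k j / sqrt 2) * l2_inner cube h (e j)) / sqrt n)" if "j \<in> J" for \<epsilon> j \<omega>
    unfolding f_def e_def by (rule observation_cos_poly[OF J that n])
  have flip: "\<kappa> \<le> r \<epsilon> j + r (\<epsilon>(j := - \<epsilon> j)) j" if \<epsilon>: "\<epsilon> \<in> (\<Pi>\<^sub>E i\<in>J. {-1, 1})" and j: "j \<in> J" for \<epsilon> j
  proof -
    \<comment> \<open>The drift depends on the signs other than the one at j, so the members of a
      flipped pair are values of the same function \<open>R\<close>.\<close>
    define B where "B h = (\<Sum>i\<in>J - {j}. \<epsilon> i * A * b k i / sqrt 2 * l2_inner cube h (e i))" for h
    define R where "R \<sigma> = (\<integral>\<^sup>+\<omega>. ennreal ((T j (\<lambda>h\<in>l2 cube. B h +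
        (W h \<omega> + \<sigma> * (sqrt n * A * b k j / sqrt 2) * l2_inner cube h (e j)) / sqrt n) - \<sigma> * A)\<^sup>2) \<partial>P)" for \<sigma>
    have rR: "r \<eta> j = R (\<eta> j)" if "\<And>i. i \<in> J - {j} \<Longrightarrow> \<eta> i = \<epsilon> i" for \<eta>
    proof -
      have "(\<Sum>i\<in>J - {j}. \<eta> i * A * b k i / sqrt 2 * l2_inner cube h (e i)) = B h" for h
        unfolding B_def using that by (intro sum.cong) auto
      then show ?thesis unfolding r_def R_def obs[OF j] by simp
    qed
    have zb: "\<bar>sqrt n * A * b k j / sqrt 2\<bar> \<le> z0"
      using z[OF j] A b_pos[OF J1[OF j], of k] by simp
    have "\<kappa> \<le> R 1 + R (- 1)"
      unfolding \<kappa>_def R_def using two_point_bound[OF e en[OF j] mT[of j] zb, where A=A and B=B and v="sqrt n"]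
      by simp
    moreover have "\<epsilon> j = 1 \<or> \<epsilon> j = - 1" using \<epsilon> j by (auto simp: PiE_iff)
    moreover have "r \<epsilon> j = R (\<epsilon> j)" "r (\<epsilon>(j := - \<epsilon> j)) j = R (- \<epsilon> j)"
      using rR[of \<epsilon>] rR[of "\<epsilon>(j := - \<epsilon> j)"] by auto
    ultimately show ?thesis by (auto simp: add.commute)
  qed
  have ub: "(\<Sum>j\<in>J. r \<epsilon> j) \<le> ?S" if \<epsilon>: "\<epsilon> \<in> (\<Pi>\<^sub>E i\<in>J. {-1, 1})" for \<epsilon>
  proof -
    have fl2: "f \<epsilon> \<in> l2 cube" unfolding f_def
        by (intro l2_cube_component centred_l2_l2 cos_poly_centred)
    have fe: "l2_inner cube (f \<epsilon>) (e j) = \<epsilon> j * A" if "j \<in> J" for j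
    proof -
      have "l2_inner cube (f \<epsilon>) (e j) =
          l2_inner unit_ival (cos_poly M (\<lambda>i. if i \<in> J then \<epsilon> i * A else 0)) (phi j)"
        unfolding f_def e_def using inner_cube_components[OF cos_poly_centred phi_centred[OF J1[OF that]], where k=k and l=k]
        by simp
      also have "\<dots> = (\<Sum>i=1..M. (if i \<in> J then \<epsilon> i * A else 0) * (if i = j then 1 else 0))"
        using J1[OF that]
        by (subst l2_inner_commute, subst inner_phi_cos_poly)
           (auto intro!: phi_centred sum.cong simp: inner_phi_phi)
      also have "\<dots> = \<epsilon> j * A"
        using that J by (simp add: if_distrib[of "\<lambda>t. _ * t"] subset_iff cong: if_cong)
      finally show ?thesis .
    qed
    have mr: "(\<lambda>\<omega>. ennreal ((T j (?Y \<epsilon> \<omega>) - \<epsilon> j * A)\<^sup>2)) \<in> borel_measurable P" if "j \<in> J" for j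
    proof -
      have "observation a W n (f \<epsilon>) \<in> measurable P (obs_space cube)"
        unfolding observation_def[abs_def] obs_space_def by (rule measurable_restrict) measurable
      from measurable_compose[OF this mT[of j]] show ?thesis by measurable
    qed
    have "(\<Sum>j\<in>J. r \<epsilon> j) = (\<integral>\<^sup>+\<omega>. (\<Sum>j\<in>J. ennreal ((T j (?Y \<epsilon> \<omega>) - \<epsilon> j * A)\<^sup>2)) \<partial>P)"
      unfolding r_def by (rule nn_integral_sum[symmetric]) (rule mr)
    also have "\<dots> \<le> risk a P W n G (f \<epsilon>)"
      unfolding risk_def
    proof (rule nn_integral_mono)
      fix \<omega>
            have g: "G (?Y \<epsilon> \<omega>) \<in> l2 cube" by (rule Gl2[OF observation_space])
      have "(\<Sum>j\<in>J. (T j (?Y \<epsilon> \<omega>) - \<epsilon> j * A)\<^sup>2) =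
          (\<Sum>j\<in>J. (l2_inner cube (\<lambda>x. G (?Y \<epsilon> \<omega>) x - f \<epsilon> x) (e j))\<^sup>2)"
        using g fl2 e by (intro sum.cong refl) (simp add: T_def l2_inner_diff_left fe)
      also have "\<dots> \<le> (l2_norm cube (\<lambda>x. G (?Y \<epsilon> \<omega>) x - f \<epsilon> x))\<^sup>2"
        using finJ g fl2 e ee by (intro l2_Bessel l2_diff) auto
      finally show "(\<Sum>j\<in>J. ennreal ((T j (?Y \<epsilon> \<omega>) - \<epsilon> j * A)\<^sup>2)) \<le>
          ennreal ((l2_norm cube (\<lambda>x. G (?Y \<epsilon> \<omega>) x - f \<epsilon> x))\<^sup>2)"
        by (subst sum_ennreal) (auto intro: ennreal_leI)
    qed
    also have "\<dots> \<le> ?S"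
      using hyp[OF \<epsilon>] unfolding f_def by (rule SUP_upper)
    finally show ?thesis .
  qed
  have "of_nat (card J) * \<kappa> \<le> 2 * ?S"
    by (rule Assouad_sum[OF finJ flip ub])
  also have "of_nat (card J) * \<kappa> = 2 * ennreal (2 * std_normal_density (1 + z0) * A\<^sup>2 * card J)"
    by (simp add: \<kappa>_def ennreal_of_nat_eq_real_of_nat ennreal_mult'[symmetric] mult_ac flip: ennreal_numeral)
  finally show ?thesis
    by (subst (asm) ennreal_mult_le_mult_iff) auto
qed

text \<open>There are m frequencies in the octave, with weights at most
  \<open>C1 * (2 * real m) powr s\<close> and multipliers at most a constant times
  \<open>real m powr (- q k)\<close>. Hence an amplitude with A^2 = \<kappa> m^(-2s - 1) fits the
  ellipsoid, the shifts stay below \<open>z0\<close> as n \<le> m^D, and the squared distance A^2 m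
  is of the order of the rate. The constant is chosen before n, G and F, so it survives both the
  infimum over estimators and the lower limit.\<close>

theorem lower_rate_component:
  fixes s L C1 :: real and w :: "nat \<Rightarrow> real" and k :: 'd
  assumes s: "s > 0" and L: "L > 0" and C1: "C1 > 0"
    and w: "\<And>j. j \<ge> 1 \<Longrightarrow> 0 \<le> w j \<and> w j \<le> C1 * real j powr s"
  defines "\<alpha> \<equiv> 2 * s / (2 * s + 2 * q k + 1)"
  shows "\<exists>c>0. \<forall>n\<ge>1. \<forall>G\<in>estimators cube. \<forall>F.
     (\<forall>g\<in>ellipsoid w L. (\<lambda>x. g (x k)) \<in> F) \<longrightarrow>
     ennreal c \<le> ennreal (real n powr \<alpha>) * (SUP f\<in>F. risk a P W n G f)"
proof -
  let ?S = "\<lambda>n G F. SUP f\<in>F. risk a P W n G f"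
  define D where "D = 2 * s + 2 * q k + 1"
  have D: "D > 0" using s q[of k] by (simp add: D_def)
  \<comment> \<open>The solution of C1^2 (2m)^(2s) A^2 m = L^2 with A^2 = \<kappa> m^(-2s - 1); the
    power of m cancels.\<close>
  define \<kappa> where "\<kappa> = L\<^sup>2 / (C1\<^sup>2 * 4 powr s)"
  have \<kappa>: "\<kappa> > 0" using L C1 by (simp add: \<kappa>_def)
  \<comment> \<open>The squared shift n A^2 b^2 / 2 is at most \<kappa> C3^2 / 2 once n \<le>
    m^D.\<close>
  define z0 where "z0 = sqrt (\<kappa> * C3\<^sup>2 / 2)"
  define p where "p = std_normal_density (1 + z0)"
  have p: "p > 0" unfolding p_def by (rule normal_density_pos) simp
  \<comment> \<open>The factor 4^(-s) pays for rounding: m \<le> 2 \<rho> gives m^(-2s) at least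
    4^(-s) n^(-\<alpha>).\<close>
  define c where "c = 2 * p * \<kappa> * 4 powr (- s)"
  have c: "c > 0" using p \<kappa> by (simp add: c_def)
  have main: "ennreal c \<le> ennreal (real n powr \<alpha>) * ?S n G F"
    if n: "n \<ge> 1" and G: "G \<in> estimators cube" and F: "\<forall>g\<in>ellipsoid w L. (\<lambda>x. g (x k)) \<in> F" for n :: nat
        and G F
  proof -
    define \<rho> where "\<rho> = real n powr (1 / D)"
    have \<rho>1: "\<rho> \<ge> 1" using n D by (simp add: \<rho>_def ge_one_powr_ge_zero)
    \<comment> \<open>Rounding up keeps n \<le> m^D, and as \<rho> is at least 1 it costs at most a
      factor 2.\<close>
    define m where "m = nat \<lceil>\<rho>\<rceil>"
    have m: "\<rho> \<le> real m" "real m \<le> 2 * \<rho>" using \<rho>1 by (auto simp: m_def) linarith+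
    have m1: "real m \<ge> 1" using m \<rho>1 by linarith
    define J where "J = {m + 1..2 * m}"
    have cJ: "card J = m" by (simp add: J_def)
    define A where "A = sqrt (\<kappa> * real m powr (- 2 * s - 1))"
    have A2: "A\<^sup>2 = \<kappa> * real m powr (- 2 * s - 1)" and A0: "A \<ge> 0"
      using \<kappa> by (auto simp: A_def)
    have "ennreal (2 * std_normal_density (1 + z0) * A\<^sup>2 * card J) \<le> ?S n G F"
    proof (rule Assouad_risk[OF G n _ A0, where M="2 * m" and k=k])
      show "J \<subseteq> {1..2 * m}" by (auto simp: J_def)
    next
      fix \<epsilon> :: "nat \<Rightarrow> real" assume \<epsilon>: "\<epsilon> \<in> (\<Pi>\<^sub>E i\<in>J. {-1, 1})"
      have "(\<Sum>j=1..2 * m. (w j)\<^sup>2 * (if j \<in> J then \<epsilon> j * A else 0)\<^sup>2) = (\<Sum>j\<in>J. (w j)\<^sup>2 * A\<^sup>2)"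
      proof (rule sum.mono_neutral_cong_right)
        fix j assume "j \<in> J"
        then have "(\<epsilon> j)\<^sup>2 = 1" using \<epsilon> by (auto simp: PiE_iff)
        then show "(w j)\<^sup>2 * (if j \<in> J then \<epsilon> j * A else 0)\<^sup>2 = (w j)\<^sup>2 * A\<^sup>2"
          using \<open>j \<in> J\<close> by (simp add: power_mult_distrib)
      qed (auto simp: J_def)
      also have "\<dots> \<le> (\<Sum>j\<in>J. C1\<^sup>2 * (4 powr s * real m powr (2 * s)) * A\<^sup>2)"
      proof (intro sum_mono mult_right_mono)
        fix j assume j: "j \<in> J"
        then have "w j \<le> C1 * real j powr s" "0 \<le> w j" using w[of j] by (auto simp: J_def)
        moreover have "C1 * real j powr s \<le> C1 * (2 * real m) powr s"
          using j s C1 by (intro mult_left_mono powr_mono2) (auto simp: J_def)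
        ultimately have "(w j)\<^sup>2 \<le> (C1 * (2 * real m) powr s)\<^sup>2" by (intro power_mono) auto
        also have "\<dots> = C1\<^sup>2 * ((2 * real m)\<^sup>2 powr s)"
        proof -
          have "(x powr s)\<^sup>2 = x\<^sup>2 powr s" if "x \<ge> 0" for x :: real
            using that by (simp add: power2_eq_square powr_mult)
          from this[of "2 * real m"] show ?thesis by (simp only: power_mult_distrib[of C1])
        qed
        also have "(2 * real m)\<^sup>2 powr s = 4 powr s * real m powr (2 * s)"
        proof -
          have "real m powr (2 * s) = (real m powr 2) powr s" by (simp only: powr_powr)
          also have "real m powr 2 = (real m)\<^sup>2" using m1 by (simp add: powr_numeral)
          finally show ?thesis by (simp add: power_mult_distrib powr_mult)
        qed
        finally show "(w j)\<^sup>2 \<le> C1\<^sup>2 * (4 powr s * real m powr (2 * s))" .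
      qed simp
      also have "\<dots> = C1\<^sup>2 * 4 powr s * \<kappa> * (real m * real m powr (2 * s) * real m powr (- 2 * s - 1))"
        by (simp add: cJ A2)
      also have "real m * real m powr (2 * s) * real m powr (- 2 * s - 1) = 1"
      proof -
        have "real m * real m powr (2 * s) * real m powr (- 2 * s - 1) =
            real m powr (1 + 2 * s + (- 2 * s - 1))"
          using m1 by (simp only: powr_add) simp
        then show ?thesis using m1 by simp
      qed
      also have "C1\<^sup>2 * 4 powr s * \<kappa> * 1 = L\<^sup>2" using C1 by (simp add: \<kappa>_def)
      finally have "cos_poly (2 * m) (\<lambda>i. if i \<in> J then \<epsilon> i * A else 0) \<in> ellipsoid w L"
        by (rule cos_poly_ellipsoid)
      then show "(\<lambda>x. cos_poly (2 * m) (\<lambda>i. if i \<in> J then \<epsilon> i * A else 0) (x k)) \<in> F"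
        using F by (rule bspec[rotated])
    next
      fix j assume j: "j \<in> J"
      have bj: "b k j \<le> C3 * real m powr (- q k)" "b k j > 0"
      proof -
        have "b k j \<le> C3 * real j powr (- q k)" using j by (intro b_upper) (auto simp: J_def)
        also have "\<dots> \<le> C3 * real m powr (- q k)"
          using j m1 q[of k] C3 by (intro mult_left_mono powr_mono2') (auto simp: J_def)
        finally show "b k j \<le> C3 * real m powr (- q k)" .
        show "b k j > 0" using j by (intro b_pos) (auto simp: J_def)
      qed
      have nm: "real n \<le> real m powr D"
      proof -
        have "real n = \<rho> powr D" using n D by (simp add: \<rho>_def powr_powr)
        also have "\<dots> \<le> real m powr D" using m(1) \<rho>1 D by (intro powr_mono2) auto
        finally show ?thesis .
      qed
      have "(sqrt n * A * b k j / sqrt 2)\<^sup>2 = real n * A\<^sup>2 * (b k j)\<^sup>2 / 2"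
        by (simp add: power_mult_distrib power_divide)
      also have "\<dots> \<le> real m powr D * A\<^sup>2 * (C3 * real m powr (- q k))\<^sup>2 / 2"
        using nm bj A0 by (intro divide_right_mono mult_mono power_mono) auto
      also have "\<dots> = \<kappa> * C3\<^sup>2 / 2 *
          (real m powr D * real m powr (- 2 * s - 1) * (real m powr (- q k))\<^sup>2)"
        by (simp add: A2 power_mult_distrib)
      also have "real m powr D * real m powr (- 2 * s - 1) * (real m powr (- q k))\<^sup>2 = 1"
      proof -
        have "real m powr D * real m powr (- 2 * s - 1) * (real m powr (- q k))\<^sup>2
            = real m powr (D + (- 2 * s - 1) + (- q k + - q k))"
          by (simp only: powr_add power2_eq_square)
        then show ?thesis using m1 by (simp add: D_def)
      qed
      finally show "sqrt n * A * b k j / sqrt 2 \<le> z0" unfolding z0_def by (intro real_le_rsqrt) simp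
    qed
    moreover have "c * real n powr (- \<alpha>) \<le> 2 * std_normal_density (1 + z0) * A\<^sup>2 * card J"
    proof -
      have "4 powr (- s) * real n powr (- \<alpha>) = (2 * \<rho>) powr (- 2 * s)"
      proof -
        have "(2 * \<rho>) powr (- 2 * s) = 2 powr (2 * - s) * \<rho> powr (- 2 * s)"
            by (simp add: powr_mult \<rho>_def)
        also have "2 powr (2 * - s) = (4 :: real) powr (- s)" using powr_powr[of 2 2 "- s"] by simp
        also have "\<rho> powr (- 2 * s) = real n powr (- \<alpha>)" by (simp add: \<rho>_def powr_powr \<alpha>_def D_def)
        finally show ?thesis by simp
      qed
      also have "\<dots> \<le> real m powr (- 2 * s)"
        using m m1 s by (intro powr_mono2') auto
      also have "\<dots> = real m powr (- 2 * s - 1) * real m"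
        using m1 by (simp add: powr_diff)
      finally have "2 * p * \<kappa> * (4 powr (- s) * real n powr (- \<alpha>)) \<le>
          2 * p * \<kappa> * (real m powr (- 2 * s - 1) * real m)"
        using p \<kappa> by (intro mult_left_mono) auto
      then show ?thesis by (simp add: c_def A2 cJ p_def mult_ac)
    qed
    ultimately have le: "ennreal (c * real n powr (- \<alpha>)) \<le> ?S n G F"
      by (meson ennreal_leI order_trans)
    have "ennreal c = ennreal (real n powr \<alpha>) * ennreal (c * real n powr (- \<alpha>))"
      using n c by (simp add: ennreal_mult'[symmetric] powr_minus)
    also have "\<dots> \<le> ennreal (real n powr \<alpha>) * ?S n G F"
      using le by (rule mult_left_mono) simp
    finally show ?thesis .
  qed
  show ?thesis using c main by blast
qed

end

text \<open>The zero function lies in every ellipsoid and can fill the other components. So a lower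
  bound for one coordinate passes to the additive class.\<close>

lemma ellipsoid_component_oplus:
  assumes "g \<in> ellipsoid (w k) (L k)"
  shows "(\<lambda>x. g (x k)) \<in> oplus (\<lambda>k. ellipsoid (w k) (L k))"
proof -
  have zero: "(\<lambda>t. 0) \<in> ellipsoid (w l) (L l)" for l
    using cos_poly_ellipsoid[of "w l" "\<lambda>_. 0" 0 "L l"] by (simp add: cos_poly_def[abs_def])
  have "(\<lambda>x. \<Sum>l\<in>UNIV. (if l = k then g else (\<lambda>_. 0)) (x l)) \<in> oplus (\<lambda>k. ellipsoid (w k) (L k))"
    using assms zero by (intro oplusI) auto
  moreover have "(\<Sum>l\<in>UNIV. (if l = k then g else (\<lambda>_. 0)) (x l)) = g (x k)" for x :: "'a \<Rightarrow> real"
    by (subst sum.remove[of _ k]) auto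
  ultimately show ?thesis by simp
qed

theorem corollary3:
  fixes a :: "('d::finite \<Rightarrow> real) \<Rightarrow> real"
    and w b :: "'d \<Rightarrow> nat \<Rightarrow> real"
    and L s q :: "'d \<Rightarrow> real"
    and C0 C1 C2 C3 \<alpha> :: real
    and P :: "'w measure"
    and W :: "(('d \<Rightarrow> real) \<Rightarrow> real) \<Rightarrow> 'w \<Rightarrow> real"
    and F :: "(('d \<Rightarrow> real) \<Rightarrow> real) set"
  assumes L_pos: "\<And>k. L k > 0"
    and s_pos: "\<And>k. s k > 0"
    and q_nonneg: "\<And>k. q k \<ge> 0"
    and C_pos: "C0 > 0" "C1 > 0" "C2 > 0" "C3 > 0"
    and w_bounds: "\<And>k j. j \<ge> 1 \<Longrightarrow>
          C0 * real j powr s k \<le> w k j \<and> w k j \<le> C1 * real j powr s k"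
    and a_integrable: "integrable cube a"
    and a_expansion: "\<And>k. l2_sums unit_ival (\<lambda>j t. b k j * phi j t) (marginal a k)"
    and b_bounds: "\<And>k j. j \<ge> 1 \<Longrightarrow>
          C2 * real j powr (- q k) \<le> b k j \<and> b k j \<le> C3 * real j powr (- q k)"
    and F_def: "F = oplus (\<lambda>k. ellipsoid (w k) (L k))"
    and alpha_def: "\<alpha> = (MIN k. 2 * s k / (2 * s k + 2 * q k + 1))"
    and noise: "white_noise cube P W"
  shows "(\<forall>net fhat. admissible_nets w L s q net \<longrightarrow>
             (\<forall>n\<ge>1. delta_net_estimator a (net n) (fhat n)) \<longrightarrow>
             limsup (\<lambda>n. ennreal (real n powr \<alpha>) * (SUP f\<in>F. risk a P W n (fhat n) f)) < \<infinity>)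
       \<and> liminf (\<lambda>n. ennreal (real n powr \<alpha>) *
             (INF g\<in>estimators cube. SUP f\<in>F. risk a P W n g f)) > 0"
proof -
  interpret deconvolution a b P W C2 C3 q
    using assms by unfold_locales auto
  let ?S = "\<lambda>n g. SUP f\<in>F. risk a P W n g f"
  let ?r = "\<lambda>k. 2 * s k / (2 * s k + 2 * q k + 1)"
  have le: "\<alpha> \<le> ?r k" for k unfolding alpha_def by (intro Min_le) auto
  \<comment> \<open>The minimum over the finite index type is attained, and the lower bound is
    proved in this one coordinate.\<close>
  have "\<alpha> \<in> range ?r" unfolding alpha_def by (intro Min_in) auto
  then obtain k where k: "\<alpha> = ?r k" by auto
  have "0 \<le> w k j \<and> w k j \<le> C1 * real j powr s k" if "j \<ge> 1" for j
  proof -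
    have "0 \<le> C0 * real j powr s k" using C_pos(1) by simp
    with w_bounds[OF that, of k] show ?thesis by linarith
  qed
  then have "\<exists>c>0. \<forall>n\<ge>1. \<forall>G\<in>estimators cube. \<forall>F.
      (\<forall>g\<in>ellipsoid (w k) (L k). (\<lambda>x. g (x k)) \<in> F) \<longrightarrow>
      ennreal c \<le> ennreal (real n powr \<alpha>) * (SUP f\<in>F. risk a P W n G f)"
    unfolding k by (intro lower_rate_component[OF s_pos L_pos C_pos(2)])
  then obtain c where c: "c > 0" and lower: "\<forall>n\<ge>1. \<forall>G\<in>estimators cube. \<forall>F.
      (\<forall>g\<in>ellipsoid (w k) (L k). (\<lambda>x. g (x k)) \<in> F) \<longrightarrow>
      ennreal c \<le> ennreal (real n powr \<alpha>) * (SUP f\<in>F. risk a P W n G f)"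
    by (elim exE conjE)
  have in_F: "\<forall>g\<in>ellipsoid (w k) (L k). (\<lambda>x. g (x k)) \<in> F"
    unfolding F_def using ellipsoid_component_oplus by blast
  have "ennreal c \<le> ennreal (real n powr \<alpha>) * (INF g\<in>estimators cube. ?S n g)" if n: "n \<ge> 1" for n
  proof -
    have pos: "real n powr \<alpha> > 0" using n by simp
    \<comment> \<open>The power of n is divided out for each single estimator, so that the infimum
      can be taken before it is multiplied back.\<close>
    have "ennreal (c / real n powr \<alpha>) \<le> (INF g\<in>estimators cube. ?S n g)"
    proof (rule INF_greatest)
      fix G assume G: "G \<in> estimators (cube :: ('d \<Rightarrow> real) measure)"
      have "ennreal (real n powr \<alpha>) * ennreal (c / real n powr \<alpha>) = ennreal c"
        using pos by (simp add: ennreal_mult'[symmetric])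
      then have "ennreal (real n powr \<alpha>) * ennreal (c / real n powr \<alpha>) \<le>
          ennreal (real n powr \<alpha>) * ?S n G"
        using lower n G in_F by simp
      then show "ennreal (c / real n powr \<alpha>) \<le> ?S n G"
        using pos by (subst (asm) ennreal_mult_le_mult_iff) auto
    qed
    then have "ennreal (real n powr \<alpha>) * ennreal (c / real n powr \<alpha>) \<le>
        ennreal (real n powr \<alpha>) * (INF g\<in>estimators cube. ?S n g)"
      by (rule mult_left_mono) simp
    moreover have "ennreal (real n powr \<alpha>) * ennreal (c / real n powr \<alpha>) = ennreal c"
      using pos by (simp add: ennreal_mult'[symmetric])
    ultimately show ?thesis by simp
  qed
  then have "ennreal c \<le> liminf (\<lambda>n. ennreal (real n powr \<alpha>) * (INF g\<in>estimators cube. ?S n g))"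
    by (intro Liminf_bounded) (auto intro: eventually_mono[OF eventually_ge_at_top[of 1]])
  moreover have "0 < ennreal c" using c by simp
  ultimately have "liminf (\<lambda>n. ennreal (real n powr \<alpha>) * (INF g\<in>estimators cube. ?S n g)) > 0"
    by (rule order_less_le_trans[rotated])
  then show ?thesis
    unfolding F_def using upper_rate[where s=s and \<alpha>=\<alpha> and w=w and L=L] s_pos le by auto
qed

end
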